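(* Let $d\ge 3$ and, for each $N$, let $\mathcal{W}=\mathcal{W}_N\in\mathcal{S}^d(N)$ be a random tensor from the Gaussian orthogonal tensor ensemble. Let $v=v_N\in\mathbb{S}^{N-1}$ be any deterministic sequence of unit vectors. Then the empirical spectral measure of the $N\times N$ symmetric matrix $\frac{1}{\sqrt N}\,\mathcal{W}\cdot v^{d-2}$ converges weakly almost surely, as $N\to\infty$, to the semicircle distribution with density $$\rho(dx)=\frac{2}{\pi\beta_d^2}\sqrt{(\beta_d^2-x^2)^+}\,dx,$$ supported on $[-\beta_d,\beta_d]$, where $\beta_d:=2/\sqrt{d(d-1)}$, whose Stieltjes transform is $$m_d(z)=\frac{2}{\beta_d^2}\left(-z+z\sqrt{1-\frac{\beta_d^2}{z^2}}\right).$$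
   Context: $\mathcal{S}^d(N)$ denotes the space of real symmetric $d$-th order tensors of size $N\times\cdots\times N$ (entries invariant under any permutation of the indices). For $\mathcal{Y}\in\mathcal{S}^d(N)$ and $u\in\mathbb{R}^N$, the contraction $\mathcal{Y}\cdot u^p$ ($p\le d$) is the symmetric $(d-p)$-th order tensor with entries $(\mathcal{Y}\cdot u^p)_{i_{p+1}\dots i_d}=\sum_{i_1,\dots,i_p=1}^N Y_{i_1\dots i_d}u_{i_1}\cdots u_{i_p}$; in particular $\mathcal{Y}\cdot u^{d-2}$ is a symmetric $N\times N$ matrix. The Gaussian orthogonal tensor ensemble on $\mathcal{S}^d(N)$ is the law with density $f(\mathcal{W})=Z_d(N)^{-1}e^{-\frac12\|\mathcal{W}\|_F^2}$ with respect to Lebesgue measure on the independent entries, where $\|\mathcal{W}\|_F^2=\sum_{i_1,\dots,i_d}W_{i_1\dots i_d}^2$; equivalently, the entries $W_{i_1\dots i_d}$ with $i_1\le\dots\le i_d$ are independent centered Gaussians whose variance equals the reciprocal of the number of distinct permutations of $(i_1,\dots,i_d)$. The Stieltjes transform of a probability measure $\rho$ is $s_\rho(z)=\int\frac{\rho(dt)}{t-z}$, and the square root branch is the one making $m_d(z)\sim -1/z$ as $|z|\to\infty$. *)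

theory Defs
  imports "HOL-Probability.Probability" "HOL-Combinatorics.Multiset_Permutations"
    "Jordan_Normal_Form.Char_Poly"
begin

definition tensor_idx :: "nat \<Rightarrow> nat \<Rightarrow> nat list set" where
  "tensor_idx d N = {xs. length xs = d \<and> set xs \<subseteq> {..<N}}"

definition num_perms :: "nat list \<Rightarrow> nat" where
  "num_perms xs = card (permutations_of_multiset (mset xs))"

definition GOTE :: "'w measure \<Rightarrow> nat \<Rightarrow> nat \<Rightarrow> ('w \<Rightarrow> nat list \<Rightarrow> real) \<Rightarrow> bool" where
  "GOTE M d N W \<longleftrightarrow>
     (\<forall>\<omega> xs ys. xs \<in> tensor_idx d N \<and> mset ys = mset xs \<longrightarrow> W \<omega> ys = W \<omega> xs) \<and>
     prob_space.indep_vars M (\<lambda>_. borel) (\<lambda>xs \<omega>. W \<omega> xs) {xs \<in> tensor_idx d N. sorted xs} \<and>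
     (\<forall>xs \<in> {xs \<in> tensor_idx d N. sorted xs}.
        distributed M lborel (\<lambda>\<omega>. W \<omega> xs)
          (\<lambda>x. ennreal (normal_density 0 (sqrt (1 / real (num_perms xs))) x)))"

definition contract_mat :: "nat \<Rightarrow> nat \<Rightarrow> (nat list \<Rightarrow> real) \<Rightarrow> (nat \<Rightarrow> real) \<Rightarrow> real mat" where
  "contract_mat d N T v = mat N N (\<lambda>(i, j).
      \<Sum>xs \<in> tensor_idx (d - 2) N. T (xs @ [i, j]) * (\<Prod>k<length xs. v (xs ! k)))"

definition empirical_spectral_measure :: "real mat \<Rightarrow> real measure" where
  "empirical_spectral_measure A = measure_pmf (pmf_of_multiset (proots (char_poly A)))"

definition beta_d :: "nat \<Rightarrow> real" where
  "beta_d d = 2 / sqrt (real d * (real d - 1))"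

definition semicircle_d :: "nat \<Rightarrow> real measure" where
  "semicircle_d d = density lborel
     (\<lambda>x. ennreal (2 / (pi * (beta_d d)\<^sup>2) * sqrt (max 0 ((beta_d d)\<^sup>2 - x\<^sup>2))))"

text \<open>m_d(z), with the branch of the square root that makes m_d(z) ~ -1/z at infinity:
  for z outside [-beta_d, beta_d] this is the principal square root.\<close>
definition m_d :: "nat \<Rightarrow> complex \<Rightarrow> complex" where
  "m_d d z = 2 / (complex_of_real (beta_d d))\<^sup>2 *
     (- z + z * csqrt (1 - (complex_of_real (beta_d d))\<^sup>2 / z\<^sup>2))"

end

theory Submission
  imports Defs "HOL-Complex_Analysis.Complex_Analysis"
begin

text \<open>Put \<open>n = d - 2\<close>. The rescaled contraction is a real symmetric matrix \<open>H\<close> that is linear in the independent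
  Gaussian entries, with covariance
  \<open>1/(N d(d-1)) (\<delta>\<^sub>i\<^sub>k \<delta>\<^sub>j\<^sub>l + \<delta>\<^sub>i\<^sub>l \<delta>\<^sub>j\<^sub>k)\<close> plus terms that carry factors of \<open>v\<close>. For the
  resolvent \<open>R = (H - z)\<^sup>-\<^sup>1\<close>, its normalised trace \<open>s\<close> and \<open>D = s - m\<close>, where \<open>m\<close> solves the
  quadratic equation \<open>1 + z m + m\<^sup>2/(d(d-1)) = 0\<close> of the semicircle, Gaussian integration by parts in
  \<open>E[cnj D tr(H R)/N]\<close> yields the self-consistent equation and the variance bound in one stroke:
  for \<open>z = \<i> y\<close> with \<open>y \<ge> 2\<close> the quadratic map is contracting and \<open>E |D|\<^sup>2 = O(N\<^sup>-\<^sup>2)\<close>. This is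
  summable, so no independence between different \<open>N\<close> is needed for almost sure convergence.

  Values of the Stieltjes transform on the imaginary axis suffice for weak convergence: their
  derivatives give the integrals of \<open>(t - \<i> y)\<^sup>-\<^sup>k\<close>, and
  \<open>(1 + \<i> s t/k)\<^sup>-\<^sup>k\<close> tends to \<open>exp(- \<i> s t)\<close>, so characteristic functions converge.\<close>

section \<open>Covariance of the contraction\<close>

text \<open>The entries of the contraction are correlated along \<open>v\<close>, so the proof
  cannot treat them as independent. Integration by parts consumes only their covariance, and every
  term that carries \<open>v\<close> collapses to a bilinear form controlled by the operator norm of
  \<open>R\<close>. The weight \<open>cnj D\<close> is chosen because, with z = \<i> y and q =
  d(d-1), the equation for \<open>m\<close> gives z D = (1 + z s) + m^2/q: tested against
  \<open>cnj D\<close>, the left side is z times the second moment that is wanted, while the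
  derivative that falls on \<open>cnj D\<close> itself costs a further factor 1/N. The quadratic
  does not determine \<open>m\<close>; the root is selected by |m| <= 1/y, which holds because
  \<open>m_d\<close> is the Stieltjes transform of a probability measure. Exceptional null sets are
  collected for rational y, and uniform Lipschitz dependence on y covers the others. Large y
  suffices in the end: characteristic functions are approximated by kernels at heights k/s and sqrt
  k / s, both of which grow with k.\<close>

text \<open>A multiset is read as the monomial in variables \<open>x\<^sub>i\<close> with these exponents, evaluated at \<open>v\<close>;
  removing an element with its multiplicity is then a partial derivative, and the product rule
  replaces the enumeration of permutations of positions.\<close>

definition mset_monom :: "(nat \<Rightarrow> real) \<Rightarrow> nat multiset \<Rightarrow> real" where
  "mset_monom v A = (\<Prod>x\<in>#A. v x)"

definition mset_monom_d1 :: "(nat \<Rightarrow> real) \<Rightarrow> nat \<Rightarrow> nat multiset \<Rightarrow> real" where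
  "mset_monom_d1 v l A = real (count A l) * mset_monom v (A - {#l#})"

definition mset_monom_d2 :: "(nat \<Rightarrow> real) \<Rightarrow> nat \<Rightarrow> nat \<Rightarrow> nat multiset \<Rightarrow> real" where
  "mset_monom_d2 v k l A = real (count A k) * mset_monom_d1 v l (A - {#k#})"

lemma mset_monom_add [simp]: "mset_monom v (add_mset x A) = v x * mset_monom v A"
  by (simp add: mset_monom_def)

lemma mset_monom_empty [simp]: "mset_monom v {#} = 1"
  by (simp add: mset_monom_def)

lemma mset_monom_d1_empty [simp]: "mset_monom_d1 v l {#} = 0"
  by (simp add: mset_monom_d1_def)

lemma mset_monom_d2_empty [simp]: "mset_monom_d2 v k l {#} = 0"
  by (simp add: mset_monom_d2_def)

lemma mset_monom_d1_add:
  "mset_monom_d1 v l (add_mset x A) = (if x = l then mset_monom v A else 0) + v x * mset_monom_d1 v l A"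
proof (cases "x = l")
  case True
  show ?thesis
  proof (cases "l \<in># A")
    case l: True
    then obtain A' where A': "A = add_mset l A'" by (meson multi_member_split)
    show ?thesis using True by (simp add: mset_monom_d1_def A' algebra_simps)
  next
    case False
    then have "count A l = 0" by (simp add: count_eq_zero_iff)
    then show ?thesis using True by (simp add: mset_monom_d1_def)
  qed
next
  case False
  then have "add_mset x A - {#l#} = add_mset x (A - {#l#})"
    by simp
  then show ?thesis using False by (simp add: mset_monom_d1_def)
qed

text \<open>Euler's relation: x_l times the partial derivative multiplies a monomial by its degree
  in x_l. The factor \<open>count A l\<close> on both sides covers an absent \<open>l\<close>, whose
  removal leaves \<open>A\<close> unchanged.\<close>

lemma count_mult_mset_monom_remove:
  "real (count A l) * (v l * mset_monom v (A - {#l#})) = real (count A l) * mset_monom v A"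
proof (cases "l \<in># A")
  case True
  then obtain A' where "A = add_mset l A'" by (meson multi_member_split)
  then show ?thesis by simp
qed (simp add: count_eq_zero_iff)

text \<open>Leibniz rule for a linear factor times a monomial: either derivative may fall on the
  factor, but not both. If k = l = x, both conditionals fire and give the doubled cross
  term.\<close>

lemma mset_monom_d2_add:
  "mset_monom_d2 v k l (add_mset x A) = (if x = k then mset_monom_d1 v l A else 0)
     + (if x = l then mset_monom_d1 v k A else 0) + v x * mset_monom_d2 v k l A"
proof (cases "x = k")
  case True
  show ?thesis
  proof (cases "k \<in># A")
    case k: True
    then obtain A' where A': "A = add_mset k A'" by (meson multi_member_split)
    show ?thesis using True
      by (simp add: mset_monom_d2_def mset_monom_d1_add A')
         (use count_mult_mset_monom_remove[of A' k v] in \<open>auto simp: mset_monom_d1_def algebra_simps\<close>)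
  next
    case False
    then have "count A k = 0" by (simp add: count_eq_zero_iff)
    then show ?thesis using True by (auto simp: mset_monom_d2_def mset_monom_d1_def[of v k] mset_monom_d1_def[of v l])
  qed
next
  case False
  then have "add_mset x A - {#k#} = add_mset x (A - {#k#})"
    by simp
  then show ?thesis using False
    by (auto simp: mset_monom_d2_def mset_monom_d1_add mset_monom_d1_def[of v k] algebra_simps)
qed

lemma finite_tensor_idx [simp]: "finite (tensor_idx n N)"
  using finite_lists_length_eq[of "{..<N}" n] by (simp add: tensor_idx_def conj_commute)

lemma tensor_idx_0: "tensor_idx 0 N = {[]}"
  by (auto simp: tensor_idx_def)

lemma sum_tensor_idx_Suc:
  "(\<Sum>xs\<in>tensor_idx (Suc n) N. f xs) = (\<Sum>x<N. \<Sum>xs\<in>tensor_idx n N. f (x # xs))"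
proof -
  have eq: "tensor_idx (Suc n) N = (\<lambda>(x, xs). x # xs) ` ({..<N} \<times> tensor_idx n N)"
    by (auto simp: tensor_idx_def length_Suc_conv image_iff)
  have "inj_on (\<lambda>(x, xs). x # xs) ({..<N} \<times> tensor_idx n N)"
    by (auto simp: inj_on_def)
  then show ?thesis
    unfolding eq by (subst sum.reindex) (auto simp: sum.cartesian_product case_prod_unfold)
qed

lemma prod_nth_eq_mset_monom: "(\<Prod>k<length xs. v (xs ! k)) = mset_monom v (mset xs)"
  by (induction xs) (simp_all add: prod.lessThan_Suc_shift del: prod.lessThan_Suc)

text \<open>The covariance of the entries \<open>(i,j)\<close> and \<open>(k,l)\<close> of the contraction of a tensor of order \<open>n + 2\<close>.\<close>

definition contr_cov :: "(nat \<Rightarrow> real) \<Rightarrow> nat \<Rightarrow> nat \<Rightarrow> nat \<Rightarrow> nat \<Rightarrow> nat \<Rightarrow> real" where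
  "contr_cov v n i j k l =
     ((if i = k \<and> j = l then 1 else 0) + (if i = l \<and> j = k then 1 else 0)
      + real n * ((if i = k then v j * v l else 0) + (if i = l then v j * v k else 0)
         + (if j = k then v i * v l else 0) + (if j = l then v i * v k else 0))
      + real n * (real n - 1) * v i * v j * v k * v l) / ((real n + 2) * (real n + 1))"

context
  fixes v :: "nat \<Rightarrow> real" and N :: nat
  assumes unit: "(\<Sum>i<N. (v i)\<^sup>2) = 1"
begin

text \<open>Expanding (v . x)^n over index lists shows that this sum and the next two are its value,
  gradient and Hessian at x = v, where all powers of |v| are 1.\<close>

lemma sum_mset_monom:
  "(\<Sum>xs\<in>tensor_idx n N. mset_monom v (mset xs) * mset_monom v (mset xs)) = 1"
proof (induction n)
  case (Suc n)
  have "(\<Sum>xs\<in>tensor_idx (Suc n) N. mset_monom v (mset xs) * mset_monom v (mset xs))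
     = (\<Sum>x<N. (v x)\<^sup>2 * (\<Sum>xs\<in>tensor_idx n N. mset_monom v (mset xs) * mset_monom v (mset xs)))"
    by (simp add: sum_tensor_idx_Suc sum_distrib_left power2_eq_square algebra_simps)
  then show ?case using unit by (simp add: Suc)
qed (simp add: tensor_idx_0)

lemma sum_mset_monom_d1:
  assumes "l < N"
  shows "(\<Sum>xs\<in>tensor_idx n N. mset_monom v (mset xs) * mset_monom_d1 v l (mset xs)) = real n * v l"
proof (induction n)
  case (Suc n)
  let ?e = "\<lambda>xs. mset_monom v (mset xs)"
  have "(\<Sum>xs\<in>tensor_idx (Suc n) N. ?e xs * mset_monom_d1 v l (mset xs))
     = (\<Sum>x<N. (if x = l then v x * (\<Sum>xs\<in>tensor_idx n N. ?e xs * ?e xs) else 0)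
         + (v x)\<^sup>2 * (\<Sum>xs\<in>tensor_idx n N. ?e xs * mset_monom_d1 v l (mset xs)))"
    unfolding sum_tensor_idx_Suc
    by (intro sum.cong refl)
       (auto simp: mset_monom_d1_add sum_distrib_left power2_eq_square sum.distrib[symmetric]
          algebra_simps intro!: sum.cong)
  also have "\<dots> = v l + real n * v l"
    using assms unit by (simp add: sum.distrib Suc sum_mset_monom flip: sum_distrib_right)
  finally show ?case by (simp add: algebra_simps)
qed (simp add: tensor_idx_0)

lemma sum_mset_monom_d2:
  assumes "k < N" "l < N"
  shows "(\<Sum>xs\<in>tensor_idx n N. mset_monom v (mset xs) * mset_monom_d2 v k l (mset xs))
    = real n * (real n - 1) * v k * v l"
proof (induction n)
  case (Suc n)
  let ?e = "\<lambda>xs. mset_monom v (mset xs)"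
  have "(\<Sum>xs\<in>tensor_idx (Suc n) N. ?e xs * mset_monom_d2 v k l (mset xs))
     = (\<Sum>x<N. (if x = k then v x * (\<Sum>xs\<in>tensor_idx n N. ?e xs * mset_monom_d1 v l (mset xs)) else 0)
         + (if x = l then v x * (\<Sum>xs\<in>tensor_idx n N. ?e xs * mset_monom_d1 v k (mset xs)) else 0)
         + (v x)\<^sup>2 * (\<Sum>xs\<in>tensor_idx n N. ?e xs * mset_monom_d2 v k l (mset xs)))"
    unfolding sum_tensor_idx_Suc
    by (intro sum.cong refl)
       (auto simp: mset_monom_d2_add sum_distrib_left power2_eq_square sum.distrib[symmetric]
          algebra_simps intro!: sum.cong)
  also have "\<dots> = 2 * real n * v k * v l + real n * (real n - 1) * v k * v l"
    using assms unit by (simp add: sum.distrib Suc sum_mset_monom_d1 flip: sum_distrib_right)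
  finally show ?case by (simp add: algebra_simps)
qed (simp add: tensor_idx_0)

text \<open>The same Hessian for x_i x_j (v . x)^n: the product rule for the two appended indices
  leaves only the sums already computed. The denominator counts ordered pairs of positions among n +
  2.\<close>

lemma sum_mset_monom_d2_pair:
  assumes "i < N" "j < N" "k < N" "l < N"
  shows "(\<Sum>xs\<in>tensor_idx n N. mset_monom v (mset xs) * mset_monom_d2 v k l (mset (xs @ [i, j])))
     / ((real n + 2) * (real n + 1)) = contr_cov v n i j k l"
proof -
  let ?e = "\<lambda>xs. mset_monom v (mset xs)"
  let ?S0 = "\<Sum>xs\<in>tensor_idx n N. ?e xs * ?e xs"
  let ?S1 = "\<lambda>l. \<Sum>xs\<in>tensor_idx n N. ?e xs * mset_monom_d1 v l (mset xs)"
  let ?S2 = "\<Sum>xs\<in>tensor_idx n N. ?e xs * mset_monom_d2 v k l (mset xs)"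
  have "(\<Sum>xs\<in>tensor_idx n N. mset_monom v (mset xs) * mset_monom_d2 v k l (mset (xs @ [i, j])))
    = (if i = k \<and> j = l then 1 else 0) * ?S0 + (if i = l \<and> j = k then 1 else 0) * ?S0
      + (if i = k then v j else 0) * ?S1 l + (if i = l then v j else 0) * ?S1 k
      + (if j = k then v i else 0) * ?S1 l + (if j = l then v i else 0) * ?S1 k
      + v i * v j * ?S2"
    unfolding sum_distrib_left sum.distrib[symmetric]
    by (intro sum.cong refl) (auto simp: mset_monom_d2_add mset_monom_d1_add algebra_simps)
  also have "\<dots> = (if i = k \<and> j = l then 1 else 0) + (if i = l \<and> j = k then 1 else 0)
      + real n * ((if i = k then v j * v l else 0) + (if i = l then v j * v k else 0)
         + (if j = k then v i * v l else 0) + (if j = l then v i * v k else 0))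
      + real n * (real n - 1) * v i * v j * v k * v l"
    using assms unfolding sum_mset_monom sum_mset_monom_d1[OF \<open>k < N\<close>] sum_mset_monom_d1[OF \<open>l < N\<close>] sum_mset_monom_d2[OF \<open>k < N\<close> \<open>l < N\<close>]
    by (simp add: algebra_simps)
  finally show ?thesis by (simp add: contr_cov_def)
qed

text \<open>Among the orderings of \<open>A\<close>, the fraction ending in \<open>k, l\<close> is
  \<open>count A k\<close> times \<open>count (A - {#k#}) l\<close> over (n + 2)(n + 1), and all of
  them carry the same monomial. If \<open>k\<close> and \<open>l\<close> cannot both be removed from
  \<open>A\<close>, both sides vanish.\<close>

lemma sum_same_mset:
  assumes "size A = n + 2" "set_mset A \<subseteq> {..<N}"
  shows "(\<Sum>ys\<in>tensor_idx n N. if mset (ys @ [k, l]) = A then mset_monom v (mset ys) else 0)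
     = real (card (permutations_of_multiset A)) * mset_monom_d2 v k l A / ((real n + 2) * (real n + 1))"
proof (cases "k \<in># A \<and> l \<in># A - {#k#}")
  case True
  then obtain A1 A' where "A = add_mset k A1" "A1 = add_mset l A'"
    by (metis add_mset_remove_trivial multi_member_split)
  then have A: "A = add_mset k (add_mset l A')" by simp
  have eq: "{ys \<in> tensor_idx n N. mset (ys @ [k, l]) = A} = permutations_of_multiset A'"
    using assms by (auto simp: tensor_idx_def A permutations_of_multiset_def add_mset_commute
       simp flip: size_mset set_mset_mset)
  have "(\<Sum>ys\<in>tensor_idx n N. if mset (ys @ [k, l]) = A then mset_monom v (mset ys) else 0)
      = (\<Sum>ys\<in>permutations_of_multiset A'. mset_monom v (mset ys))"
    by (subst sum.inter_filter[symmetric]) (simp_all only: finite_tensor_idx eq)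
  also have "\<dots> = real (card (permutations_of_multiset A')) * mset_monom v A'"
    by (simp add: permutations_of_multiset_def)
  finally have lhs: "(\<Sum>ys\<in>tensor_idx n N. if mset (ys @ [k, l]) = A then mset_monom v (mset ys) else 0)
     = real (card (permutations_of_multiset A')) * mset_monom v A'" .
  let ?A1 = "add_mset l A'"
  have "card (permutations_of_multiset A) * count A k = (n + 2) * card (permutations_of_multiset ?A1)"
    using card_permutations_of_multiset_remove_aux[of k A] assms by (simp add: A)
  then have "real (card (permutations_of_multiset A) * count A k) = real ((n + 2) * card (permutations_of_multiset ?A1))"
    by (simp only:)
  then have 1: "real (card (permutations_of_multiset A)) * real (count A k) = (real n + 2) * real (card (permutations_of_multiset ?A1))"
    by (simp add: algebra_simps)
  have "card (permutations_of_multiset ?A1) * count ?A1 l = (n + 1) * card (permutations_of_multiset A')"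
    using card_permutations_of_multiset_remove_aux[of l ?A1] assms by (simp add: A)
  then have "real (card (permutations_of_multiset ?A1) * count ?A1 l) = real ((n + 1) * card (permutations_of_multiset A'))"
    by (simp only:)
  then have 2: "real (card (permutations_of_multiset ?A1)) * real (count ?A1 l) = (real n + 1) * real (card (permutations_of_multiset A'))"
    by (simp add: algebra_simps)
  have "real (card (permutations_of_multiset A)) * mset_monom_d2 v k l A
      = (real (card (permutations_of_multiset A)) * real (count A k)) * real (count ?A1 l) * mset_monom v A'"
    by (simp add: mset_monom_d2_def mset_monom_d1_def A)
  also have "\<dots> = (real n + 2) * (real (card (permutations_of_multiset ?A1)) * real (count ?A1 l)) * mset_monom v A'"
    unfolding 1 by (simp only: mult.assoc)
  also have "\<dots> = (real n + 2) * (real n + 1) * (real (card (permutations_of_multiset A')) * mset_monom v A')"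
    unfolding 2 by (simp only: mult.assoc)
  finally have r: "real (card (permutations_of_multiset A)) * mset_monom_d2 v k l A
     = (real n + 2) * (real n + 1) * (real (card (permutations_of_multiset A')) * mset_monom v A')" .
  have "(real n + 2) * (real n + 1) \<noteq> 0"
    by (simp add: add_nonneg_eq_0_iff)
  then show ?thesis unfolding lhs r by simp
next
  case False
  have "mset (ys @ [k, l]) \<noteq> A" for ys
    using False by (auto simp: add_mset_commute)
  moreover have "real (count A k) = 0 \<or> real (count (A - {#k#}) l) = 0"
    using False by (metis count_eq_zero_iff of_nat_0)
  then have "mset_monom_d2 v k l A = 0"
    unfolding mset_monom_d2_def mset_monom_d1_def by (elim disjE) (simp_all only: mult_zero_left mult_zero_right)
  ultimately show ?thesis by simp
qed

end

text \<open>The coefficient of the independent entry \<open>W I\<close> at position (i, j) of the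
  contraction. Independent entries are indexed by sorted lists, so each permutation orbit of index
  lists is pooled.\<close>

definition contr_coeff :: "nat \<Rightarrow> nat \<Rightarrow> (nat \<Rightarrow> real) \<Rightarrow> nat list \<Rightarrow> nat \<Rightarrow> nat \<Rightarrow> real" where
  "contr_coeff n N v I i j =
     (\<Sum>xs\<in>tensor_idx n N. if sort (xs @ [i, j]) = I then mset_monom v (mset xs) else 0)"

lemma sort_eq_iff: "sort xs = sort ys \<longleftrightarrow> mset xs = mset (ys :: 'a :: linorder list)"
  by (metis mset_sort sorted_list_of_multiset_mset)

lemma contr_coeff_sym: "contr_coeff n N v I i j = contr_coeff n N v I j i"
proof -
  have "sort (xs @ [i, j]) = sort (xs @ [j, i])" for xs
    by (simp add: sort_eq_iff add_mset_commute)
  then show ?thesis by (simp add: contr_coeff_def)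
qed

text \<open>Serves twice: with \<open>g\<close> the random tensor, to write the contraction in
  independent variables, and with \<open>g\<close> a coefficient over \<open>num_perms\<close>, to
  compute the covariance.\<close>

lemma sum_contr_coeff:
  assumes "i < N" "j < N"
  shows "(\<Sum>xs\<in>tensor_idx n N. g (sort (xs @ [i, j])) * mset_monom v (mset xs))
     = (\<Sum>I\<in>{xs \<in> tensor_idx (n + 2) N. sorted xs}. g I * contr_coeff n N v I i j)"
proof -
  let ?S = "{xs \<in> tensor_idx (n + 2) N. sorted xs}"
  have in_S: "sort (xs @ [i, j]) \<in> ?S" if "xs \<in> tensor_idx n N" for xs
    using that assms by (auto simp: tensor_idx_def)
  have "(\<Sum>I\<in>?S. g I * contr_coeff n N v I i j)
    = (\<Sum>xs\<in>tensor_idx n N. \<Sum>I\<in>?S. if sort (xs @ [i, j]) = I then g I * mset_monom v (mset xs) else 0)"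
    unfolding contr_coeff_def sum_distrib_left
    by (subst sum.swap) (intro sum.cong refl, simp)
  also have "\<dots> = (\<Sum>xs\<in>tensor_idx n N. g (sort (xs @ [i, j])) * mset_monom v (mset xs))"
    using in_S by (intro sum.cong refl) simp
  finally show ?thesis by simp
qed

lemma num_perms_pos: "num_perms xs > 0"
proof -
  have "xs \<in> permutations_of_multiset (mset xs)" by (simp add: permutations_of_multiset_def)
  then show ?thesis unfolding num_perms_def card_gt_0_iff by auto
qed

text \<open>The variance of \<open>W I\<close> is the reciprocal of its orbit size and cancels the
  orbit size produced by \<open>sum_same_mset\<close>; what remains is the Hessian of
  \<open>sum_mset_monom_d2_pair\<close>.\<close>

lemma sum_contr_coeff_cov:
  assumes unit: "(\<Sum>i<N. (v i)\<^sup>2) = 1" and "i < N" "j < N" "k < N" "l < N"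
  shows "(\<Sum>I\<in>{xs \<in> tensor_idx (n + 2) N. sorted xs}.
      contr_coeff n N v I i j * contr_coeff n N v I k l / real (num_perms I)) = contr_cov v n i j k l"
proof -
  let ?S = "{xs \<in> tensor_idx (n + 2) N. sorted xs}"
  have "(\<Sum>I\<in>?S. contr_coeff n N v I i j * contr_coeff n N v I k l / real (num_perms I))
      = (\<Sum>I\<in>?S. (contr_coeff n N v I k l / real (num_perms I)) * contr_coeff n N v I i j)"
    by (simp add: algebra_simps)
  also have "\<dots> = (\<Sum>xs\<in>tensor_idx n N. contr_coeff n N v (sort (xs @ [i, j])) k l
       / real (num_perms (sort (xs @ [i, j]))) * mset_monom v (mset xs))"
    using sum_contr_coeff[OF assms(2,3), where g = "\<lambda>I. contr_coeff n N v I k l / real (num_perms I)" and n = n and v = v] by simp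
  also have "\<dots> = (\<Sum>xs\<in>tensor_idx n N. mset_monom v (mset xs) *
       mset_monom_d2 v k l (mset (xs @ [i, j])) / ((real n + 2) * (real n + 1)))"
  proof (intro sum.cong refl)
    fix xs assume xs: "xs \<in> tensor_idx n N"
    let ?A = "mset (xs @ [i, j])"
    have A: "size ?A = n + 2" "set_mset ?A \<subseteq> {..<N}"
      using xs assms by (auto simp: tensor_idx_def)
    have np: "real (num_perms (sort (xs @ [i, j]))) = real (card (permutations_of_multiset ?A))"
      by (simp add: num_perms_def)
    have np0: "real (card (permutations_of_multiset ?A)) \<noteq> 0"
      using num_perms_pos[of "xs @ [i, j]"] by (simp add: num_perms_def)
    have "contr_coeff n N v (sort (xs @ [i, j])) k l
      = real (card (permutations_of_multiset ?A)) * mset_monom_d2 v k l ?A / ((real n + 2) * (real n + 1))"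
      unfolding contr_coeff_def sort_eq_iff by (rule sum_same_mset[OF unit A])
    then show "contr_coeff n N v (sort (xs @ [i, j])) k l
       / real (num_perms (sort (xs @ [i, j]))) * mset_monom v (mset xs)
      = mset_monom v (mset xs) * mset_monom_d2 v k l ?A / ((real n + 2) * (real n + 1))"
      unfolding np using np0 by simp
  qed
  also have "\<dots> = contr_cov v n i j k l"
    unfolding sum_divide_distrib[symmetric] by (rule sum_mset_monom_d2_pair[OF assms])
  finally show ?thesis .
qed

section \<open>Resolvents of real symmetric matrices\<close>

text \<open>Matrices are functions of two indices, of which only those below N matter: associativity
  then holds without dimension conditions, and calculus and measurability concern single
  entries.\<close>

definition mat_prod :: "nat \<Rightarrow> (nat \<Rightarrow> nat \<Rightarrow> complex) \<Rightarrow> (nat \<Rightarrow> nat \<Rightarrow> complex) \<Rightarrow> nat \<Rightarrow> nat \<Rightarrow> complex" where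
  "mat_prod N A B i j = (\<Sum>k<N. A i k * B k j)"

definition vec_norm :: "nat \<Rightarrow> (nat \<Rightarrow> complex) \<Rightarrow> real" where
  "vec_norm N x = L2_set (\<lambda>i. cmod (x i)) {..<N}"

definition shift_mat :: "nat \<Rightarrow> complex \<Rightarrow> (nat \<Rightarrow> nat \<Rightarrow> real) \<Rightarrow> complex mat" where
  "shift_mat N z H = mat N N (\<lambda>(i, j). (if i = j then z else 0) - complex_of_real (H i j))"

text \<open>The inverse of H - z in adjugate form. \<open>shift_mat\<close> is z - H, the sign of
  the characteristic polynomial, hence the leading minus. The function is total, with entries that
  are rational in those of \<open>H\<close>.\<close>

definition resolvent :: "nat \<Rightarrow> complex \<Rightarrow> (nat \<Rightarrow> nat \<Rightarrow> real) \<Rightarrow> nat \<Rightarrow> nat \<Rightarrow> complex" where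
  "resolvent N z H i j = - (adj_mat (shift_mat N z H) $$ (i, j) / Determinant.det (shift_mat N z H))"

definition minus_shift :: "complex \<Rightarrow> (nat \<Rightarrow> nat \<Rightarrow> real) \<Rightarrow> nat \<Rightarrow> nat \<Rightarrow> complex" where
  "minus_shift z H i j = complex_of_real (H i j) - (if i = j then z else 0)"

lemma shift_mat_carrier [simp]: "shift_mat N z H \<in> carrier_mat N N"
  by (simp add: shift_mat_def)

lemma vec_norm_nonneg [simp]: "vec_norm N x \<ge> 0"
  by (simp add: vec_norm_def L2_set_nonneg)

lemma vec_norm_sq: "(vec_norm N x)\<^sup>2 = (\<Sum>i<N. (cmod (x i))\<^sup>2)"
  by (simp add: vec_norm_def L2_set_def sum_nonneg)

lemma cmod_le_vec_norm: "i < N \<Longrightarrow> cmod (x i) \<le> vec_norm N x"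
  unfolding vec_norm_def by (rule member_le_L2_set) auto

lemma norm_sum_mult_le_vec_norm: "cmod (\<Sum>i<N. x i * y i) \<le> vec_norm N x * vec_norm N y"
proof -
  have "cmod (\<Sum>i<N. x i * y i) \<le> (\<Sum>i<N. \<bar>cmod (x i)\<bar> * \<bar>cmod (y i)\<bar>)"
    by (rule order_trans[OF norm_sum]) (simp add: norm_mult)
  also have "\<dots> \<le> vec_norm N x * vec_norm N y"
    unfolding vec_norm_def by (rule L2_set_mult_ineq)
  finally show ?thesis .
qed

lemma vec_norm_unit: "j < N \<Longrightarrow> vec_norm N (\<lambda>i. if i = j then 1 else 0) = 1"
  by (simp add: vec_norm_def L2_set_def if_distrib[where f = cmod] if_distrib[where f = "\<lambda>x. x\<^sup>2"] cong: if_cong)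

lemma vec_norm_cong: "(\<And>i. i < N \<Longrightarrow> x i = y i) \<Longrightarrow> vec_norm N x = vec_norm N y"
  unfolding vec_norm_def by (intro L2_set_cong) auto

lemma mat_prod_cong:
  "(\<And>k. k < N \<Longrightarrow> A i k = A' i k) \<Longrightarrow> (\<And>k. k < N \<Longrightarrow> B k j = B' k j) \<Longrightarrow> mat_prod N A B i j = mat_prod N A' B' i j"
  unfolding mat_prod_def by (intro sum.cong) auto

lemma mat_prod_assoc: "mat_prod N (mat_prod N A B) C = mat_prod N A (mat_prod N B C)"
  unfolding mat_prod_def sum_distrib_left sum_distrib_right
  by (intro ext, subst sum.swap) (simp add: mult.assoc)

lemma mat_prod_diff_left: "mat_prod N (\<lambda>i j. A i j - B i j) C i j = mat_prod N A C i j - mat_prod N B C i j"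
  by (simp add: mat_prod_def left_diff_distrib sum_subtractf)

lemma mat_prod_diff_right: "mat_prod N C (\<lambda>i j. A i j - B i j) i j = mat_prod N C A i j - mat_prod N C B i j"
  by (simp add: mat_prod_def right_diff_distrib sum_subtractf)

context
  fixes N :: nat and H :: "nat \<Rightarrow> nat \<Rightarrow> real"
  assumes sym: "\<And>i j. i < N \<Longrightarrow> j < N \<Longrightarrow> H i j = H j i"
begin

text \<open>The quadratic form of a real symmetric matrix is real, so <x, (H - z) x> has imaginary
  part - Im z |x|^2; Cauchy-Schwarz bounds it by |x| |(H - z) x|.\<close>

lemma vec_norm_minus_shift_ge:
  "\<bar>Im z\<bar> * vec_norm N x \<le> vec_norm N (\<lambda>i. \<Sum>j<N. minus_shift z H i j * x j)"
proof -
  let ?w = "\<lambda>i. \<Sum>j<N. minus_shift z H i j * x j"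
  define q where "q = (\<Sum>i<N. \<Sum>j<N. complex_of_real (H i j) * (cnj (x i) * x j))"
  have "cnj q = (\<Sum>i<N. \<Sum>j<N. complex_of_real (H i j) * (cnj (x j) * x i))"
    by (simp add: q_def mult.commute)
  also have "\<dots> = (\<Sum>j<N. \<Sum>i<N. complex_of_real (H i j) * (cnj (x j) * x i))"
    by (rule sum.swap)
  also have "\<dots> = q"
    unfolding q_def by (intro sum.cong refl) (simp add: sym)
  finally have q: "Im q = 0" by (simp add: complex_eq_iff)
  have w: "?w i = (\<Sum>j<N. complex_of_real (H i j) * x j) - z * x i" if "i < N" for i
    using that by (simp add: minus_shift_def left_diff_distrib sum_subtractf if_distrib[of "\<lambda>c. c * _"] cong: if_cong)
  have "(\<Sum>i<N. cnj (x i) * ?w i) = q - z * (\<Sum>i<N. cnj (x i) * x i)"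
    by (simp add: w q_def right_diff_distrib sum_subtractf sum_distrib_left mult.left_commute mult.assoc)
  also have "(\<Sum>i<N. cnj (x i) * x i) = complex_of_real ((vec_norm N x)\<^sup>2)"
    unfolding vec_norm_sq of_real_sum
    by (intro sum.cong refl) (metis complex_norm_square mult.commute)
  finally have "(\<Sum>i<N. cnj (x i) * ?w i) = q - z * complex_of_real ((vec_norm N x)\<^sup>2)" .
  then have Im_eq: "\<bar>Im (\<Sum>i<N. cnj (x i) * ?w i)\<bar> = \<bar>Im z\<bar> * (vec_norm N x)\<^sup>2"
    using q by (simp add: abs_mult)
  have "\<bar>Im z\<bar> * (vec_norm N x)\<^sup>2 \<le> cmod (\<Sum>i<N. cnj (x i) * ?w i)"
    using abs_Im_le_cmod[of "\<Sum>i<N. cnj (x i) * ?w i"] unfolding Im_eq .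
  also have "\<dots> \<le> vec_norm N (\<lambda>i. cnj (x i)) * vec_norm N ?w"
    by (rule norm_sum_mult_le_vec_norm)
  also have "vec_norm N (\<lambda>i. cnj (x i)) = vec_norm N x"
    by (simp add: vec_norm_def)
  finally have *: "\<bar>Im z\<bar> * (vec_norm N x)\<^sup>2 \<le> vec_norm N x * vec_norm N ?w" .
  show ?thesis
  proof (cases "vec_norm N x = 0")
    case False
    then have "vec_norm N x > 0" using vec_norm_nonneg[of N x] by linarith
    then show ?thesis using * by (simp add: power2_eq_square)
  qed simp
qed

lemma eigenvector_real:
  assumes "x \<in> carrier_vec N" "x \<noteq> 0\<^sub>v N" and "shift_mat N z H *\<^sub>v x = 0\<^sub>v N"
  shows "Im z = 0"
proof (rule ccontr)
  assume nz: "Im z \<noteq> 0"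
  have "(\<Sum>j<N. minus_shift z H i j * x $ j) = 0" if "i < N" for i
  proof -
    have "(shift_mat N z H *\<^sub>v x) $ i = 0" using assms that by simp
    then have "(\<Sum>j<N. ((if i = j then z else 0) - complex_of_real (H i j)) * x $ j) = 0"
      using assms that by (simp add: shift_mat_def scalar_prod_def atLeast0LessThan)
    then have "- (\<Sum>j<N. ((if i = j then z else 0) - complex_of_real (H i j)) * x $ j) = 0"
      by simp
    then show ?thesis unfolding sum_negf[symmetric] by (simp add: minus_shift_def algebra_simps)
  qed
  then have "vec_norm N (\<lambda>i. \<Sum>j<N. minus_shift z H i j * x $ j) = vec_norm N (\<lambda>i. 0)"
    by (intro vec_norm_cong) auto
  also have "\<dots> = 0" by (simp add: vec_norm_def L2_set_def)
  finally have "\<bar>Im z\<bar> * vec_norm N (\<lambda>i. x $ i) \<le> 0"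
    using vec_norm_minus_shift_ge[of z "\<lambda>i. x $ i"] by simp
  then have "vec_norm N (\<lambda>i. x $ i) \<le> 0" using nz by (simp add: mult_le_0_iff)
  then have "x $ i = 0" if "i < N" for i
    using cmod_le_vec_norm[OF that, of "\<lambda>i. x $ i"]
    by (metis norm_le_zero_iff order_trans)
  then have "x = 0\<^sub>v N" using assms(1) by (intro eq_vecI) auto
  then show False using assms(2) by simp
qed

lemma det_shift_mat_nz: "Im z \<noteq> 0 \<Longrightarrow> Determinant.det (shift_mat N z H) \<noteq> 0"
  using det_0_iff_vec_prod_zero_field[OF shift_mat_carrier[of N z H]] eigenvector_real by blast

context
  fixes z :: complex
  assumes z: "Im z \<noteq> 0"
begin

lemma minus_shift_resolvent:
  assumes "i < N" "j < N"
  shows "mat_prod N (minus_shift z H) (resolvent N z H) i j = (if i = j then 1 else 0)"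
proof -
  let ?Z = "shift_mat N z H"
  have a: "adj_mat ?Z \<in> carrier_mat N N" by (rule adj_mat) simp
  have "(?Z * adj_mat ?Z) $$ (i, j) = (Determinant.det ?Z \<cdot>\<^sub>m 1\<^sub>m N) $$ (i, j)"
    by (subst adj_mat(2)[OF shift_mat_carrier]) simp
  then have "(\<Sum>k<N. ?Z $$ (i, k) * adj_mat ?Z $$ (k, j)) = (if i = j then Determinant.det ?Z else 0)"
    using assms a carrier_matD[OF shift_mat_carrier[of N z H]] by (simp add: scalar_prod_def atLeast0LessThan)
  then have "(\<Sum>k<N. ?Z $$ (i, k) * adj_mat ?Z $$ (k, j)) / Determinant.det ?Z = (if i = j then 1 else 0)"
    using det_shift_mat_nz[OF z] by simp
  also have "(\<Sum>k<N. ?Z $$ (i, k) * adj_mat ?Z $$ (k, j)) / Determinant.det ?Z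
      = mat_prod N (minus_shift z H) (resolvent N z H) i j"
    unfolding mat_prod_def sum_divide_distrib
  proof (intro sum.cong refl)
    fix k assume "k \<in> {..<N}"
    then have "?Z $$ (i, k) = - minus_shift z H i k" using assms by (simp add: shift_mat_def minus_shift_def)
    then show "?Z $$ (i, k) * adj_mat ?Z $$ (k, j) / Determinant.det ?Z = minus_shift z H i k * resolvent N z H k j"
      by (simp add: resolvent_def)
  qed
  finally show ?thesis .
qed

lemma resolvent_minus_shift:
  assumes "i < N" "j < N"
  shows "mat_prod N (resolvent N z H) (minus_shift z H) i j = (if i = j then 1 else 0)"
proof -
  let ?Z = "shift_mat N z H"
  have a: "adj_mat ?Z \<in> carrier_mat N N" by (rule adj_mat) simp
  have "(adj_mat ?Z * ?Z) $$ (i, j) = (Determinant.det ?Z \<cdot>\<^sub>m 1\<^sub>m N) $$ (i, j)"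
    by (subst adj_mat(3)[OF shift_mat_carrier]) simp
  then have "(\<Sum>k<N. adj_mat ?Z $$ (i, k) * ?Z $$ (k, j)) = (if i = j then Determinant.det ?Z else 0)"
    using assms a carrier_matD[OF shift_mat_carrier[of N z H]] by (simp add: scalar_prod_def atLeast0LessThan)
  then have "(\<Sum>k<N. adj_mat ?Z $$ (i, k) * ?Z $$ (k, j)) / Determinant.det ?Z = (if i = j then 1 else 0)"
    using det_shift_mat_nz[OF z] by simp
  also have "(\<Sum>k<N. adj_mat ?Z $$ (i, k) * ?Z $$ (k, j)) / Determinant.det ?Z
      = mat_prod N (resolvent N z H) (minus_shift z H) i j"
    unfolding mat_prod_def sum_divide_distrib
  proof (intro sum.cong refl)
    fix k assume "k \<in> {..<N}"
    then have "?Z $$ (k, j) = - minus_shift z H k j" using assms by (simp add: shift_mat_def minus_shift_def)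
    then show "adj_mat ?Z $$ (i, k) * ?Z $$ (k, j) / Determinant.det ?Z = resolvent N z H i k * minus_shift z H k j"
      by (simp add: resolvent_def)
  qed
  finally show ?thesis .
qed

text \<open>The lower bound for H - z, applied to the vector R x, becomes an operator norm bound for
  R.\<close>

lemma vec_norm_resolvent_le:
  "vec_norm N (\<lambda>i. \<Sum>j<N. resolvent N z H i j * x j) \<le> vec_norm N x / \<bar>Im z\<bar>"
proof -
  let ?y = "\<lambda>i. \<Sum>j<N. resolvent N z H i j * x j"
  have "(\<Sum>j<N. minus_shift z H i j * ?y j) = x i" if "i < N" for i
  proof -
    have "(\<Sum>j<N. minus_shift z H i j * ?y j)
        = (\<Sum>k<N. mat_prod N (minus_shift z H) (resolvent N z H) i k * x k)"
      unfolding mat_prod_def sum_distrib_left sum_distrib_right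
      by (subst sum.swap) (simp add: mult.assoc)
    also have "\<dots> = (\<Sum>k<N. if i = k then x k else 0)"
      using that by (intro sum.cong refl) (simp add: minus_shift_resolvent)
    finally show ?thesis using that by simp
  qed
  then have "vec_norm N (\<lambda>i. \<Sum>j<N. minus_shift z H i j * ?y j) = vec_norm N x"
    by (intro vec_norm_cong) auto
  then show ?thesis using vec_norm_minus_shift_ge[of z ?y] z by (simp add: field_simps)
qed

lemma vec_norm_resolvent_col_le: "j < N \<Longrightarrow> vec_norm N (\<lambda>i. resolvent N z H i j) \<le> 1 / \<bar>Im z\<bar>"
  using vec_norm_resolvent_le[of "\<lambda>i. if i = j then 1 else 0"]
  by (simp add: vec_norm_unit if_distrib[of "\<lambda>c. _ * c"] cong: if_cong)

lemma norm_resolvent_le: "i < N \<Longrightarrow> j < N \<Longrightarrow> cmod (resolvent N z H i j) \<le> 1 / \<bar>Im z\<bar>"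
  using cmod_le_vec_norm[of i N "\<lambda>i. resolvent N z H i j"] vec_norm_resolvent_col_le[of j] by linarith

end
end

text \<open>\<open>R' A R = R'\<close> and \<open>R' A' R = R\<close>, since \<open>R\<close> and
  \<open>R'\<close> invert \<open>A\<close> and \<open>A'\<close>; in the difference of the two the
  shift by z cancels.\<close>

lemma resolvent_identity:
  assumes sym: "\<And>i j. i < N \<Longrightarrow> j < N \<Longrightarrow> H i j = H j i" "\<And>i j. i < N \<Longrightarrow> j < N \<Longrightarrow> H' i j = H' j i"
    and z: "Im z \<noteq> 0" and ij: "i < N" "j < N"
  shows "resolvent N z H' i j - resolvent N z H i j
    = - mat_prod N (resolvent N z H') (mat_prod N (\<lambda>k l. complex_of_real (H' k l - H k l)) (resolvent N z H)) i j"
proof -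
  let ?R = "resolvent N z H" and ?R' = "resolvent N z H'"
  let ?A = "minus_shift z H" and ?A' = "minus_shift z H'"
  have "mat_prod N ?R' (mat_prod N ?A ?R) i j = mat_prod N ?R' (\<lambda>k l. if k = l then 1 else 0) i j"
    using ij by (intro mat_prod_cong refl minus_shift_resolvent[OF sym(1) z])
  also have "\<dots> = ?R' i j"
    using ij by (simp add: mat_prod_def if_distrib[of "\<lambda>c. _ * c"] cong: if_cong)
  finally have 1: "mat_prod N ?R' (mat_prod N ?A ?R) i j = ?R' i j" .
  have "mat_prod N ?R' (mat_prod N ?A' ?R) i j = mat_prod N (mat_prod N ?R' ?A') ?R i j"
    by (simp add: mat_prod_assoc)
  also have "\<dots> = mat_prod N (\<lambda>k l. if k = l then 1 else 0) ?R i j"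
    using ij by (intro mat_prod_cong refl resolvent_minus_shift[OF sym(2) z])
  also have "\<dots> = ?R i j"
    using ij by (simp add: mat_prod_def if_distrib[of "\<lambda>c. c * _"] cong: if_cong)
  finally have 2: "mat_prod N ?R' (mat_prod N ?A' ?R) i j = ?R i j" .
  have "(\<lambda>k l. complex_of_real (H' k l - H k l)) = (\<lambda>k l. ?A' k l - ?A k l)"
    by (simp add: minus_shift_def fun_eq_iff)
  then have "mat_prod N ?R' (mat_prod N (\<lambda>k l. complex_of_real (H' k l - H k l)) ?R) i j =
     mat_prod N ?R' (\<lambda>k l. mat_prod N ?A' ?R k l - mat_prod N ?A ?R k l) i j"
    by (simp add: mat_prod_diff_left[abs_def])
  also have "\<dots> = ?R i j - ?R' i j" by (simp add: mat_prod_diff_right 1 2)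
  finally show ?thesis by simp
qed

lemma norm_mat_prod_le:
  assumes "\<And>i j. i < N \<Longrightarrow> j < N \<Longrightarrow> cmod (A i j) \<le> a" "\<And>i j. i < N \<Longrightarrow> j < N \<Longrightarrow> cmod (B i j) \<le> b"
   and "a \<ge> 0" "i < N" "j < N"
  shows "cmod (mat_prod N A B i j) \<le> real N * (a * b)"
proof -
  have "cmod (mat_prod N A B i j) \<le> (\<Sum>k<N. a * b)"
    unfolding mat_prod_def using assms by (intro sum_norm_le) (auto simp: norm_mult intro!: mult_mono)
  then show ?thesis by simp
qed

section \<open>Differentiability and measurability of the resolvent\<close>

lemma has_vector_derivative_quadratic:
  fixes f :: "real \<Rightarrow> 'a :: real_normed_vector"
  assumes "\<And>t. norm (f t - f a - (t - a) *\<^sub>R D) \<le> B * (t - a)\<^sup>2"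
  shows "(f has_vector_derivative D) (at a)"
  unfolding has_vector_derivative_def
proof (rule has_derivativeI_sandwich[of 1])
  show "((\<lambda>t. B * \<bar>t - a\<bar>) \<longlongrightarrow> 0) (at a)"
    by (rule tendsto_eq_intros refl | simp)+
  show "norm (f t - f a - (t - a) *\<^sub>R D) / norm (t - a) \<le> B * \<bar>t - a\<bar>" if "t \<noteq> a" for t
    using assms[of t] that by (simp add: divide_le_eq power2_eq_square mult.assoc abs_mult_self_eq)
qed (auto intro: bounded_linear_scaleR_left)

text \<open>The identity R(t) - R(a) = - (t - a) R(t) C R(a) is used twice: first it makes R
  Lipschitz in t, and then the error of replacing R(t) by R(a) on its right side is quadratic in t -
  a.\<close>

lemma has_vector_derivative_resolvent:
  assumes sym: "\<And>i j. i < N \<Longrightarrow> j < N \<Longrightarrow> H i j = H j i" "\<And>i j. i < N \<Longrightarrow> j < N \<Longrightarrow> C i j = C j i"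
    and z: "Im z \<noteq> 0" and ij: "i < N" "j < N"
  shows "((\<lambda>t. resolvent N z (\<lambda>k l. H k l + t * C k l) i j) has_vector_derivative
     - mat_prod N (resolvent N z (\<lambda>k l. H k l + a * C k l)) (mat_prod N (\<lambda>k l. complex_of_real (C k l))
         (resolvent N z (\<lambda>k l. H k l + a * C k l))) i j) (at a)"
proof -
  define R where "R t = resolvent N z (\<lambda>k l. H k l + t * C k l)" for t
  let ?C = "\<lambda>k l. complex_of_real (C k l)"
  define y where "y = 1 / \<bar>Im z\<bar>"
  have y: "y \<ge> 0" by (simp add: y_def)
  \<comment> \<open>A crude bound for all entries of \<open>C\<close>; powers of N are harmless here
    because only differentiability is at stake.\<close>
  define c where "c = (\<Sum>i<N. \<Sum>j<N. \<bar>C i j\<bar>)"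
  have c: "cmod (?C i j) \<le> c" if "i < N" "j < N" for i j
  proof -
    have "\<bar>C i j\<bar> \<le> (\<Sum>j<N. \<bar>C i j\<bar>)" using that by (intro member_le_sum) auto
    also have "\<dots> \<le> c" unfolding c_def using that by (intro member_le_sum) (auto intro: sum_nonneg)
    finally show ?thesis by simp
  qed
  have c0: "c \<ge> 0" by (simp add: c_def sum_nonneg)
  have s: "H k l + t * C k l = H l k + t * C l k" if "k < N" "l < N" for t k l
    using sym that by simp
  have R: "cmod (R t k l) \<le> y" if "k < N" "l < N" for t k l
    unfolding R_def y_def using that by (intro norm_resolvent_le s z)
  have id: "R t k l - R u k l = - complex_of_real (t - u) * mat_prod N (R t) (mat_prod N ?C (R u)) k l" if "k < N" "l < N" for t u k l
  proof -
    have "R t k l - R u k l = - mat_prod N (R t) (mat_prod N (\<lambda>k l. complex_of_real ((H k l + t * C k l) - (H k l + u * C k l))) (R u)) k l"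
      unfolding R_def by (rule resolvent_identity) (use s z that in auto)
    also have "(\<lambda>k l. complex_of_real ((H k l + t * C k l) - (H k l + u * C k l))) = (\<lambda>k l. complex_of_real (t - u) * ?C k l)"
      by (simp add: fun_eq_iff algebra_simps)
    also have "mat_prod N (R t) (mat_prod N (\<lambda>k l. complex_of_real (t - u) * ?C k l) (R u)) k l = complex_of_real (t - u) * mat_prod N (R t) (mat_prod N ?C (R u)) k l"
      by (simp add: mat_prod_def sum_distrib_left mult_ac del: of_real_diff)
    finally show ?thesis by (simp del: of_real_diff)
  qed
  define b where "b = real N * (y * (real N * (c * y)))"
  have b: "cmod (mat_prod N (R t) (mat_prod N ?C (R u)) k l) \<le> b" if "k < N" "l < N" for t u k l
    unfolding b_def using that y c0 by (intro norm_mat_prod_le R c)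
  have lip: "cmod (R t k l - R u k l) \<le> \<bar>t - u\<bar> * b" if "k < N" "l < N" for t u k l
    unfolding id[OF that] using b[OF that]
    by (simp add: norm_mult mult_left_mono del: of_real_diff)
  have "((\<lambda>t. R t i j) has_vector_derivative - mat_prod N (R a) (mat_prod N ?C (R a)) i j) (at a)"
  proof (rule has_vector_derivative_quadratic)
    fix t
    let ?E = "mat_prod N (\<lambda>k l. R t k l - R a k l) (mat_prod N ?C (R a)) i j"
    have "R t i j - R a i j - (t - a) *\<^sub>R - mat_prod N (R a) (mat_prod N ?C (R a)) i j = - (t - a) * ?E"
      unfolding id[OF ij] mat_prod_diff_left by (simp add: scaleR_conv_of_real algebra_simps)
    also have "cmod \<dots> = \<bar>t - a\<bar> * cmod ?E" by (simp add: norm_mult abs_minus_commute del: of_real_diff)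
    finally have *: "cmod (R t i j - R a i j - (t - a) *\<^sub>R - mat_prod N (R a) (mat_prod N ?C (R a)) i j)
       = \<bar>t - a\<bar> * cmod ?E" .
    have b0: "b \<ge> 0" by (rule order_trans[OF norm_ge_zero b[OF ij, of a a]])
    have "cmod ?E \<le> real N * ((\<bar>t - a\<bar> * b) * (real N * (c * y)))"
      by (intro norm_mat_prod_le lip c R mult_nonneg_nonneg abs_ge_zero b0 c0 ij)
    then have "\<bar>t - a\<bar> * cmod ?E \<le> \<bar>t - a\<bar> * (real N * ((\<bar>t - a\<bar> * b) * (real N * (c * y))))"
      by (rule mult_left_mono) simp
    also have "\<dots> = (real N * b * real N * c * y) * (\<bar>t - a\<bar> * \<bar>t - a\<bar>)"
      by (simp only: mult_ac)
    also have "\<bar>t - a\<bar> * \<bar>t - a\<bar> = (t - a)\<^sup>2"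
      by (simp add: power2_eq_square)
    finally show "cmod (R t i j - R a i j - (t - a) *\<^sub>R - mat_prod N (R a) (mat_prod N ?C (R a)) i j)
       \<le> (real N * b * real N * c * y) * (t - a)\<^sup>2" unfolding * .
  qed
  then show ?thesis unfolding R_def .
qed

text \<open>By the Leibniz formula the determinant and all cofactors are polynomials in the entries,
  so the adjugate form is measurable entry by entry.\<close>

lemma measurable_resolvent:
  assumes [measurable]: "\<And>i j. i < N \<Longrightarrow> j < N \<Longrightarrow> (\<lambda>x. H x i j) \<in> borel_measurable M"
    and ij: "i < N" "j < N"
  shows "(\<lambda>x. resolvent N z (H x) i j) \<in> borel_measurable M"
proof -
  have det: "(\<lambda>x. Determinant.det (mat n n (f x))) \<in> borel_measurable M"
    if "\<And>i j. i < n \<Longrightarrow> j < n \<Longrightarrow> (\<lambda>x. f x (i, j)) \<in> borel_measurable M"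
    for n and f :: "_ \<Rightarrow> nat \<times> nat \<Rightarrow> complex"
  proof -
    have "(\<lambda>x. \<Sum>p\<in>{p. p permutes {0..<n}}. signof p * (\<Prod>i\<in>{0..<n}. f x (i, p i))) \<in> borel_measurable M"
    proof (intro borel_measurable_sum borel_measurable_times borel_measurable_const borel_measurable_prod)
      fix p i assume "p \<in> {p. p permutes {0..<n}}" "i \<in> {0..<n}"
      then have "i < n" "p i < n" using permutes_in_image[of p "{0..<n}" i] by auto
      then show "(\<lambda>x. f x (i, p i)) \<in> borel_measurable M" by (rule that)
    qed
    also have "(\<lambda>x. \<Sum>p\<in>{p. p permutes {0..<n}}. signof p * (\<Prod>i\<in>{0..<n}. f x (i, p i)))
       = (\<lambda>x. Determinant.det (mat n n (f x)))"
    proof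
      fix x
      have "(\<Prod>i\<in>{0..<n}. mat n n (f x) $$ (i, p i)) = (\<Prod>i\<in>{0..<n}. f x (i, p i))"
        if "p permutes {0..<n}" for p
      proof (intro prod.cong refl)
        fix i assume "i \<in> {0..<n}"
        then have "i < n" "p i < n" using permutes_in_image[OF that, of i] by auto
        then show "mat n n (f x) $$ (i, p i) = f x (i, p i)" by simp
      qed
      then show "(\<Sum>p\<in>{p. p permutes {0..<n}}. signof p * (\<Prod>i\<in>{0..<n}. f x (i, p i)))
         = Determinant.det (mat n n (f x))"
        by (subst det_def'[of _ n]) (auto intro!: sum.cong)
    qed
    finally show ?thesis .
  qed
  have 1: "(\<lambda>x. Determinant.det (shift_mat N z (H x))) \<in> borel_measurable M"
    unfolding shift_mat_def by (rule det) simp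
  have md: "mat_delete (shift_mat N z (H x)) j i = mat (N - 1) (N - 1) (\<lambda>(i', j').
       shift_mat N z (H x) $$ (if i' < j then i' else Suc i', if j' < i then j' else Suc j'))" for x
    unfolding mat_delete_def by (simp add: shift_mat_def)
  have "(\<lambda>x. Determinant.det (mat_delete (shift_mat N z (H x)) j i)) \<in> borel_measurable M"
    unfolding md by (rule det) (auto simp: shift_mat_def)
  then have "(\<lambda>x. adj_mat (shift_mat N z (H x)) $$ (i, j)) \<in> borel_measurable M"
    using ij carrier_matD[OF shift_mat_carrier] by (simp add: adj_mat_def cofactor_def)
  with 1 show ?thesis unfolding resolvent_def by measurable
qed

section \<open>The spectral measure and the trace of the resolvent\<close>

lemma sum_count_mult_eq_sum_mset:
  fixes f :: "'a \<Rightarrow> 'b :: comm_semiring_1"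
  assumes "finite S" "set_mset A \<subseteq> S"
  shows "(\<Sum>x\<in>S. of_nat (count A x) * f x) = (\<Sum>x\<in>#A. f x)"
  using assms(2)
proof (induction A)
  case (add a A)
  have "(\<Sum>x\<in>S. of_nat (count (add_mset a A) x) * f x)
      = (\<Sum>x\<in>S. of_nat (count A x) * f x + (if x = a then f x else 0))"
    by (intro sum.cong) (auto simp: algebra_simps)
  also have "\<dots> = (\<Sum>x\<in>#A. f x) + f a"
    using add assms(1) by (simp add: sum.distrib)
  finally show ?case by (simp add: add.commute)
qed simp

lemma integral_pmf_of_multiset:
  fixes f :: "'a \<Rightarrow> complex"
  assumes "A \<noteq> {#}"
  shows "(\<integral>x. f x \<partial>measure_pmf (pmf_of_multiset A)) = (\<Sum>x\<in>#A. f x) / of_nat (size A)"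
proof -
  have "(\<integral>x. f x \<partial>measure_pmf (pmf_of_multiset A)) = (\<Sum>x\<in>set_mset A. pmf (pmf_of_multiset A) x *\<^sub>R f x)"
    using assms by (intro integral_measure_pmf) auto
  also have "\<dots> = (\<Sum>x\<in>set_mset A. of_nat (count A x) * f x) / of_nat (size A)"
    unfolding sum_divide_distrib using assms by (intro sum.cong) (auto simp: scaleR_conv_of_real)
  also have "(\<Sum>x\<in>set_mset A. of_nat (count A x) * f x) = (\<Sum>x\<in>#A. f x)"
    by (rule sum_count_mult_eq_sum_mset) auto
  finally show ?thesis .
qed

text \<open>Logarithmic derivative of a product; the sign comes from writing 1 / (r - z) in place of
  1 / (z - r).\<close>

lemma pderiv_prod_linear_factors:
  fixes rs :: "complex list"
  assumes "\<And>r. r \<in> set rs \<Longrightarrow> r \<noteq> z"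
  shows "poly (pderiv (\<Prod>r\<leftarrow>rs. [:- r, 1:])) z = - poly (\<Prod>r\<leftarrow>rs. [:- r, 1:]) z * (\<Sum>r\<leftarrow>rs. 1 / (r - z))"
  using assms
proof (induction rs)
  case (Cons r rs)
  have "r - z \<noteq> 0" using Cons.prems[of r] by simp
  then show ?case using Cons by (simp add: pderiv_mult pderiv_pCons field_simps del: mult_pCons_left)
qed (simp add: pderiv_1)

lemma poly_char_poly_eq_det_shift:
  assumes "(A :: 'a :: field mat) \<in> carrier_mat n n"
  shows "poly (char_poly A) z = Determinant.det (mat n n (\<lambda>(i, j). (if i = j then z else 0) - A $$ (i, j)))"
proof -
  have "- (char_matrix A z) = mat n n (\<lambda>(i, j). (if i = j then z else 0) - A $$ (i, j))"
    using assms by (intro eq_matI) (auto simp: char_matrix_def)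
  then show ?thesis using char_poly_matrix[OF assms] by simp
qed

text \<open>The trace of the adjugate of z - H is the sum of the characteristic polynomials of the
  principal minors, which is the derivative of the characteristic polynomial p. Hence the trace of
  the resolvent is - p'/p, a sum over roots, without any diagonalisation. Non-real roots are
  excluded by invertibility of z - H off the real axis, so p splits over the reals and has N roots
  with multiplicity.\<close>

lemma trace_resolvent_eq:
  fixes A :: "real mat"
  assumes A: "A \<in> carrier_mat N N" and sym: "\<And>i j. i < N \<Longrightarrow> j < N \<Longrightarrow> A $$ (i, j) = A $$ (j, i)"
    and z: "Im z \<noteq> 0"
  shows "(\<Sum>i<N. resolvent N z (\<lambda>i j. A $$ (i, j)) i i) = (\<Sum>r\<in>#proots (char_poly A). 1 / (complex_of_real r - z))"
    and "size (proots (char_poly A)) = N"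
proof -
  let ?H = "\<lambda>i j. A $$ (i, j)"
  define B where "B = map_mat complex_of_real A"
  have B: "B \<in> carrier_mat N N" using A by (simp add: B_def)
  have Z: "mat N N (\<lambda>(i, j). (if i = j then w else 0) - B $$ (i, j)) = shift_mat N w ?H" for w
    using A by (auto simp: shift_mat_def B_def intro!: eq_matI)
  have cp: "poly (char_poly B) w = Determinant.det (shift_mat N w ?H)" for w
    using poly_char_poly_eq_det_shift[OF B] Z by simp
  obtain as where as: "char_poly B = (\<Prod>a\<leftarrow>as. [:- a, 1:])" "length as = N"
    using char_poly_factorized[OF B] by blast
  have real: "Im a = 0" if "a \<in> set as" for a
  proof (rule ccontr)
    assume "Im a \<noteq> 0"
    then have "Determinant.det (shift_mat N a ?H) \<noteq> 0" using sym by (intro det_shift_mat_nz) auto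
    moreover have "poly (char_poly B) a = 0"
      unfolding as(1) using that by (auto simp: poly_prod_list prod_list_zero_iff image_iff intro!: bexI[of _ a])
    ultimately show False by (simp add: cp)
  qed
  interpret mp: map_poly_inj_idom_hom complex_of_real ..
  define rs where "rs = map Re as"
  have as': "as = map complex_of_real rs"
    unfolding rs_def map_map by (rule map_idI[symmetric]) (use real in \<open>auto simp: complex_eq_iff\<close>)
  \<comment> \<open>The real factorisation is obtained over the complex numbers and pulled back
    along the injective embedding.\<close>
  have "map_poly complex_of_real (char_poly A) = char_poly B"
    unfolding B_def by (rule of_real_hom.char_poly_hom[OF A, symmetric])
  also have "\<dots> = map_poly complex_of_real (\<Prod>r\<leftarrow>rs. [:- r, 1:])"
    unfolding as(1) as' by (induction rs) (simp_all add: mp.hom_mult of_real_hom.map_poly_pCons_hom del: mult_pCons_left)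
  finally have cpA: "char_poly A = (\<Prod>r\<leftarrow>rs. [:- r, 1:])"
    by (rule mp.injectivity)
  have pr: "proots (\<Prod>r\<leftarrow>rs. [:- r, 1:]) = mset rs"
  proof (induction rs)
    case (Cons r rs)
    have "(\<Prod>r\<leftarrow>rs. [:- r, 1:]) \<noteq> 0" by (auto simp: prod_list_zero_iff)
    then show ?case using Cons by (simp add: proots_mult del: mult_pCons_left)
  qed simp
  show "size (proots (char_poly A)) = N" unfolding cpA pr using as(2) by (simp add: rs_def)
  have dnz: "Determinant.det (shift_mat N z ?H) \<noteq> 0" using sym z by (intro det_shift_mat_nz) auto
  have "(\<Sum>i<N. adj_mat (shift_mat N z ?H) $$ (i, i)) = (\<Sum>i<N. poly (char_poly (mat_delete B i i)) z)"
  proof (intro sum.cong refl)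
    fix i assume "i \<in> {..<N}"
    then have i: "i < N" by simp
    have Bi: "mat_delete B i i \<in> carrier_mat (N - 1) (N - 1)"
      by (rule mat_delete_carrier[OF B])
    have "adj_mat (shift_mat N z ?H) $$ (i, i) = Determinant.det (mat_delete (shift_mat N z ?H) i i)"
      using i carrier_matD[OF shift_mat_carrier] by (simp add: adj_mat_def cofactor_def)
    also have "mat_delete (shift_mat N z ?H) i i
      = mat (N - 1) (N - 1) (\<lambda>(k, j). (if k = j then z else 0) - mat_delete B i i $$ (k, j))"
      using i A by (auto simp: mat_delete_def shift_mat_def B_def intro!: eq_matI)
    finally show "adj_mat (shift_mat N z ?H) $$ (i, i) = poly (char_poly (mat_delete B i i)) z"
      using poly_char_poly_eq_det_shift[OF Bi] by simp
  qed
  also have "\<dots> = poly (pderiv (char_poly B)) z"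
    by (simp add: pderiv_char_poly[OF B] poly_sum)
  also have "\<dots> = - poly (char_poly B) z * (\<Sum>r\<leftarrow>as. 1 / (r - z))"
    unfolding as(1) by (rule pderiv_prod_linear_factors) (use real z in auto)
  finally have "(\<Sum>i<N. resolvent N z ?H i i) = (\<Sum>r\<leftarrow>as. 1 / (r - z))"
    unfolding resolvent_def sum_negf sum_divide_distrib[symmetric] using dnz by (simp add: cp)
  also have "\<dots> = (\<Sum>r\<in>#proots (char_poly A). 1 / (complex_of_real r - z))"
    unfolding cpA pr as' by (simp add: sum_mset_sum_list[symmetric] o_def)
  finally show "(\<Sum>i<N. resolvent N z ?H i i) = (\<Sum>r\<in>#proots (char_poly A). 1 / (complex_of_real r - z))" .
qed

lemma stieltjes_empirical_spectral_measure:
  fixes A :: "real mat"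
  assumes "A \<in> carrier_mat N N" "\<And>i j. i < N \<Longrightarrow> j < N \<Longrightarrow> A $$ (i, j) = A $$ (j, i)"
    and "Im z \<noteq> 0" "N > 0"
  shows "(\<integral>t. 1 / (complex_of_real t - z) \<partial>empirical_spectral_measure A)
     = (\<Sum>i<N. resolvent N z (\<lambda>i j. A $$ (i, j)) i i) / of_nat N"
proof -
  have "proots (char_poly A) \<noteq> {#}" using trace_resolvent_eq(2)[OF assms(1-3)] assms(4) by auto
  then show ?thesis
    unfolding empirical_spectral_measure_def
    using trace_resolvent_eq[OF assms(1-3)] by (simp add: integral_pmf_of_multiset)
qed

section \<open>Gaussian integration by parts\<close>

abbreviation gaussian :: "real \<Rightarrow> real measure" where
  "gaussian \<sigma> \<equiv> density lborel (\<lambda>x. ennreal (normal_density 0 \<sigma> x))"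

lemma normal_density_deriv:
  assumes "\<sigma> > 0"
  shows "(normal_density 0 \<sigma> has_real_derivative - (x / \<sigma>\<^sup>2) * normal_density 0 \<sigma> x) (at x)"
  unfolding normal_density_def[abs_def]
  using assms by (auto intro!: derivative_eq_intros simp: field_simps power2_eq_square)

text \<open>A general filter treats both ends of the real line at once.\<close>

lemma normal_density_tendsto_0:
  assumes "\<sigma> > 0" and F: "filterlim (\<lambda>x :: real. x\<^sup>2) at_top F"
  shows "(normal_density 0 \<sigma> \<longlongrightarrow> 0) F"
proof -
  have "filterlim (\<lambda>x. 1 / (2 * \<sigma>\<^sup>2) * x\<^sup>2) at_top F"
    using assms by (intro filterlim_tendsto_pos_mult_at_top[OF tendsto_const]) auto
  then have "((\<lambda>x. exp (- (1 / (2 * \<sigma>\<^sup>2) * x\<^sup>2))) \<longlongrightarrow> 0) F"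
    by (intro filterlim_compose[OF exp_at_bot] filterlim_compose[OF filterlim_uminus_at_bot_at_top])
  then have "((\<lambda>x. 1 / sqrt (2 * pi * \<sigma>\<^sup>2) * exp (- (1 / (2 * \<sigma>\<^sup>2) * x\<^sup>2))) \<longlongrightarrow> 1 / sqrt (2 * pi * \<sigma>\<^sup>2) * 0) F"
    by (intro tendsto_intros)
  then show ?thesis unfolding normal_density_def[abs_def] by simp
qed

text \<open>Stein's identity: the derivative of density times \<open>f\<close> has total integral
  zero, because the density decays at both ends while \<open>f\<close> stays bounded.\<close>

lemma gaussian_integration_by_parts:
  fixes f f' :: "real \<Rightarrow> complex"
  assumes \<sigma>: "\<sigma> > 0" and deriv: "\<And>x. (f has_vector_derivative f' x) (at x)"
    and cont: "continuous_on UNIV f'"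
    and B: "\<And>x. cmod (f x) \<le> B" and B': "\<And>x. cmod (f' x) \<le> B'"
  shows "(\<integral>x. x *\<^sub>R f x \<partial>gaussian \<sigma>) = \<sigma>\<^sup>2 *\<^sub>R (\<integral>x. f' x \<partial>gaussian \<sigma>)"
proof -
  let ?\<phi> = "normal_density 0 \<sigma>"
  have contf: "continuous_on UNIV f"
    using deriv by (auto intro: continuous_at_imp_continuous_on has_vector_derivative_continuous)
  have [measurable]: "f \<in> borel_measurable borel" "f' \<in> borel_measurable borel"
    using contf cont by (auto intro: borel_measurable_continuous_onI)
  have B0: "B \<ge> 0" "B' \<ge> 0" using B[of 0] B'[of 0] by (auto intro: order_trans[OF norm_ge_zero])
  have i1: "integrable lborel (\<lambda>x. ?\<phi> x *\<^sub>R f' x)"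
  proof (rule Bochner_Integration.integrable_bound)
    show "integrable lborel (\<lambda>x. B' * ?\<phi> x)" using \<sigma> by simp
    show "AE x in lborel. cmod (?\<phi> x *\<^sub>R f' x) \<le> norm (B' * ?\<phi> x)"
      using B' B0 by (auto simp: abs_mult mult.commute intro!: mult_right_mono)
  qed simp
  have i2: "integrable lborel (\<lambda>x. (x * ?\<phi> x) *\<^sub>R f x)"
  proof (rule Bochner_Integration.integrable_bound)
    show "integrable lborel (\<lambda>x. B * (?\<phi> x * \<bar>x\<bar> ^ 1))"
      using integrable_normal_moment_abs[OF \<sigma>, of 0 1] by simp
    have "cmod ((x * ?\<phi> x) *\<^sub>R f x) \<le> norm (B * (?\<phi> x * \<bar>x\<bar> ^ 1))" for x
    proof -
      have "cmod ((x * ?\<phi> x) *\<^sub>R f x) = (\<bar>x\<bar> * ?\<phi> x) * cmod (f x)" by (simp add: abs_mult)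
      also have "\<dots> \<le> (\<bar>x\<bar> * ?\<phi> x) * B" by (intro mult_left_mono B) simp
      finally show ?thesis using B0 by (simp add: abs_mult mult_ac)
    qed
    then show "AE x in lborel. cmod ((x * ?\<phi> x) *\<^sub>R f x) \<le> norm (B * (?\<phi> x * \<bar>x\<bar> ^ 1))" by simp
  qed simp
  let ?F = "\<lambda>x. ?\<phi> x *\<^sub>R f x"
  let ?F' = "\<lambda>x. ?\<phi> x *\<^sub>R f' x - (1 / \<sigma>\<^sup>2) *\<^sub>R ((x * ?\<phi> x) *\<^sub>R f x)"
  have i: "integrable lborel ?F'"
    by (intro Bochner_Integration.integrable_diff i1 integrable_scaleR_right i2)
  have lim: "(?F \<longlongrightarrow> 0) F" if "filterlim (\<lambda>x :: real. x\<^sup>2) at_top F" for F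
  proof (rule Lim_null_comparison)
    show "\<forall>\<^sub>F x in F. cmod (?F x) \<le> ?\<phi> x * B"
      using B by (intro always_eventually allI) (simp add: mult_left_mono)
    show "((\<lambda>x. ?\<phi> x * B) \<longlongrightarrow> 0) F"
      using tendsto_mult_right[OF normal_density_tendsto_0[OF \<sigma> that], of B] by simp
  qed
  have "(LBINT x=-\<infinity>..\<infinity>. ?F' x) = 0 - 0"
  proof (rule interval_integral_FTC_integrable)
    fix x
    show "(?F has_vector_derivative ?F' x) (at x)"
      using has_vector_derivative_scaleR[OF normal_density_deriv[OF \<sigma>] deriv, of x]
      by (simp add: algebra_simps)
    have "continuous_on UNIV ?F'"
      unfolding normal_density_def by (intro continuous_intros cont contf) (use \<sigma> in auto)
    then show "isCont ?F' x" by (simp add: continuous_on_eq_continuous_at)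
  next
    show "set_integrable lborel (einterval (-\<infinity>) \<infinity>) ?F'" using i by (simp add: set_integrable_def)
    show "((?F \<circ> real_of_ereal) \<longlongrightarrow> 0) (at_right (- \<infinity>))"
      unfolding ereal_tendsto_simps1 by (rule lim) real_asymp
    show "((?F \<circ> real_of_ereal) \<longlongrightarrow> 0) (at_left \<infinity>)"
      unfolding ereal_tendsto_simps1 by (rule lim) real_asymp
  qed simp
  then have "(\<integral>x. ?F' x \<partial>lborel) = 0"
    by (simp add: interval_lebesgue_integral_def set_lebesgue_integral_def)
  then have "(\<integral>x. ?\<phi> x *\<^sub>R f' x \<partial>lborel) = (1 / \<sigma>\<^sup>2) *\<^sub>R (\<integral>x. (x * ?\<phi> x) *\<^sub>R f x \<partial>lborel)"
    unfolding Bochner_Integration.integral_diff[OF i1 integrable_scaleR_right[OF i2]] integral_scaleR_right by simp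
  then have "\<sigma>\<^sup>2 *\<^sub>R (\<integral>x. ?\<phi> x *\<^sub>R f' x \<partial>lborel) = (\<integral>x. (x * ?\<phi> x) *\<^sub>R f x \<partial>lborel)"
    using \<sigma> by simp
  moreover have "(\<integral>x. x *\<^sub>R f x \<partial>gaussian \<sigma>) = (\<integral>x. (x * ?\<phi> x) *\<^sub>R f x \<partial>lborel)"
    by (subst integral_density) (auto simp: mult.commute)
  moreover have "(\<integral>x. f' x \<partial>gaussian \<sigma>) = (\<integral>x. ?\<phi> x *\<^sub>R f' x \<partial>lborel)"
    by (subst integral_density) auto
  ultimately show ?thesis by simp
qed

lemma integrable_gaussian_abs: "\<sigma> > 0 \<Longrightarrow> integrable (gaussian \<sigma>) (\<lambda>x. \<bar>x\<bar>)"
  using integrable_normal_moment_abs[of \<sigma> 0 1] by (subst integrable_density) auto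

context
  fixes \<sigma> :: "'i \<Rightarrow> real" and S :: "'i set"
  assumes \<sigma>: "\<And>i. \<sigma> i > 0" and S: "finite S"
begin

definition gaussian_PiM :: "('i \<Rightarrow> real) measure" where
  "gaussian_PiM = PiM S (\<lambda>i. gaussian (\<sigma> i))"

lemma prob_space_gaussian_PiM: "prob_space gaussian_PiM"
  unfolding gaussian_PiM_def by (intro prob_space_PiM prob_space_normal_density \<sigma>)

lemma sets_gaussian_PiM: "sets gaussian_PiM = sets (PiM S (\<lambda>_. borel))"
  unfolding gaussian_PiM_def by (intro sets_PiM_cong) auto

lemma measurable_gaussian_PiM_component: "i \<in> S \<Longrightarrow> (\<lambda>g. g i) \<in> borel_measurable gaussian_PiM"
  using measurable_component_singleton[of i S "\<lambda>_. borel"] measurable_cong_sets[OF sets_gaussian_PiM refl]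
  by blast

lemma integrable_gaussian_PiM_component:
  assumes "i \<in> S" shows "integrable gaussian_PiM (\<lambda>g. \<bar>g i\<bar>)"
proof -
  have "distr gaussian_PiM (gaussian (\<sigma> i)) (\<lambda>g. g i) = gaussian (\<sigma> i)"
    unfolding gaussian_PiM_def by (intro distr_PiM_component prob_space_normal_density \<sigma> assms)
  then have "integrable (distr gaussian_PiM (gaussian (\<sigma> i)) (\<lambda>g. g i)) (\<lambda>x. \<bar>x\<bar>)"
    using integrable_gaussian_abs[OF \<sigma>, of i] by simp
  then show ?thesis
    by (rule integrable_distr[rotated]) (use assms in \<open>simp add: gaussian_PiM_def\<close>)
qed

text \<open>Fubini isolates coordinate \<open>i\<close>, and Stein's identity applies on each line
  where the other coordinates are frozen.\<close>

lemma gaussian_PiM_integration_by_parts: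
  fixes F F' :: "('i \<Rightarrow> real) \<Rightarrow> complex"
  assumes i: "i \<in> S"
    and meas: "F \<in> borel_measurable gaussian_PiM" "F' \<in> borel_measurable gaussian_PiM"
    and deriv: "\<And>g t. ((\<lambda>t. F (g(i := t))) has_vector_derivative F' (g(i := t))) (at t)"
    and cont: "\<And>g. continuous_on UNIV (\<lambda>t. F' (g(i := t)))"
    and B: "\<And>g. cmod (F g) \<le> B" and B': "\<And>g. cmod (F' g) \<le> B'"
  shows "(\<integral>g. g i *\<^sub>R F g \<partial>gaussian_PiM) = (\<sigma> i)\<^sup>2 *\<^sub>R (\<integral>g. F' g \<partial>gaussian_PiM)"
    and "integrable gaussian_PiM (\<lambda>g. g i *\<^sub>R F g)"
proof -
  define S' where "S' = S - {i}"
  have S': "finite S'" "i \<notin> S'" "insert i S' = S" using S i by (auto simp: S'_def)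
  interpret P: prob_space gaussian_PiM by (rule prob_space_gaussian_PiM)
  interpret product_sigma_finite "\<lambda>i. gaussian (\<sigma> i)"
    by (intro product_sigma_finite.intro prob_space_imp_sigma_finite prob_space_normal_density \<sigma>)
  have B0: "B \<ge> 0" using B by (auto intro: order_trans[OF norm_ge_zero])
  show int: "integrable gaussian_PiM (\<lambda>g. g i *\<^sub>R F g)"
  proof (rule Bochner_Integration.integrable_bound)
    show "integrable gaussian_PiM (\<lambda>g. B * \<bar>g i\<bar>)"
      by (intro integrable_mult_right integrable_gaussian_PiM_component i)
    show "(\<lambda>g. g i *\<^sub>R F g) \<in> borel_measurable gaussian_PiM"
      by (intro borel_measurable_scaleR measurable_gaussian_PiM_component i meas)
    show "AE g in gaussian_PiM. cmod (g i *\<^sub>R F g) \<le> norm (B * \<bar>g i\<bar>)"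
      using B B0 by (intro AE_I2) (auto simp: abs_mult mult.commute[of _ "cmod _"] intro!: mult_right_mono)
  qed
  have int': "integrable gaussian_PiM F'"
    by (rule P.integrable_const_bound[where B = B']) (use B' meas in auto)
  have "(\<integral>g. g i *\<^sub>R F g \<partial>gaussian_PiM)
     = (\<integral>g. (\<integral>t. t *\<^sub>R F (g(i := t)) \<partial>gaussian (\<sigma> i)) \<partial>PiM S' (\<lambda>i. gaussian (\<sigma> i)))"
    using product_integral_insert[OF S'(1,2), of "\<lambda>g. g i *\<^sub>R F g"] int by (simp add: gaussian_PiM_def S')
  also have "\<dots> = (\<integral>g. (\<sigma> i)\<^sup>2 *\<^sub>R (\<integral>t. F' (g(i := t)) \<partial>gaussian (\<sigma> i)) \<partial>PiM S' (\<lambda>i. gaussian (\<sigma> i)))"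
    by (subst gaussian_integration_by_parts[OF \<sigma> deriv cont B B']) (rule refl)
  also have "\<dots> = (\<sigma> i)\<^sup>2 *\<^sub>R (\<integral>g. (\<integral>t. F' (g(i := t)) \<partial>gaussian (\<sigma> i)) \<partial>PiM S' (\<lambda>i. gaussian (\<sigma> i)))"
    by simp
  also have "(\<integral>g. (\<integral>t. F' (g(i := t)) \<partial>gaussian (\<sigma> i)) \<partial>PiM S' (\<lambda>i. gaussian (\<sigma> i))) = (\<integral>g. F' g \<partial>gaussian_PiM)"
    using product_integral_insert[OF S'(1,2), of F'] int' by (simp add: gaussian_PiM_def S')
  finally show "(\<integral>g. g i *\<^sub>R F g \<partial>gaussian_PiM) = (\<sigma> i)\<^sup>2 *\<^sub>R (\<integral>g. F' g \<partial>gaussian_PiM)" .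
qed

end

section \<open>The Schwinger-Dyson estimate\<close>

text \<open>Transposing (H - z) R = 1 makes the transpose of \<open>R\<close> a left inverse of the
  symmetric matrix H - z, and a left inverse agrees with a right inverse.\<close>

lemma resolvent_sym:
  assumes sym: "\<And>i j. i < N \<Longrightarrow> j < N \<Longrightarrow> H i j = H j i" and z: "Im z \<noteq> 0" and ij: "i < N" "j < N"
  shows "resolvent N z H i j = resolvent N z H j i"
proof -
  let ?R = "resolvent N z H" and ?A = "minus_shift z H"
  let ?T = "\<lambda>i j. ?R j i"
  have A_sym: "?A k l = ?A l k" if "k < N" "l < N" for k l
    using sym[OF that] by (simp add: minus_shift_def)
  have TA: "mat_prod N ?T ?A k l = (if k = l then 1 else 0)" if "k < N" "l < N" for k l
  proof -
    have "mat_prod N ?T ?A k l = mat_prod N ?A ?R l k"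
      unfolding mat_prod_def using that by (intro sum.cong refl) (simp add: A_sym[of l] mult.commute)
    then show ?thesis using minus_shift_resolvent[OF sym z that(2,1)] by auto
  qed
  have "?T i j = mat_prod N ?T (\<lambda>k l. if k = l then 1 else 0) i j"
    using ij by (simp add: mat_prod_def if_distrib[of "\<lambda>c. _ * c"] cong: if_cong)
  also have "\<dots> = mat_prod N ?T (mat_prod N ?A ?R) i j"
    using ij by (intro mat_prod_cong refl minus_shift_resolvent[OF sym z, symmetric])
  also have "\<dots> = mat_prod N (mat_prod N ?T ?A) ?R i j" by (simp add: mat_prod_assoc)
  also have "\<dots> = mat_prod N (\<lambda>k l. if k = l then 1 else 0) ?R i j"
    using ij by (intro mat_prod_cong refl TA)
  also have "\<dots> = ?R i j"
    using ij by (simp add: mat_prod_def if_distrib[of "\<lambda>c. c * _"] cong: if_cong)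
  finally show ?thesis by simp
qed

section \<open>Contracting the covariance with a four-index array\<close>

lemma sum_delta_first:
  fixes f :: "nat \<Rightarrow> nat \<Rightarrow> 'a :: comm_ring_1"
  assumes "i < N"
  shows "(\<Sum>k<N. \<Sum>l<N. (if i = k then g l else 0) * f k l) = (\<Sum>l<N. g l * f i l)"
    and "(\<Sum>k<N. \<Sum>l<N. (if i = l then g k else 0) * f k l) = (\<Sum>k<N. g k * f k i)"
    and "(\<Sum>k<N. \<Sum>l<N. (if i = k \<and> j = l then 1 else 0) * f k l) = (if j < N then f i j else 0)"
    and "(\<Sum>k<N. \<Sum>l<N. (if i = l \<and> j = k then 1 else 0) * f k l) = (if j < N then f j i else 0)"
proof -
  have "(\<Sum>k<N. \<Sum>l<N. (if i = k then g l else 0) * f k l) = (\<Sum>k<N. if i = k then (\<Sum>l<N. g l * f k l) else 0)"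
    by (intro sum.cong refl) auto
  then show "(\<Sum>k<N. \<Sum>l<N. (if i = k then g l else 0) * f k l) = (\<Sum>l<N. g l * f i l)" using assms by simp
  have "(\<Sum>k<N. \<Sum>l<N. (if i = l then g k else 0) * f k l) = (\<Sum>k<N. \<Sum>l<N. if i = l then g k * f k l else 0)"
    by (intro sum.cong refl) auto
  then show "(\<Sum>k<N. \<Sum>l<N. (if i = l then g k else 0) * f k l) = (\<Sum>k<N. g k * f k i)" using assms by simp
  have "(\<Sum>k<N. \<Sum>l<N. (if i = k \<and> j = l then 1 else 0) * f k l) = (\<Sum>k<N. if i = k then (\<Sum>l<N. if j = l then f i l else 0) else 0)"
    by (intro sum.cong refl) (auto intro!: sum.cong simp del: sum.delta sum.delta')
  then show "(\<Sum>k<N. \<Sum>l<N. (if i = k \<and> j = l then 1 else 0) * f k l) = (if j < N then f i j else 0)" using assms by simp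
  have "(\<Sum>k<N. \<Sum>l<N. (if i = l \<and> j = k then 1 else 0) * f k l) = (\<Sum>k<N. if j = k then (\<Sum>l<N. if i = l then f j l else 0) else 0)"
    by (intro sum.cong refl) (auto intro!: sum.cong simp del: sum.delta sum.delta')
  then show "(\<Sum>k<N. \<Sum>l<N. (if i = l \<and> j = k then 1 else 0) * f k l) = (if j < N then f j i else 0)" using assms by simp
qed

text \<open>Each Kronecker delta removes one summation: two terms keep two sums, four keep three
  sums and two factors of \<open>v\<close>, the last keeps all four. Both estimates below start from
  this form, with different \<open>f\<close>.\<close>

lemma sum_contr_cov:
  fixes f :: "nat \<Rightarrow> nat \<Rightarrow> nat \<Rightarrow> nat \<Rightarrow> complex" and v :: "nat \<Rightarrow> real"
  defines "w \<equiv> \<lambda>i. complex_of_real (v i)"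
  shows "(\<Sum>i<N. \<Sum>j<N. \<Sum>k<N. \<Sum>l<N. complex_of_real (contr_cov v n i j k l) * f i j k l) =
    ((\<Sum>i<N. \<Sum>j<N. f i j i j) + (\<Sum>i<N. \<Sum>j<N. f i j j i)
     + of_nat n * ((\<Sum>i<N. \<Sum>j<N. \<Sum>l<N. w j * w l * f i j i l) + (\<Sum>i<N. \<Sum>j<N. \<Sum>k<N. w j * w k * f i j k i)
         + (\<Sum>i<N. \<Sum>j<N. \<Sum>l<N. w i * w l * f i j j l) + (\<Sum>i<N. \<Sum>j<N. \<Sum>k<N. w i * w k * f i j k j))
     + of_nat n * (of_nat n - 1) * (\<Sum>i<N. \<Sum>j<N. \<Sum>k<N. \<Sum>l<N. w i * w j * w k * w l * f i j k l))
     / ((of_nat n + 2) * (of_nat n + 1))"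
proof -
  let ?q = "(of_nat n + 2) * (of_nat n + 1) :: complex"
  have inner: "(\<Sum>k<N. \<Sum>l<N. complex_of_real (contr_cov v n i j k l) * f i j k l)
    = (f i j i j + f i j j i + of_nat n * ((\<Sum>l<N. w j * w l * f i j i l) + (\<Sum>k<N. w j * w k * f i j k i)
         + (\<Sum>l<N. w i * w l * f i j j l) + (\<Sum>k<N. w i * w k * f i j k j))
       + of_nat n * (of_nat n - 1) * (\<Sum>k<N. \<Sum>l<N. w i * w j * w k * w l * f i j k l)) / ?q"
    if ij: "i < N" "j < N" for i j
  proof -
    have "complex_of_real (contr_cov v n i j k l) * f i j k l =
      ((if i = k \<and> j = l then 1 else 0) * f i j k l + (if i = l \<and> j = k then 1 else 0) * f i j k l
      + of_nat n * ((if i = k then w j * w l else 0) * f i j k l + (if i = l then w j * w k else 0) * f i j k l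
         + (if j = k then w i * w l else 0) * f i j k l + (if j = l then w i * w k else 0) * f i j k l)
      + of_nat n * (of_nat n - 1) * (w i * w j * w k * w l * f i j k l)) / ?q" for k l
    proof -
      \<comment> \<open>Stated for arbitrary scalars, so that the arithmetic does not look inside
        the indicators.\<close>
      have alg: "(e1 + e2 + m * (e3 + e4 + e5 + e6) + m * (m - 1) * a * b * c * d) / q * x
         = (e1 * x + e2 * x + m * (e3 * x + e4 * x + e5 * x + e6 * x) + m * (m - 1) * (a * b * c * d * x)) / q"
        for e1 e2 e3 e4 e5 e6 m a b c d q x :: complex
        by (simp add: algebra_simps)
      have of_real_if: "complex_of_real (if P then a else b) = (if P then complex_of_real a else complex_of_real b)" for P a b
        by simp
      show ?thesis
        unfolding contr_cov_def w_def alg[symmetric]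
        by (simp only: of_real_divide of_real_add of_real_diff of_real_mult of_real_if of_real_0 of_real_1 of_real_numeral
            of_real_of_nat_eq)
    qed
    then have "(\<Sum>k<N. \<Sum>l<N. complex_of_real (contr_cov v n i j k l) * f i j k l) =
      ((\<Sum>k<N. \<Sum>l<N. (if i = k \<and> j = l then 1 else 0) * f i j k l) + (\<Sum>k<N. \<Sum>l<N. (if i = l \<and> j = k then 1 else 0) * f i j k l)
      + of_nat n * ((\<Sum>k<N. \<Sum>l<N. (if i = k then w j * w l else 0) * f i j k l) + (\<Sum>k<N. \<Sum>l<N. (if i = l then w j * w k else 0) * f i j k l)
         + (\<Sum>k<N. \<Sum>l<N. (if j = k then w i * w l else 0) * f i j k l) + (\<Sum>k<N. \<Sum>l<N. (if j = l then w i * w k else 0) * f i j k l))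
      + of_nat n * (of_nat n - 1) * (\<Sum>k<N. \<Sum>l<N. w i * w j * w k * w l * f i j k l)) / ?q"
      by (simp only: sum.distrib sum_distrib_left[symmetric] sum_divide_distrib[symmetric])
    then show ?thesis
      unfolding sum_delta_first[OF ij(1)] sum_delta_first[OF ij(2)] using ij by simp
  qed
  have "(\<Sum>i<N. \<Sum>j<N. \<Sum>k<N. \<Sum>l<N. complex_of_real (contr_cov v n i j k l) * f i j k l) =
     (\<Sum>i<N. \<Sum>j<N. (f i j i j + f i j j i + of_nat n * ((\<Sum>l<N. w j * w l * f i j i l) + (\<Sum>k<N. w j * w k * f i j k i)
         + (\<Sum>l<N. w i * w l * f i j j l) + (\<Sum>k<N. w i * w k * f i j k j))
       + of_nat n * (of_nat n - 1) * (\<Sum>k<N. \<Sum>l<N. w i * w j * w k * w l * f i j k l)) / ?q)"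
    by (intro sum.cong refl inner) auto
  then show ?thesis
    by (simp only: sum.distrib sum_distrib_left[symmetric] sum_divide_distrib[symmetric])
qed

lemma norm_divide_norm_factor_le: "cmod (x / ((of_nat n + 2) * (of_nat n + 1))) \<le> cmod x"
proof -
  have "(of_nat n + 2) * (of_nat n + 1) = complex_of_real ((real n + 2) * (real n + 1))" by simp
  then have q: "cmod ((of_nat n + 2) * (of_nat n + 1)) = (real n + 2) * (real n + 1)"
    by (simp only: norm_of_real) simp
  have "(real n + 2) * (real n + 1) \<ge> 1 * 1" by (intro mult_mono) auto
  then have "cmod x * 1 \<le> cmod x * ((real n + 2) * (real n + 1))" by (intro mult_left_mono) auto
  then show ?thesis unfolding norm_divide q by (simp add: divide_le_eq add_pos_pos)
qed

lemma norm_falling_factorial_le: "cmod (of_nat n * (of_nat n - 1)) \<le> (real n)\<^sup>2"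
proof (cases n)
  case (Suc m)
  have "cmod (of_nat n * (of_nat n - 1)) = real n * real m"
    unfolding norm_mult norm_of_nat by (simp add: Suc)
  also have "\<dots> \<le> real n * real n" by (intro mult_left_mono) (auto simp: Suc)
  finally show ?thesis by (simp add: power2_eq_square)
qed simp

text \<open>Only the operator norm bound on \<open>R\<close> is used, so the terms of the covariance that involve \<open>v\<close>, which
  amount to a perturbation of bounded rank, contribute at lower order.\<close>

context
  fixes N :: nat and R :: "nat \<Rightarrow> nat \<Rightarrow> complex" and v :: "nat \<Rightarrow> real" and c :: real
  assumes R_sym: "\<And>i j. i < N \<Longrightarrow> j < N \<Longrightarrow> R i j = R j i"
    and R_contr: "\<And>x. vec_norm N (\<lambda>i. \<Sum>j<N. R i j * x j) \<le> c * vec_norm N x"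
    and c: "c \<ge> 0" and v: "(\<Sum>i<N. (v i)\<^sup>2) = 1" and N: "N > 0"
begin

abbreviation (input) "cvec \<equiv> \<lambda>i. complex_of_real (v i)"
abbreviation (input) "R_cvec \<equiv> \<lambda>i. \<Sum>j<N. R i j * cvec j"
abbreviation (input) "RR_cvec \<equiv> \<lambda>i. \<Sum>j<N. R i j * R_cvec j"

lemma vec_norm_cvec: "vec_norm N cvec = 1"
  using v by (simp add: vec_norm_def L2_set_def)

lemma vec_norm_R_cvec: "vec_norm N R_cvec \<le> c"
  using R_contr[of cvec] vec_norm_cvec by simp

lemma vec_norm_RR_cvec: "vec_norm N RR_cvec \<le> c\<^sup>2"
  using R_contr[of R_cvec] mult_left_mono[OF vec_norm_R_cvec c] by (simp add: power2_eq_square)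

lemma vec_norm_R_col: "j < N \<Longrightarrow> vec_norm N (\<lambda>i. R i j) \<le> c"
  using R_contr[of "\<lambda>i. if i = j then 1 else 0"]
  by (simp add: vec_norm_unit if_distrib[of "\<lambda>c. _ * c"] cong: if_cong)

lemma vec_norm_RR_col: "j < N \<Longrightarrow> vec_norm N (\<lambda>i. mat_prod N R R i j) \<le> c\<^sup>2"
  using R_contr[of "\<lambda>i. R i j"] mult_left_mono[OF vec_norm_R_col c, of j]
  unfolding mat_prod_def by (simp add: power2_eq_square)

lemma vec_norm_cnj: "vec_norm N (\<lambda>i. cnj (x i)) = vec_norm N x"
  by (simp add: vec_norm_def)

lemma norm_sum_le_of_vec_norm:
  assumes "vec_norm N x \<le> a" "vec_norm N y \<le> b"
  shows "cmod (\<Sum>i<N. x i * y i) \<le> a * b"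
  by (rule order_trans[OF norm_sum_mult_le_vec_norm mult_mono])
     (use assms order_trans[OF vec_norm_nonneg assms(1)] in auto)

lemma norm_trace_R: "cmod (\<Sum>i<N. R i i) \<le> real N * c"
proof -
  have "cmod (\<Sum>i<N. R i i) \<le> (\<Sum>i<N. c)"
    using cmod_le_vec_norm[of _ N "\<lambda>i. R i _"] vec_norm_R_col
    by (intro sum_norm_le) (meson lessThan_iff order_trans)
  then show ?thesis by simp
qed

lemma norm_cvec_R_cvec: "cmod (\<Sum>i<N. cvec i * R_cvec i) \<le> c"
  using norm_sum_le_of_vec_norm[OF eq_refl[OF vec_norm_cvec] vec_norm_R_cvec] by simp

lemma norm_R_cvec_sq: "cmod (\<Sum>i<N. R_cvec i * R_cvec i) \<le> c\<^sup>2"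
  using norm_sum_le_of_vec_norm[OF vec_norm_R_cvec vec_norm_R_cvec] by (simp add: power2_eq_square)

text \<open>This array arises when the derivative falls on \<open>R\<close>. The pairing i = l, j =
  k produces the square of the trace, of order N^2. The other pairing is a sum of N products of
  columns, and the terms with \<open>v\<close> are products of tr R, <v, R v> and the bilinear
  square of R v; all of these are at most N c^2, and adding up their multiplicities gives the
  constant.\<close>

lemma main_term_estimate:
  "cmod ((\<Sum>i<N. \<Sum>j<N. \<Sum>k<N. \<Sum>l<N. complex_of_real (contr_cov v n i j k l) * (R j k * R l i))
     - (\<Sum>i<N. R i i)\<^sup>2 / ((of_nat n + 2) * (of_nat n + 1)))
   \<le> (1 + 4 * real n + (real n)\<^sup>2) * (real N * c\<^sup>2)"
proof -
  let ?q = "(of_nat n + 2) * (of_nat n + 1) :: complex"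
  let ?a = "\<Sum>i<N. \<Sum>j<N. R j i * R j i"
  let ?t = "\<Sum>i<N. R i i" and ?p = "\<Sum>i<N. cvec i * R_cvec i" and ?r = "\<Sum>i<N. R_cvec i * R_cvec i"
  have R_cvec': "(\<Sum>j<N. cvec j * R j i) = R_cvec i" if "i < N" for i
    using that by (intro sum.cong refl) (simp add: R_sym mult.commute)
  have t: "(\<Sum>i<N. \<Sum>j<N. R j j * R i i) = ?t\<^sup>2"
    by (simp add: power2_eq_square sum_product mult.commute)
  have s1: "(\<Sum>i<N. \<Sum>j<N. \<Sum>l<N. cvec j * cvec l * (R j i * R l i)) = ?r"
  proof (intro sum.cong refl)
    fix i assume "i \<in> {..<N}"
    then have i: "i < N" by simp
    have "(\<Sum>j<N. \<Sum>l<N. cvec j * cvec l * (R j i * R l i)) = (\<Sum>j<N. cvec j * R j i) * (\<Sum>l<N. cvec l * R l i)"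
      unfolding sum_product by (intro sum.cong refl) (simp add: mult_ac)
    then show "(\<Sum>j<N. \<Sum>l<N. cvec j * cvec l * (R j i * R l i)) = R_cvec i * R_cvec i"
      unfolding R_cvec'[OF i] .
  qed
  have s2: "(\<Sum>i<N. \<Sum>j<N. \<Sum>k<N. cvec j * cvec k * (R j k * R i i)) = ?t * ?p"
  proof -
    have "?t * ?p = (\<Sum>i<N. \<Sum>j<N. R i i * (cvec j * R_cvec j))" by (rule sum_product)
    also have "\<dots> = (\<Sum>i<N. \<Sum>j<N. \<Sum>k<N. cvec j * cvec k * (R j k * R i i))"
      unfolding sum_distrib_left by (intro sum.cong refl) (simp only: mult_ac)
    finally show ?thesis by simp
  qed
  have s3: "(\<Sum>i<N. \<Sum>j<N. \<Sum>l<N. cvec i * cvec l * (R j j * R l i)) = ?t * ?p"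
  proof -
    have "(\<Sum>i<N. \<Sum>j<N. \<Sum>l<N. cvec i * cvec l * (R j j * R l i)) = (\<Sum>j<N. \<Sum>i<N. \<Sum>l<N. cvec i * cvec l * (R j j * R l i))"
      by (rule sum.swap)
    also have "\<dots> = (\<Sum>i<N. \<Sum>j<N. \<Sum>k<N. cvec j * cvec k * (R j k * R i i))"
      by (intro sum.cong refl) (simp add: R_sym)
    finally show ?thesis unfolding s2 .
  qed
  have s4: "(\<Sum>i<N. \<Sum>j<N. \<Sum>k<N. cvec i * cvec k * (R j k * R j i)) = ?r"
  proof -
    have "(\<Sum>i<N. \<Sum>j<N. \<Sum>k<N. cvec i * cvec k * (R j k * R j i)) = (\<Sum>j<N. \<Sum>i<N. \<Sum>k<N. cvec i * cvec k * (R j k * R j i))"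
      by (rule sum.swap)
    also have "\<dots> = ?r"
      unfolding sum_product by (intro sum.cong refl) (simp add: mult_ac)
    finally show ?thesis .
  qed
  have s5: "(\<Sum>i<N. \<Sum>j<N. \<Sum>k<N. \<Sum>l<N. cvec i * cvec j * cvec k * cvec l * (R j k * R l i)) = ?p\<^sup>2"
  proof -
    have "?p\<^sup>2 = (\<Sum>i<N. \<Sum>j<N. (cvec i * R_cvec i) * (cvec j * R_cvec j))"
      unfolding power2_eq_square by (rule sum_product)
    also have "\<dots> = (\<Sum>i<N. \<Sum>j<N. (\<Sum>l<N. cvec i * (R i l * cvec l)) * (\<Sum>k<N. cvec j * (R j k * cvec k)))"
      by (simp only: sum_distrib_left)
    also have "\<dots> = (\<Sum>i<N. \<Sum>j<N. \<Sum>l<N. \<Sum>k<N. cvec i * cvec j * cvec k * cvec l * (R j k * R l i))"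
      unfolding sum_product by (intro sum.cong refl) (simp add: mult_ac R_sym)
    also have "\<dots> = (\<Sum>i<N. \<Sum>j<N. \<Sum>k<N. \<Sum>l<N. cvec i * cvec j * cvec k * cvec l * (R j k * R l i))"
      by (intro sum.cong refl sum.swap)
    finally show ?thesis by simp
  qed
  have eq: "(\<Sum>i<N. \<Sum>j<N. \<Sum>k<N. \<Sum>l<N. complex_of_real (contr_cov v n i j k l) * (R j k * R l i))
     - ?t\<^sup>2 / ?q = (?a + of_nat n * (?r + ?t * ?p + ?t * ?p + ?r) + of_nat n * (of_nat n - 1) * ?p\<^sup>2) / ?q"
    unfolding sum_contr_cov s1 s2 s3 s4 s5 t by (simp add: add_divide_distrib diff_divide_distrib)
  have "cmod ((?a + of_nat n * (?r + ?t * ?p + ?t * ?p + ?r) + of_nat n * (of_nat n - 1) * ?p\<^sup>2) / ?q)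
      \<le> cmod (?a + of_nat n * (?r + ?t * ?p + ?t * ?p + ?r) + of_nat n * (of_nat n - 1) * ?p\<^sup>2)"
    by (rule norm_divide_norm_factor_le)
  also have "\<dots> \<le> cmod ?a + real n * (cmod ?r + cmod ?t * cmod ?p + cmod ?t * cmod ?p + cmod ?r) + (real n)\<^sup>2 * (cmod ?p)\<^sup>2"
  proof -
    have "cmod (a + of_nat n * (r + t * p + t * p + r) + of_nat n * (of_nat n - 1) * p\<^sup>2)
       \<le> cmod a + real n * (cmod r + cmod t * cmod p + cmod t * cmod p + cmod r) + (real n)\<^sup>2 * (cmod p)\<^sup>2"
      for a r t p :: complex
    proof -
      have 1: "cmod (of_nat n * (r + t * p + t * p + r)) \<le> real n * (cmod r + cmod t * cmod p + cmod t * cmod p + cmod r)"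
        unfolding norm_mult[of "of_nat n"] norm_of_nat
        by (intro mult_left_mono norm_triangle_le add_mono order_refl) (auto simp: norm_mult)
      have 2: "cmod (of_nat n * (of_nat n - 1) * p\<^sup>2) \<le> (real n)\<^sup>2 * (cmod p)\<^sup>2"
        unfolding norm_mult[of "of_nat n * (of_nat n - 1)"] norm_power
        by (intro mult_right_mono norm_falling_factorial_le) simp
      show ?thesis by (intro norm_triangle_le add_mono 1 2 order_refl)
    qed
    then show ?thesis .
  qed
  also have "\<dots> \<le> real N * c\<^sup>2 + real n * (c\<^sup>2 + (real N * c) * c + (real N * c) * c + c\<^sup>2) + (real n)\<^sup>2 * c\<^sup>2"
  proof -
    have "cmod ?a \<le> (\<Sum>i<N. c\<^sup>2)"
      using norm_sum_le_of_vec_norm[OF vec_norm_R_col vec_norm_R_col]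
      by (intro sum_norm_le) (simp add: power2_eq_square)
    then have a: "cmod ?a \<le> real N * c\<^sup>2" by simp
    have "a + real n * (r + t * p + t * p + r) + (real n)\<^sup>2 * p\<^sup>2
      \<le> real N * c\<^sup>2 + real n * (c\<^sup>2 + (real N * c) * c + (real N * c) * c + c\<^sup>2) + (real n)\<^sup>2 * c\<^sup>2"
      if "a \<le> real N * c\<^sup>2" "r \<le> c\<^sup>2" "t \<le> real N * c" "p \<le> c" "0 \<le> p" for a r t p :: real
    proof -
      have "t * p \<le> (real N * c) * c" "p\<^sup>2 \<le> c\<^sup>2"
        using that c by (auto intro: mult_mono power_mono)
      then show ?thesis using that by (intro add_mono mult_left_mono) auto
    qed
    from this[OF a norm_R_cvec_sq norm_trace_R norm_cvec_R_cvec norm_ge_zero] show ?thesis .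
  qed
  also have "\<dots> \<le> (1 + 4 * real n + (real n)\<^sup>2) * (real N * c\<^sup>2)"
  proof -
    have "c\<^sup>2 \<le> real N * c\<^sup>2" using N by (simp add: mult_le_cancel_right1)
    then have "real n * (c\<^sup>2 + c\<^sup>2) \<le> real n * (real N * c\<^sup>2 + real N * c\<^sup>2)" "(real n)\<^sup>2 * c\<^sup>2 \<le> (real n)\<^sup>2 * (real N * c\<^sup>2)"
      by (intro mult_left_mono; simp)+
    then show ?thesis by (simp add: algebra_simps power2_eq_square)
  qed
  finally show ?thesis unfolding eq .
qed

text \<open>This array arises when the derivative falls on \<open>cnj D\<close>, whose gradient
  contains R^2. Here both pairings couple a column of \<open>R\<close> to one of R^2, so there is no
  product of two traces and everything is of order N. The two equal pairings account for the summand
  2 in the constant.\<close>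

lemma variance_term_estimate:
  "cmod (\<Sum>i<N. \<Sum>j<N. \<Sum>k<N. \<Sum>l<N. complex_of_real (contr_cov v n i j k l) * (R j i * cnj (mat_prod N R R l k)))
   \<le> (2 + 4 * real n + (real n)\<^sup>2) * (real N * c ^ 3)"
proof -
  let ?q = "(of_nat n + 2) * (of_nat n + 1) :: complex"
  let ?Q = "mat_prod N R R"
  let ?a = "\<Sum>i<N. \<Sum>j<N. R j i * cnj (?Q j i)"
  let ?p = "\<Sum>i<N. cvec i * R_cvec i" and ?p' = "\<Sum>i<N. cvec i * RR_cvec i" and ?r = "\<Sum>i<N. R_cvec i * cnj (RR_cvec i)"
  have Q_sym: "?Q i j = ?Q j i" if "i < N" "j < N" for i j
    unfolding mat_prod_def using that by (intro sum.cong refl) (simp add: R_sym mult.commute)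
  have R_cvec': "(\<Sum>j<N. cvec j * R j i) = R_cvec i" if "i < N" for i
    using that by (intro sum.cong refl) (simp add: R_sym mult.commute)
  have RR_cvec': "RR_cvec i = (\<Sum>l<N. ?Q i l * cvec l)" for i
    unfolding mat_prod_def sum_distrib_left sum_distrib_right
    by (subst sum.swap) (simp add: mult.assoc)
  have cRRv: "(\<Sum>l<N. cvec l * cnj (?Q l i)) = cnj (RR_cvec i)" if "i < N" for i
    unfolding RR_cvec' using that by (simp add: Q_sym mult.commute)
  have t: "(\<Sum>i<N. \<Sum>j<N. R j i * cnj (?Q i j)) = ?a"
    by (intro sum.cong refl) (simp add: Q_sym)
  have s1: "(\<Sum>i<N. \<Sum>j<N. \<Sum>l<N. cvec j * cvec l * (R j i * cnj (?Q l i))) = ?r"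
  proof (intro sum.cong refl)
    fix i assume "i \<in> {..<N}"
    then have i: "i < N" by simp
    have "(\<Sum>j<N. \<Sum>l<N. cvec j * cvec l * (R j i * cnj (?Q l i))) = (\<Sum>j<N. cvec j * R j i) * (\<Sum>l<N. cvec l * cnj (?Q l i))"
      unfolding sum_product by (intro sum.cong refl) (simp add: mult_ac)
    then show "(\<Sum>j<N. \<Sum>l<N. cvec j * cvec l * (R j i * cnj (?Q l i))) = R_cvec i * cnj (RR_cvec i)"
      unfolding R_cvec'[OF i] cRRv[OF i] .
  qed
  have s2: "(\<Sum>i<N. \<Sum>j<N. \<Sum>k<N. cvec j * cvec k * (R j i * cnj (?Q i k))) = ?r"
    unfolding s1[symmetric] by (intro sum.cong refl) (simp add: Q_sym)
  have s3: "(\<Sum>i<N. \<Sum>j<N. \<Sum>l<N. cvec i * cvec l * (R j i * cnj (?Q l j))) = ?r"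
  proof -
    have "(\<Sum>i<N. \<Sum>j<N. \<Sum>l<N. cvec i * cvec l * (R j i * cnj (?Q l j))) = (\<Sum>j<N. \<Sum>i<N. \<Sum>l<N. cvec i * cvec l * (R j i * cnj (?Q l j)))"
      by (rule sum.swap)
    also have "\<dots> = (\<Sum>i<N. \<Sum>j<N. \<Sum>l<N. cvec j * cvec l * (R j i * cnj (?Q l i)))"
      by (intro sum.cong refl) (simp add: R_sym)
    finally show ?thesis unfolding s1 .
  qed
  have s4: "(\<Sum>i<N. \<Sum>j<N. \<Sum>k<N. cvec i * cvec k * (R j i * cnj (?Q j k))) = ?r"
    unfolding s3[symmetric] by (intro sum.cong refl) (simp add: Q_sym)
  have s5: "(\<Sum>i<N. \<Sum>j<N. \<Sum>k<N. \<Sum>l<N. cvec i * cvec j * cvec k * cvec l * (R j i * cnj (?Q l k))) = ?p * cnj ?p'"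
  proof -
    have "?p * cnj ?p' = (\<Sum>i<N. cvec i * (\<Sum>j<N. R i j * cvec j)) * (\<Sum>k<N. cvec k * (\<Sum>l<N. cnj (?Q k l) * cvec l))"
      unfolding RR_cvec' by simp
    also have "\<dots> = (\<Sum>i<N. \<Sum>j<N. cvec i * (R i j * cvec j)) * (\<Sum>k<N. \<Sum>l<N. cvec k * (cnj (?Q k l) * cvec l))"
      by (simp only: sum_distrib_left)
    also have "\<dots> = (\<Sum>i<N. \<Sum>k<N. \<Sum>j<N. \<Sum>l<N. (cvec i * (R i j * cvec j)) * (cvec k * (cnj (?Q k l) * cvec l)))"
      by (simp only: sum_product)
    also have "\<dots> = (\<Sum>i<N. \<Sum>j<N. \<Sum>k<N. \<Sum>l<N. (cvec i * (R i j * cvec j)) * (cvec k * (cnj (?Q k l) * cvec l)))"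
      by (intro sum.cong refl sum.swap)
    also have "\<dots> = (\<Sum>i<N. \<Sum>j<N. \<Sum>k<N. \<Sum>l<N. cvec i * cvec j * cvec k * cvec l * (R j i * cnj (?Q l k)))"
      by (intro sum.cong refl) (simp add: mult_ac R_sym Q_sym)
    finally show ?thesis by simp
  qed
  have eq: "(\<Sum>i<N. \<Sum>j<N. \<Sum>k<N. \<Sum>l<N. complex_of_real (contr_cov v n i j k l) * (R j i * cnj (?Q l k)))
     = (?a + ?a + of_nat n * (?r + ?r + ?r + ?r) + of_nat n * (of_nat n - 1) * (?p * cnj ?p')) / ?q"
    unfolding sum_contr_cov s1 s2 s3 s4 s5 t by simp
  have "cmod ((?a + ?a + of_nat n * (?r + ?r + ?r + ?r) + of_nat n * (of_nat n - 1) * (?p * cnj ?p')) / ?q)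
      \<le> cmod (?a + ?a + of_nat n * (?r + ?r + ?r + ?r) + of_nat n * (of_nat n - 1) * (?p * cnj ?p'))"
    by (rule norm_divide_norm_factor_le)
  also have "\<dots> \<le> cmod ?a + cmod ?a + real n * (cmod ?r + cmod ?r + cmod ?r + cmod ?r) + (real n)\<^sup>2 * (cmod ?p * cmod ?p')"
  proof -
    have "cmod (a + a + of_nat n * (r + r + r + r) + of_nat n * (of_nat n - 1) * (p * cnj p'))
       \<le> cmod a + cmod a + real n * (cmod r + cmod r + cmod r + cmod r) + (real n)\<^sup>2 * (cmod p * cmod p')"
      for a r p p' :: complex
    proof -
      have 1: "cmod (of_nat n * (r + r + r + r)) \<le> real n * (cmod r + cmod r + cmod r + cmod r)"
        unfolding norm_mult norm_of_nat
        by (intro mult_left_mono norm_triangle_le add_mono order_refl) auto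
      have "cmod (of_nat n * (of_nat n - 1) * (p * cnj p')) \<le> (real n)\<^sup>2 * cmod (p * cnj p')"
        unfolding norm_mult[of "of_nat n * (of_nat n - 1)"]
        by (intro mult_right_mono norm_falling_factorial_le) simp
      then have 2: "cmod (of_nat n * (of_nat n - 1) * (p * cnj p')) \<le> (real n)\<^sup>2 * (cmod p * cmod p')"
        unfolding norm_mult[of p] complex_mod_cnj .
      show ?thesis by (intro norm_triangle_le add_mono 1 2 order_refl)
    qed
    then show ?thesis .
  qed
  also have "\<dots> \<le> real N * (c * c\<^sup>2) + real N * (c * c\<^sup>2) + real n * (c * c\<^sup>2 + c * c\<^sup>2 + c * c\<^sup>2 + c * c\<^sup>2) + (real n)\<^sup>2 * (c * c\<^sup>2)"
  proof -
    have "cmod ?a \<le> (\<Sum>i<N. c * c\<^sup>2)"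
    proof (intro sum_norm_le)
      fix i assume "i \<in> {..<N}"
      then have i: "i < N" by simp
      show "cmod (\<Sum>j<N. R j i * cnj (?Q j i)) \<le> c * c\<^sup>2"

        by (rule norm_sum_le_of_vec_norm[OF vec_norm_R_col[OF i] order_trans[OF eq_refl[OF vec_norm_cnj] vec_norm_RR_col[OF i]]])
    qed
    then have a: "cmod ?a \<le> real N * (c * c\<^sup>2)" by simp
    have r: "cmod ?r \<le> c * c\<^sup>2"

      by (rule norm_sum_le_of_vec_norm[OF vec_norm_R_cvec order_trans[OF eq_refl[OF vec_norm_cnj] vec_norm_RR_cvec]])
    have p': "cmod ?p' \<le> c\<^sup>2"
      using norm_sum_le_of_vec_norm[OF eq_refl[OF vec_norm_cvec] vec_norm_RR_cvec] by simp
    have "a + a + real n * (r + r + r + r) + (real n)\<^sup>2 * (p * p')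
      \<le> real N * (c * c\<^sup>2) + real N * (c * c\<^sup>2) + real n * (c * c\<^sup>2 + c * c\<^sup>2 + c * c\<^sup>2 + c * c\<^sup>2) + (real n)\<^sup>2 * (c * c\<^sup>2)"
      if "a \<le> real N * (c * c\<^sup>2)" "r \<le> c * c\<^sup>2" "p \<le> c" "p' \<le> c\<^sup>2" "0 \<le> p'" for a r p p' :: real
    proof -
      have "p * p' \<le> c * c\<^sup>2" using that c by (intro mult_mono) auto
      then show ?thesis using that by (intro add_mono mult_left_mono) auto
    qed
    from this[OF a r norm_cvec_R_cvec p' norm_ge_zero] show ?thesis .
  qed
  also have "\<dots> \<le> (2 + 4 * real n + (real n)\<^sup>2) * (real N * c ^ 3)"
  proof -
    have c3: "c * c\<^sup>2 = c ^ 3" by (simp add: power2_eq_square power3_eq_cube)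
    have "c ^ 3 \<le> real N * c ^ 3" using N c by (simp add: mult_le_cancel_right1)
    then have "real n * (4 * c ^ 3) \<le> real n * (4 * (real N * c ^ 3))" "(real n)\<^sup>2 * c ^ 3 \<le> (real n)\<^sup>2 * (real N * c ^ 3)"
      by (intro mult_left_mono; simp)+
    then show ?thesis unfolding c3 by (simp add: algebra_simps)
  qed
  finally show ?thesis unfolding eq .
qed

end

section \<open>The abstract Gaussian matrix model\<close>

lemma sum_swap_4:
  fixes f :: "'i \<Rightarrow> nat \<Rightarrow> nat \<Rightarrow> nat \<Rightarrow> nat \<Rightarrow> 'a :: comm_monoid_add"
  shows "(\<Sum>I\<in>S. \<Sum>i<N. \<Sum>j<N. \<Sum>k<N. \<Sum>l<N. f I i j k l) = (\<Sum>i<N. \<Sum>j<N. \<Sum>k<N. \<Sum>l<N. \<Sum>I\<in>S. f I i j k l)"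
  by (subst sum.swap, rule sum.cong[OF refl])+ (rule refl)

text \<open>All that the estimate knows of the tensor is a symmetric matrix, linear in independent
  Gaussians, with this covariance. The two roots of \<open>m_eq\<close> have product (n + 2)(n + 1),
  so \<open>m_le\<close> admits only one of them.\<close>

locale gaussian_matrix_model =
  fixes \<sigma> :: "'i \<Rightarrow> real" and S :: "'i set" and C :: "'i \<Rightarrow> nat \<Rightarrow> nat \<Rightarrow> real"
    and N n :: nat and v :: "nat \<Rightarrow> real" and y :: real and m :: complex
  assumes \<sigma>_pos: "\<And>i. \<sigma> i > 0" and S_finite: "finite S"
    and C_sym: "\<And>I i j. C I i j = C I j i"
    and cov: "\<And>i j k l. i < N \<Longrightarrow> j < N \<Longrightarrow> k < N \<Longrightarrow> l < N \<Longrightarrow>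
        (\<Sum>I\<in>S. (\<sigma> I)\<^sup>2 * (C I i j * C I k l)) = contr_cov v n i j k l / real N"
    and v_unit: "(\<Sum>i<N. (v i)\<^sup>2) = 1" and N_pos: "N > 0" and y_ge: "y \<ge> 2"
    and m_eq: "\<i> * y * m = - 1 - m\<^sup>2 / ((of_nat n + 2) * (of_nat n + 1))"
    and m_le: "cmod m \<le> 1 / y"
begin

abbreviation "P \<equiv> gaussian_PiM \<sigma> S"

sublocale P: prob_space P
  by (rule prob_space_gaussian_PiM[OF \<sigma>_pos S_finite])

definition H :: "('i \<Rightarrow> real) \<Rightarrow> nat \<Rightarrow> nat \<Rightarrow> real" where
  "H g i j = (\<Sum>I\<in>S. g I * C I i j)"

definition R :: "('i \<Rightarrow> real) \<Rightarrow> nat \<Rightarrow> nat \<Rightarrow> complex" where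
  "R g = resolvent N (\<i> * y) (H g)"

definition s :: "('i \<Rightarrow> real) \<Rightarrow> complex" where
  "s g = (\<Sum>i<N. R g i i) / of_nat N"

definition D :: "('i \<Rightarrow> real) \<Rightarrow> complex" where
  "D g = s g - m"

text \<open>Up to sign, the derivative of \<open>R\<close> along coordinate
  \<open>I\<close>.\<close>

definition RCR :: "'i \<Rightarrow> ('i \<Rightarrow> real) \<Rightarrow> nat \<Rightarrow> nat \<Rightarrow> complex" where
  "RCR I g = mat_prod N (R g) (mat_prod N (\<lambda>k l. complex_of_real (C I k l)) (R g))"

lemma y_pos: "y > 0" using y_ge by simp

lemma Im_iy_nz: "Im (\<i> * complex_of_real y) \<noteq> 0" using y_pos by simp

lemma H_sym: "H g i j = H g j i"
  unfolding H_def by (subst C_sym) (rule refl)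

text \<open>\<open>H\<close> is affine in each coordinate: changing \<open>g I\<close> moves it
  along a line with direction \<open>C I\<close>, the setting of
  \<open>has_vector_derivative_resolvent\<close>.\<close>

lemma H_upd: "I \<in> S \<Longrightarrow> H (g(I := t)) = (\<lambda>i j. H (g(I := 0)) i j + t * C I i j)"
  unfolding H_def using S_finite
  by (auto simp: fun_eq_iff sum.remove[of S I] intro!: sum.cong)

lemma norm_R_le: "i < N \<Longrightarrow> j < N \<Longrightarrow> cmod (R g i j) \<le> 1 / y"
  using norm_resolvent_le[of N "H g" "\<i> * y" i j, OF H_sym Im_iy_nz] y_pos unfolding R_def by simp

lemma R_sym: "i < N \<Longrightarrow> j < N \<Longrightarrow> R g i j = R g j i"
  unfolding R_def by (rule resolvent_sym[OF H_sym Im_iy_nz])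

lemma R_contr: "vec_norm N (\<lambda>i. \<Sum>j<N. R g i j * x j) \<le> 1 / y * vec_norm N x"
  using vec_norm_resolvent_le[of N "H g" "\<i> * y" x, OF H_sym Im_iy_nz] y_pos unfolding R_def by simp

lemma R_deriv:
  assumes "I \<in> S" "i < N" "j < N"
  shows "((\<lambda>t. R (g(I := t)) i j) has_vector_derivative - RCR I (g(I := t)) i j) (at t)"
proof -
  define H0 where "H0 = H (g(I := 0))"
  have upd: "H (g(I := t)) = (\<lambda>i j. H0 i j + t * C I i j)" for t
    unfolding H0_def by (rule H_upd[OF assms(1)])
  have "H0 i j = H0 j i" for i j unfolding H0_def by (rule H_sym)
  then show ?thesis unfolding RCR_def R_def upd
    by (intro has_vector_derivative_resolvent[OF _ C_sym Im_iy_nz assms(2,3)])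
qed

lemma R_cont: "I \<in> S \<Longrightarrow> i < N \<Longrightarrow> j < N \<Longrightarrow> continuous_on UNIV (\<lambda>t. R (g(I := t)) i j)"
  by (auto intro: continuous_at_imp_continuous_on has_vector_derivative_continuous R_deriv)

lemma R_measurable:
  assumes "i < N" "j < N" shows "(\<lambda>g. R g i j) \<in> borel_measurable P"
  unfolding R_def
proof (rule measurable_resolvent[OF _ assms])
  show "(\<lambda>g. H g i j) \<in> borel_measurable P" for i j
    unfolding H_def
    by (intro borel_measurable_sum borel_measurable_times borel_measurable_const
        measurable_gaussian_PiM_component[OF \<sigma>_pos S_finite])
qed

text \<open>Bounded measurable functions form an algebra closed under conjugation, so membership
  follows the syntax of a term. The bound is required at every point, as integration by parts asks
  for it, and it also yields integrability.\<close>

definition bdd_meas :: "(('i \<Rightarrow> real) \<Rightarrow> complex) \<Rightarrow> bool" where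
  "bdd_meas F \<longleftrightarrow> F \<in> borel_measurable P \<and> (\<exists>B. \<forall>g. cmod (F g) \<le> B)"

lemma bdd_measI: "F \<in> borel_measurable P \<Longrightarrow> (\<And>g. cmod (F g) \<le> B) \<Longrightarrow> bdd_meas F"
  by (auto simp: bdd_meas_def)

lemma bdd_meas_const: "bdd_meas (\<lambda>g. c)"
  by (rule bdd_measI[of _ "cmod c"]) auto

lemma bdd_meas_add:
  assumes "bdd_meas F" "bdd_meas G" shows "bdd_meas (\<lambda>g. F g + G g)"
proof -
  obtain A B where "\<And>g. cmod (F g) \<le> A" "\<And>g. cmod (G g) \<le> B" using assms by (auto simp: bdd_meas_def)
  then show ?thesis using assms
    by (intro bdd_measI[of _ "A + B"] norm_triangle_le add_mono) (auto simp: bdd_meas_def)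
qed

lemma bdd_meas_mult:
  assumes "bdd_meas F" "bdd_meas G" shows "bdd_meas (\<lambda>g. F g * G g)"
proof -
  obtain A B where *: "\<And>g. cmod (F g) \<le> A" "\<And>g. cmod (G g) \<le> B" using assms by (auto simp: bdd_meas_def)
  then have "cmod (F g * G g) \<le> A * B" for g
    unfolding norm_mult by (intro mult_mono) (auto intro: order_trans[OF norm_ge_zero])
  then show ?thesis using assms
    by (intro bdd_measI[of _ "A * B"]) (auto simp: bdd_meas_def)
qed

lemma bdd_meas_sum: "(\<And>k. k \<in> K \<Longrightarrow> bdd_meas (F k)) \<Longrightarrow> bdd_meas (\<lambda>g. \<Sum>k\<in>K. F k g)"
  by (induction K rule: infinite_finite_induct) (auto intro: bdd_meas_const bdd_meas_add)

lemma bdd_meas_cnj: "bdd_meas F \<Longrightarrow> bdd_meas (\<lambda>g. cnj (F g))"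
  unfolding bdd_meas_def
  by (auto intro!: borel_measurable_continuous_on[of cnj] continuous_intros)

lemma bdd_meas_uminus: "bdd_meas F \<Longrightarrow> bdd_meas (\<lambda>g. - F g)"
  using bdd_meas_mult[OF bdd_meas_const[of "-1"], of F] by simp

lemma bdd_meas_diff: "bdd_meas F \<Longrightarrow> bdd_meas G \<Longrightarrow> bdd_meas (\<lambda>g. F g - G g)"
  using bdd_meas_add[OF _ bdd_meas_uminus, of F G] by simp

lemma bdd_meas_divide: "bdd_meas F \<Longrightarrow> bdd_meas (\<lambda>g. F g / c)"
  using bdd_meas_mult[OF _ bdd_meas_const[of "1 / c"], of F] by simp

lemma bdd_meas_scaleR: "bdd_meas F \<Longrightarrow> bdd_meas (\<lambda>g. a *\<^sub>R F g)"
  using bdd_meas_mult[OF bdd_meas_const[of "complex_of_real a"], of F] by (simp add: scaleR_conv_of_real)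

lemma bdd_meas_R: "i < N \<Longrightarrow> j < N \<Longrightarrow> bdd_meas (\<lambda>g. R g i j)"
  by (rule bdd_measI[OF R_measurable norm_R_le])

lemmas bdd_meas_intros = bdd_meas_const bdd_meas_add bdd_meas_mult bdd_meas_sum bdd_meas_cnj
  bdd_meas_uminus bdd_meas_diff bdd_meas_divide bdd_meas_scaleR bdd_meas_R

lemma bdd_meas_integrable: "bdd_meas F \<Longrightarrow> integrable P F"
  unfolding bdd_meas_def by (auto intro: P.integrable_const_bound)

lemma bdd_meas_D: "bdd_meas D"
  unfolding D_def[abs_def] s_def by (intro bdd_meas_intros) auto

lemma bdd_meas_RCR: "i < N \<Longrightarrow> j < N \<Longrightarrow> bdd_meas (\<lambda>g. RCR I g i j)"
  unfolding RCR_def mat_prod_def by (intro bdd_meas_intros) auto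

lemma D_deriv:
  assumes "I \<in> S"
  shows "((\<lambda>t. D (g(I := t))) has_vector_derivative - (\<Sum>p<N. RCR I (g(I := t)) p p) / of_nat N) (at t)"
proof -
  have "((\<lambda>t. (\<Sum>p<N. R (g(I := t)) p p) / of_nat N - m) has_vector_derivative
     (\<Sum>p<N. - RCR I (g(I := t)) p p) / of_nat N - 0) (at t)"
    by (intro has_vector_derivative_diff has_vector_derivative_const has_vector_derivative_divide
         has_vector_derivative_sum R_deriv assms) auto
  then show ?thesis by (simp add: D_def s_def sum_negf)
qed

lemma D_cont: "I \<in> S \<Longrightarrow> continuous_on UNIV (\<lambda>t. D (g(I := t)))"
  by (auto intro: continuous_at_imp_continuous_on has_vector_derivative_continuous D_deriv)

text \<open>By parts, each \<open>g I\<close> in \<open>cnj D tr(H R)/N = (\<Sum>I. g I F I)\<close> becomes a derivative \<open>F'\<close> of \<open>F\<close>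
  in direction \<open>I\<close>.\<close>

definition F :: "'i \<Rightarrow> ('i \<Rightarrow> real) \<Rightarrow> complex" where
  "F I g = (\<Sum>i<N. \<Sum>j<N. complex_of_real (C I i j) * (R g j i * cnj (D g))) / of_nat N"

definition F' :: "'i \<Rightarrow> ('i \<Rightarrow> real) \<Rightarrow> complex" where
  "F' I g = (\<Sum>i<N. \<Sum>j<N. complex_of_real (C I i j) *
     (R g j i * cnj (- (\<Sum>p<N. RCR I g p p) / of_nat N) + - RCR I g j i * cnj (D g))) / of_nat N"

lemma bdd_meas_F: "bdd_meas (F I)"
  unfolding F_def[abs_def] by (intro bdd_meas_intros bdd_meas_D) auto

lemma bdd_meas_F': "bdd_meas (F' I)"
  unfolding F'_def[abs_def] by (intro bdd_meas_intros bdd_meas_D bdd_meas_RCR) auto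

lemma F_deriv:
  assumes "I \<in> S"
  shows "((\<lambda>t. F I (g(I := t))) has_vector_derivative F' I (g(I := t))) (at t)"
  unfolding F_def F'_def
  by (intro has_vector_derivative_divide has_vector_derivative_sum has_vector_derivative_mult_right
       has_vector_derivative_mult has_vector_derivative_cnj R_deriv D_deriv assms) auto

lemma F'_cont: "I \<in> S \<Longrightarrow> continuous_on UNIV (\<lambda>t. F' I (g(I := t)))"
  unfolding F'_def RCR_def mat_prod_def
  by (intro continuous_intros R_cont D_cont) (use N_pos in auto)

lemma F_by_parts:
  assumes "I \<in> S"
  shows "(\<integral>g. g I *\<^sub>R F I g \<partial>P) = (\<sigma> I)\<^sup>2 *\<^sub>R (\<integral>g. F' I g \<partial>P)" "integrable P (\<lambda>g. g I *\<^sub>R F I g)"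
proof -
  obtain B B' where B: "\<And>g. cmod (F I g) \<le> B" "\<And>g. cmod (F' I g) \<le> B'"
    using bdd_meas_F[of I] bdd_meas_F'[of I] by (auto simp: bdd_meas_def)
  have meas: "F I \<in> borel_measurable P" "F' I \<in> borel_measurable P"
    using bdd_meas_F[of I] bdd_meas_F'[of I] by (auto simp: bdd_meas_def)
  note * = gaussian_PiM_integration_by_parts[OF \<sigma>_pos S_finite assms meas F_deriv[OF assms] F'_cont[OF assms] B]
  show "(\<integral>g. g I *\<^sub>R F I g \<partial>P) = (\<sigma> I)\<^sup>2 *\<^sub>R (\<integral>g. F' I g \<partial>P)" "integrable P (\<lambda>g. g I *\<^sub>R F I g)"
    by (rule *)+
qed

text \<open>The averaged diagonal of (H - z) R = 1, with z = \<i> y, turns tr(H R)/N into 1 + z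
  s.\<close>

lemma sum_F: "(\<Sum>I\<in>S. g I *\<^sub>R F I g) = (1 + \<i> * y * s g) * cnj (D g)"
proof -
  have "(\<Sum>I\<in>S. g I *\<^sub>R F I g) = (\<Sum>I\<in>S. \<Sum>i<N. \<Sum>j<N. complex_of_real (g I * C I i j) * (R g j i * cnj (D g))) / of_nat N"
    unfolding F_def by (simp add: scaleR_conv_of_real sum_divide_distrib sum_distrib_left mult.assoc)
  also have "(\<Sum>I\<in>S. \<Sum>i<N. \<Sum>j<N. complex_of_real (g I * C I i j) * (R g j i * cnj (D g)))
     = (\<Sum>i<N. \<Sum>j<N. \<Sum>I\<in>S. complex_of_real (g I * C I i j) * (R g j i * cnj (D g)))"
    by (subst sum.swap, rule sum.cong[OF refl])+ (rule refl)
  also have "\<dots> = (\<Sum>i<N. (\<Sum>j<N. complex_of_real (H g i j) * R g j i) * cnj (D g))"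
    unfolding H_def by (simp add: sum_distrib_right sum_distrib_left mult.assoc)
  also have "\<dots> = (\<Sum>i<N. (1 + \<i> * y * R g i i) * cnj (D g))"
  proof (intro sum.cong refl)
    fix i assume "i \<in> {..<N}"
    then have i: "i < N" by simp
    have "1 = mat_prod N (minus_shift (\<i> * y) (H g)) (R g) i i"
      unfolding R_def using minus_shift_resolvent[OF H_sym Im_iy_nz i i] by simp
    also have "\<dots> = (\<Sum>j<N. complex_of_real (H g i j) * R g j i) - \<i> * y * R g i i"
      using i by (simp add: mat_prod_def minus_shift_def left_diff_distrib sum_subtractf
          if_distrib[of "\<lambda>c. c * _"] cong: if_cong)
    finally have "(\<Sum>j<N. complex_of_real (H g i j) * R g j i) = 1 + \<i> * y * R g i i"
      by (simp add: algebra_simps)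
    then show "(\<Sum>j<N. complex_of_real (H g i j) * R g j i) * cnj (D g) = (1 + \<i> * y * R g i i) * cnj (D g)"
      by simp
  qed
  also have "\<dots> / of_nat N = (1 + \<i> * y * s g) * cnj (D g)"
    using N_pos by (simp add: s_def sum.distrib sum_distrib_left[symmetric] sum_distrib_right[symmetric]
       add_divide_distrib distrib_right)
  finally show ?thesis .
qed

text \<open>The covariance and the prefactor of \<open>F\<close> contribute N^-2. The part in which
  \<open>cnj D\<close> is differentiated has a further 1/N from the normalised trace inside
  \<open>D\<close>.\<close>

lemma sum_F':
  "(\<Sum>I\<in>S. (\<sigma> I)\<^sup>2 *\<^sub>R F' I g) =
    - (\<Sum>i<N. \<Sum>j<N. \<Sum>k<N. \<Sum>l<N. complex_of_real (contr_cov v n i j k l) * (R g j k * R g l i)) * cnj (D g) / (of_nat N)\<^sup>2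
    - (\<Sum>i<N. \<Sum>j<N. \<Sum>k<N. \<Sum>l<N. complex_of_real (contr_cov v n i j k l) * (R g j i * cnj (mat_prod N (R g) (R g) l k))) / (of_nat N) ^ 3"
proof -
  define X where "X i j k l = R g j k * R g l i" for i j k l
  define Y where "Y i j k l = R g j i * cnj (mat_prod N (R g) (R g) l k)" for i j k l
  define Z where "Z i j k l = - (X i j k l * cnj (D g)) / of_nat N - Y i j k l / (of_nat N)\<^sup>2" for i j k l
  have RCR1: "RCR I g j i = (\<Sum>k<N. \<Sum>l<N. complex_of_real (C I k l) * X i j k l)" for I i j
    unfolding RCR_def mat_prod_def X_def sum_distrib_left by (simp add: mult_ac)
  \<comment> \<open>Cyclicity of the trace: tr(R C R) = tr(C R^2).\<close>
  have tr: "(\<Sum>p<N. RCR I g p p) = (\<Sum>k<N. \<Sum>l<N. complex_of_real (C I k l) * mat_prod N (R g) (R g) l k)" for I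
  proof -
    have "(\<Sum>p<N. RCR I g p p) = (\<Sum>p<N. \<Sum>k<N. \<Sum>l<N. complex_of_real (C I k l) * (R g l p * R g p k))"
      unfolding RCR1 X_def by (simp add: mult.commute)
    also have "\<dots> = (\<Sum>k<N. \<Sum>l<N. \<Sum>p<N. complex_of_real (C I k l) * (R g l p * R g p k))"
      by (subst sum.swap, rule sum.cong[OF refl])+ (rule refl)
    finally show ?thesis by (simp add: mat_prod_def sum_distrib_left)
  qed
  have "F' I g = (\<Sum>i<N. \<Sum>j<N. \<Sum>k<N. \<Sum>l<N. complex_of_real (C I i j * C I k l) * Z i j k l)" for I
  proof -
    have "complex_of_real (C I i j) * (R g j i * cnj (- (\<Sum>p<N. RCR I g p p) / of_nat N) + - RCR I g j i * cnj (D g)) / of_nat N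
       = (\<Sum>k<N. \<Sum>l<N. complex_of_real (C I i j * C I k l) * Z i j k l)" for i j
    proof -
      have 1: "RCR I g j i * cnj (D g) = (\<Sum>k<N. \<Sum>l<N. complex_of_real (C I k l) * (X i j k l * cnj (D g)))"
        unfolding RCR1 sum_distrib_right by (simp only: mult.assoc)
      have 2: "R g j i * cnj (\<Sum>p<N. RCR I g p p) = (\<Sum>k<N. \<Sum>l<N. complex_of_real (C I k l) * Y i j k l)"
        unfolding tr Y_def cnj_sum sum_distrib_left by (simp add: mult.left_commute)
      have "complex_of_real (C I i j) * (R g j i * cnj (- (\<Sum>p<N. RCR I g p p) / of_nat N) + - RCR I g j i * cnj (D g)) / of_nat N
         = complex_of_real (C I i j) * (- (R g j i * cnj (\<Sum>p<N. RCR I g p p)) / (of_nat N)\<^sup>2 - (RCR I g j i * cnj (D g)) / of_nat N)"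
        using N_pos by (simp add: field_simps power2_eq_square)
      also have "\<dots> = complex_of_real (C I i j) * (\<Sum>k<N. \<Sum>l<N. complex_of_real (C I k l) * Z i j k l)"
      proof -
        have "complex_of_real (C I k l) * Z i j k l = - (complex_of_real (C I k l) * Y i j k l) / (of_nat N)\<^sup>2
           - (complex_of_real (C I k l) * (X i j k l * cnj (D g))) / of_nat N" for k l
          by (simp add: Z_def right_diff_distrib)
        then show ?thesis unfolding 1 2
          by (simp only: sum_subtractf sum_divide_distrib[symmetric] sum_negf)
      qed
      also have "\<dots> = (\<Sum>k<N. \<Sum>l<N. complex_of_real (C I i j * C I k l) * Z i j k l)"
        by (simp only: sum_distrib_left of_real_mult mult.assoc)
      finally show ?thesis .
    qed
    then show ?thesis unfolding F'_def sum_divide_distrib by (intro sum.cong refl)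
  qed
  then have "(\<Sum>I\<in>S. (\<sigma> I)\<^sup>2 *\<^sub>R F' I g)
     = (\<Sum>I\<in>S. \<Sum>i<N. \<Sum>j<N. \<Sum>k<N. \<Sum>l<N. complex_of_real ((\<sigma> I)\<^sup>2 * (C I i j * C I k l)) * Z i j k l)"
    by (simp only: scaleR_conv_of_real sum_distrib_left of_real_mult mult.assoc)
  also have "\<dots> = (\<Sum>i<N. \<Sum>j<N. \<Sum>k<N. \<Sum>l<N. \<Sum>I\<in>S. complex_of_real ((\<sigma> I)\<^sup>2 * (C I i j * C I k l)) * Z i j k l)"
    by (rule sum_swap_4)
  also have "\<dots> = (\<Sum>i<N. \<Sum>j<N. \<Sum>k<N. \<Sum>l<N. complex_of_real (contr_cov v n i j k l / real N) * Z i j k l)"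
  proof (intro sum.cong refl)
    fix i j k l assume "i \<in> {..<N}" "j \<in> {..<N}" "k \<in> {..<N}" "l \<in> {..<N}"
    then show "(\<Sum>I\<in>S. complex_of_real ((\<sigma> I)\<^sup>2 * (C I i j * C I k l)) * Z i j k l) = complex_of_real (contr_cov v n i j k l / real N) * Z i j k l"
      unfolding sum_distrib_right[symmetric] of_real_sum[symmetric] by (subst cov) auto
  qed
  also have "\<dots> = (\<Sum>i<N. \<Sum>j<N. \<Sum>k<N. \<Sum>l<N. - (complex_of_real (contr_cov v n i j k l) * X i j k l * (cnj (D g) / (of_nat N)\<^sup>2))
      - complex_of_real (contr_cov v n i j k l) * Y i j k l / (of_nat N) ^ 3)"
  proof (intro sum.cong refl)
    fix i j k l
    show "complex_of_real (contr_cov v n i j k l / real N) * Z i j k l = - (complex_of_real (contr_cov v n i j k l) * X i j k l * (cnj (D g) / (of_nat N)\<^sup>2))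
      - complex_of_real (contr_cov v n i j k l) * Y i j k l / (of_nat N) ^ 3"
      unfolding Z_def using N_pos by (simp add: field_simps power2_eq_square power3_eq_cube)
  qed
  also have "\<dots> = - ((\<Sum>i<N. \<Sum>j<N. \<Sum>k<N. \<Sum>l<N. complex_of_real (contr_cov v n i j k l) * X i j k l) * (cnj (D g) / (of_nat N)\<^sup>2))
      - (\<Sum>i<N. \<Sum>j<N. \<Sum>k<N. \<Sum>l<N. complex_of_real (contr_cov v n i j k l) * Y i j k l) / (of_nat N) ^ 3"
    by (simp only: sum_subtractf sum_negf sum_distrib_right[symmetric] sum_divide_distrib[symmetric])
  finally show ?thesis unfolding X_def Y_def by simp
qed

definition K1 :: real where "K1 = 1 + 4 * real n + (real n)\<^sup>2"
definition K2 :: real where "K2 = 2 + 4 * real n + (real n)\<^sup>2"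

text \<open>The squared trace isolated by \<open>main_term_estimate\<close> is N^2 s^2, so it
  becomes the quadratic term of the self-consistent equation and the rest is error. As y >= 2,
  powers of 1/y are bounded by 1.\<close>

lemma sum_F'_estimate:
  "cmod ((\<Sum>I\<in>S. (\<sigma> I)\<^sup>2 *\<^sub>R F' I g) + (s g)\<^sup>2 / ((of_nat n + 2) * (of_nat n + 1)) * cnj (D g))
    \<le> K1 / real N * cmod (D g) + K2 / (real N)\<^sup>2"
proof -
  let ?q = "(of_nat n + 2) * (of_nat n + 1) :: complex"
  define T1 where "T1 = (\<Sum>i<N. \<Sum>j<N. \<Sum>k<N. \<Sum>l<N. complex_of_real (contr_cov v n i j k l) * (R g j k * R g l i))"
  define T2 where "T2 = (\<Sum>i<N. \<Sum>j<N. \<Sum>k<N. \<Sum>l<N. complex_of_real (contr_cov v n i j k l) * (R g j i * cnj (mat_prod N (R g) (R g) l k)))"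
  define t where "t = (\<Sum>i<N. R g i i)"
  have c: "1 / y \<ge> 0" "(1 / y)\<^sup>2 \<le> 1" "(1 / y) ^ 3 \<le> 1"
    using y_ge by (auto intro!: power_le_one)
  have "cmod (T1 - t\<^sup>2 / ?q) \<le> K1 * (real N * (1 / y)\<^sup>2)"
    unfolding T1_def t_def K1_def by (rule main_term_estimate[OF R_sym R_contr c(1) v_unit N_pos])
  also have "\<dots> \<le> K1 * (real N * 1)"
    using c by (intro mult_left_mono) (auto simp: K1_def)
  finally have T1: "cmod (T1 - t\<^sup>2 / ?q) \<le> K1 * real N" by simp
  have "cmod T2 \<le> K2 * (real N * (1 / y) ^ 3)"
    unfolding T2_def K2_def by (rule variance_term_estimate[OF R_sym R_contr c(1) v_unit N_pos])
  also have "\<dots> \<le> K2 * (real N * 1)"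
    using c by (intro mult_left_mono) (auto simp: K2_def)
  finally have T2: "cmod T2 \<le> K2 * real N" by simp
  have "(\<Sum>I\<in>S. (\<sigma> I)\<^sup>2 *\<^sub>R F' I g) + (s g)\<^sup>2 / ?q * cnj (D g)
     = - ((T1 - t\<^sup>2 / ?q) * (cnj (D g) / (of_nat N)\<^sup>2)) - T2 / (of_nat N) ^ 3"
  proof -
    have "- T1 * d / M\<^sup>2 - T2 / M ^ 3 + (t / M)\<^sup>2 / q * d = - ((T1 - t\<^sup>2 / q) * (d / M\<^sup>2)) - T2 / M ^ 3"
      for T1 T2 t d M q :: complex
      by (simp add: power_divide algebra_simps diff_divide_distrib)
    then show ?thesis
      unfolding sum_F' T1_def[symmetric] T2_def[symmetric] s_def t_def[symmetric] .
  qed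
  also have "cmod \<dots> \<le> cmod ((T1 - t\<^sup>2 / ?q) * (cnj (D g) / (of_nat N)\<^sup>2)) + cmod (T2 / (of_nat N) ^ 3)"
    by (metis norm_minus_cancel norm_triangle_ineq4)
  also have "\<dots> = cmod (T1 - t\<^sup>2 / ?q) * (cmod (D g) / (real N)\<^sup>2) + cmod T2 / (real N) ^ 3"
    by (simp only: norm_mult norm_divide norm_power norm_of_nat complex_mod_cnj)
  also have "\<dots> \<le> (K1 * real N) * (cmod (D g) / (real N)\<^sup>2) + (K2 * real N) / (real N) ^ 3"
    by (intro add_mono mult_right_mono divide_right_mono T1 T2) auto
  also have "\<dots> = K1 / real N * cmod (D g) + K2 / (real N)\<^sup>2"
    using N_pos by (simp add: field_simps power2_eq_square power3_eq_cube)
  finally show ?thesis .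
qed

lemma norm_s_le: "cmod (s g) \<le> 1 / y"
proof -
  have "cmod (\<Sum>i<N. R g i i) \<le> (\<Sum>i<N. 1 / y)" by (intro sum_norm_le norm_R_le) auto
  then show ?thesis using N_pos y_pos by (simp add: s_def norm_divide field_simps)
qed

text \<open>Let q = (n + 2)(n + 1) and z = \<i> y. Integrating z |D|^2 = (1 + z s)
  \<open>cnj D\<close> + (m^2/q) \<open>cnj D\<close> and treating the first summand by parts
  replaces it by - (s^2/q) \<open>cnj D\<close> up to errors. Since s^2 - m^2 = (s + m) D, the right
  side is at most E|D|^2 plus a multiple of N^-2, and the factor y >= 2 on the left absorbs
  E|D|^2.\<close>

theorem second_moment_bound:
  "(\<integral>g. (cmod (D g))\<^sup>2 \<partial>P) \<le> (K1\<^sup>2 / 2 + K2) / (real N)\<^sup>2"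
  and integrable_norm_D_sq: "integrable P (\<lambda>g. (cmod (D g))\<^sup>2)"
proof -
  let ?q = "(of_nat n + 2) * (of_nat n + 1) :: complex"
  define E where "E g = (\<Sum>I\<in>S. (\<sigma> I)\<^sup>2 *\<^sub>R F' I g)" for g
  have bm_E: "bdd_meas E" unfolding E_def[abs_def] by (intro bdd_meas_intros bdd_meas_F')
  have int_E: "(\<integral>g. (1 + \<i> * y * s g) * cnj (D g) \<partial>P) = (\<integral>g. E g \<partial>P)"
  proof -
    have "(\<integral>g. (1 + \<i> * y * s g) * cnj (D g) \<partial>P) = (\<integral>g. (\<Sum>I\<in>S. g I *\<^sub>R F I g) \<partial>P)"
      by (simp only: sum_F)
    also have "\<dots> = (\<Sum>I\<in>S. \<integral>g. g I *\<^sub>R F I g \<partial>P)"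
      by (intro Bochner_Integration.integral_sum F_by_parts)
    also have "\<dots> = (\<Sum>I\<in>S. \<integral>g. (\<sigma> I)\<^sup>2 *\<^sub>R F' I g \<partial>P)"
      by (intro sum.cong refl) (simp add: F_by_parts)
    also have "\<dots> = (\<integral>g. E g \<partial>P)"
      unfolding E_def by (intro Bochner_Integration.integral_sum[symmetric] bdd_meas_integrable bdd_meas_intros bdd_meas_F')
    finally show ?thesis .
  qed
  have bm_D2: "bdd_meas (\<lambda>g. D g * cnj (D g))" by (intro bdd_meas_intros bdd_meas_D)
  have D2: "D g * cnj (D g) = complex_of_real ((cmod (D g))\<^sup>2)" for g
    by (rule complex_norm_square[symmetric])
  have "integrable P (\<lambda>g. complex_of_real ((cmod (D g))\<^sup>2))"
    using bdd_meas_integrable[OF bm_D2] unfolding D2 .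
  then show int: "integrable P (\<lambda>g. (cmod (D g))\<^sup>2)"
    unfolding complex_of_real_integrable_eq .
  have bm_sD: "bdd_meas (\<lambda>g. (1 + \<i> * y * s g) * cnj (D g))"
    unfolding s_def by (intro bdd_meas_intros bdd_meas_D) auto
  have bm_mD: "bdd_meas (\<lambda>g. m\<^sup>2 / ?q * cnj (D g))"
    by (intro bdd_meas_intros bdd_meas_D)
  have "\<i> * y * (\<integral>g. D g * cnj (D g) \<partial>P) = (\<integral>g. \<i> * y * (D g * cnj (D g)) \<partial>P)"
    by simp
  also have "\<dots> = (\<integral>g. (1 + \<i> * y * s g) * cnj (D g) + m\<^sup>2 / ?q * cnj (D g) \<partial>P)"
  proof (intro Bochner_Integration.integral_cong refl)
    fix g
    have "\<i> * y * D g = \<i> * y * s g - \<i> * y * m" by (simp add: D_def right_diff_distrib)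
    also have "\<dots> = (1 + \<i> * y * s g) + m\<^sup>2 / ?q" unfolding m_eq by simp
    finally show "\<i> * y * (D g * cnj (D g)) = (1 + \<i> * y * s g) * cnj (D g) + m\<^sup>2 / ?q * cnj (D g)"
      by (simp only: mult.assoc[symmetric] distrib_right)
  qed
  also have "\<dots> = (\<integral>g. (1 + \<i> * y * s g) * cnj (D g) \<partial>P) + (\<integral>g. m\<^sup>2 / ?q * cnj (D g) \<partial>P)"
    by (intro Bochner_Integration.integral_add bdd_meas_integrable bm_sD bm_mD)
  also have "\<dots> = (\<integral>g. E g + m\<^sup>2 / ?q * cnj (D g) \<partial>P)"
    unfolding int_E by (intro Bochner_Integration.integral_add[symmetric] bdd_meas_integrable bm_E bm_mD)
  finally have eq: "\<i> * y * (\<integral>g. D g * cnj (D g) \<partial>P) = (\<integral>g. E g + m\<^sup>2 / ?q * cnj (D g) \<partial>P)" .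
  have pointwise: "cmod (E g + m\<^sup>2 / ?q * cnj (D g)) \<le> (cmod (D g))\<^sup>2 + (K1\<^sup>2 / 2 + K2) / (real N)\<^sup>2" for g
  proof -
    have split: "E g + m\<^sup>2 / ?q * cnj (D g) = (E g + (s g)\<^sup>2 / ?q * cnj (D g)) - ((s g + m) * (D g * cnj (D g))) / ?q"
    proof -
      have "e + m\<^sup>2 / q * d = (e + s\<^sup>2 / q * d) - ((s + m) * ((s - m) * d)) / q" for e m q d s :: complex
        by (simp add: power2_eq_square algebra_simps add_divide_distrib diff_divide_distrib)
      then show ?thesis unfolding D_def .
    qed
    have "cmod ((E g + (s g)\<^sup>2 / ?q * cnj (D g)) - ((s g + m) * (D g * cnj (D g))) / ?q)
        \<le> cmod (E g + (s g)\<^sup>2 / ?q * cnj (D g)) + cmod (((s g + m) * (D g * cnj (D g))) / ?q)"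
      by (rule norm_triangle_ineq4)
    also have "\<dots> \<le> (K1 / real N * cmod (D g) + K2 / (real N)\<^sup>2) + (cmod (D g))\<^sup>2 / 2"
    proof (intro add_mono)
      show "cmod (E g + (s g)\<^sup>2 / ?q * cnj (D g)) \<le> K1 / real N * cmod (D g) + K2 / (real N)\<^sup>2"
        unfolding E_def by (rule sum_F'_estimate)
      \<comment> \<open>One half of |D|^2 arises here, from |s + m| <= 2/y <= 1 and a denominator of
        at least 2.\<close>
      have "1 / y \<le> 1 / 2" using y_ge by (intro divide_left_mono) auto
      then have sm: "cmod (s g + m) \<le> 1"
        using norm_triangle_ineq[of "s g" m] norm_s_le[of g] m_le by linarith
      have "?q = complex_of_real ((real n + 2) * (real n + 1))" by simp
      then have q: "cmod ?q = (real n + 2) * (real n + 1)" by (simp only: norm_of_real) simp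
      have q2: "(real n + 2) * (real n + 1) \<ge> 2 * 1" by (intro mult_mono) auto
      have "cmod (((s g + m) * (D g * cnj (D g))) / ?q) = cmod (s g + m) * (cmod (D g))\<^sup>2 / ((real n + 2) * (real n + 1))"
        unfolding norm_divide q by (simp add: norm_mult power2_eq_square)
      also have "\<dots> \<le> 1 * (cmod (D g))\<^sup>2 / 2"
        using sm q2 by (intro frac_le mult_right_mono) auto
      finally show "cmod (((s g + m) * (D g * cnj (D g))) / ?q) \<le> (cmod (D g))\<^sup>2 / 2" by simp
    qed
    \<comment> \<open>The other half of |D|^2: a b <= a^2/2 + b^2/2 turns the linear error into a
      constant of order N^-2.\<close>
    also have "K1 / real N * cmod (D g) \<le> (K1 / real N)\<^sup>2 / 2 + (cmod (D g))\<^sup>2 / 2"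
      using sum_squares_bound[of "K1 / real N" "cmod (D g)"] by simp
    finally show ?thesis unfolding split by (simp add: power_divide add_divide_distrib)
  qed
  have "y * (\<integral>g. (cmod (D g))\<^sup>2 \<partial>P) = cmod (\<i> * y * (\<integral>g. D g * cnj (D g) \<partial>P))"
  proof -
    have "(\<integral>g. D g * cnj (D g) \<partial>P) = complex_of_real (\<integral>g. (cmod (D g))\<^sup>2 \<partial>P)"
      unfolding D2 by (rule integral_complex_of_real)
    moreover have "(\<integral>g. (cmod (D g))\<^sup>2 \<partial>P) \<ge> 0" by simp
    ultimately show ?thesis using y_pos by (simp add: norm_mult)
  qed
  also have "\<dots> \<le> (\<integral>g. (cmod (D g))\<^sup>2 + (K1\<^sup>2 / 2 + K2) / (real N)\<^sup>2 \<partial>P)"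
    unfolding eq
  proof (rule order_trans[OF integral_norm_bound Bochner_Integration.integral_mono])
    show "integrable P (\<lambda>g. cmod (E g + m\<^sup>2 / ?q * cnj (D g)))"
      by (rule integrable_norm[OF bdd_meas_integrable[OF bdd_meas_add[OF bm_E bm_mD]]])
    show "integrable P (\<lambda>g. (cmod (D g))\<^sup>2 + (K1\<^sup>2 / 2 + K2) / (real N)\<^sup>2)"
      by (intro Bochner_Integration.integrable_add int P.integrable_const)
  qed (rule pointwise)
  also have "\<dots> = (\<integral>g. (cmod (D g))\<^sup>2 \<partial>P) + (K1\<^sup>2 / 2 + K2) / (real N)\<^sup>2"
    using int P.prob_space by simp
  finally have "y * (\<integral>g. (cmod (D g))\<^sup>2 \<partial>P) \<le> (\<integral>g. (cmod (D g))\<^sup>2 \<partial>P) + (K1\<^sup>2 / 2 + K2) / (real N)\<^sup>2" .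
  moreover have "2 * (\<integral>g. (cmod (D g))\<^sup>2 \<partial>P) \<le> y * (\<integral>g. (cmod (D g))\<^sup>2 \<partial>P)"
    using y_ge by (intro mult_right_mono) auto
  ultimately show "(\<integral>g. (cmod (D g))\<^sup>2 \<partial>P) \<le> (K1\<^sup>2 / 2 + K2) / (real N)\<^sup>2" by linarith
qed

end

section \<open>Cauchy transforms and weak convergence\<close>

definition cauchy_ker :: "real \<Rightarrow> real \<Rightarrow> complex" where
  "cauchy_ker y t = 1 / (complex_of_real t - \<i> * complex_of_real y)"

lemma cauchy_ker_nz: "y \<noteq> 0 \<Longrightarrow> complex_of_real t - \<i> * complex_of_real y \<noteq> 0"
  by (auto simp: complex_eq_iff)

lemma norm_cauchy_ker_le:
  assumes "y > 0" shows "cmod (cauchy_ker y t) \<le> 1 / y"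
proof -
  have "y \<le> cmod (complex_of_real t - \<i> * complex_of_real y)"
    using abs_Im_le_cmod[of "complex_of_real t - \<i> * complex_of_real y"] assms by simp
  then show ?thesis using assms by (simp add: cauchy_ker_def norm_divide frac_le)
qed

lemma cauchy_ker_diff:
  assumes "y > 0" "h > 0"
  shows "cauchy_ker (y + h) t - cauchy_ker y t = \<i> * h * cauchy_ker y t * cauchy_ker (y + h) t"
  using cauchy_ker_nz[of y t] cauchy_ker_nz[of "y + h" t] assms
  unfolding cauchy_ker_def by (simp add: field_simps)

lemma borel_measurable_cauchy_ker [measurable]: "cauchy_ker y \<in> borel_measurable borel"
  unfolding cauchy_ker_def by measurable

lemma norm_cauchy_ker_power_diff_le:
  assumes "y > 0" "h > 0"
  shows "cmod (cauchy_ker (y + h) t ^ n - cauchy_ker y t ^ n) \<le> real n * h / y ^ (n + 1)"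
proof -
  let ?f = "cauchy_ker y t" and ?g = "cauchy_ker (y + h) t"
  have f: "cmod ?f \<le> 1 / y" and g: "cmod ?g \<le> 1 / y"
    using norm_cauchy_ker_le[of y t] norm_cauchy_ker_le[of "y + h" t] assms
    by (auto elim!: order_trans simp: frac_le)
  \<comment> \<open>The kernels are scaled by y because the bound for a difference of powers asks
    for modulus at most 1.\<close>
  have "cmod ((y * ?g) ^ n - (y * ?f) ^ n) \<le> real n * cmod (y * ?g - y * ?f)"
    using f g assms by (intro norm_power_diff) (auto simp: norm_mult field_simps)
  also have "cmod (y * ?g - y * ?f) = y * cmod (?g - ?f)"
    using assms by (simp add: norm_mult flip: right_diff_distrib)
  also have "cmod (?g - ?f) = h * (cmod ?f * cmod ?g)"
    using assms by (simp add: cauchy_ker_diff norm_mult)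
  also have "(y * ?g) ^ n - (y * ?f) ^ n = y ^ n * (?g ^ n - ?f ^ n)"
    by (simp add: power_mult_distrib algebra_simps)
  also have "cmod \<dots> = y ^ n * cmod (?g ^ n - ?f ^ n)"
    using assms by (simp add: norm_mult norm_power)
  finally have "y ^ n * cmod (?g ^ n - ?f ^ n) \<le> real n * (y * (h * (cmod ?f * cmod ?g)))" .
  also have "\<dots> \<le> real n * (y * (h * (1 / y * (1 / y))))"
    using assms f g by (intro mult_left_mono mult_mono) auto
  also have "\<dots> = real n * h / y" using assms by (simp add: field_simps)
  finally show ?thesis using assms by (simp add: field_simps)
qed

text \<open>The y-derivative of the n-th power of the kernel is \<i> n times the next power. What
  matters is that the remainder is uniform in t, so that it survives integration against any
  probability measure. The induction is the product rule, and n^2 + n + 1 <= (n + 1)^2 closes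
  it.\<close>

lemma norm_cauchy_ker_power_diffquot_le:
  assumes "y > 0" "h > 0"
  shows "cmod (cauchy_ker (y + h) t ^ n - cauchy_ker y t ^ n - \<i> * h * of_nat n * cauchy_ker y t ^ (n + 1))
    \<le> h\<^sup>2 * (real n)\<^sup>2 / y ^ (n + 2)"
proof (induction n)
  case (Suc n)
  let ?f = "cauchy_ker y t" and ?g = "cauchy_ker (y + h) t"
  define E where "E = ?g ^ n - ?f ^ n - \<i> * h * of_nat n * ?f ^ (n + 1)"
  have "?g ^ Suc n - ?f ^ Suc n = ?g ^ n * (?g - ?f) + ?f * (?g ^ n - ?f ^ n)"
    by (simp add: algebra_simps)
  then have "?g ^ Suc n - ?f ^ Suc n = ?g ^ n * (\<i> * h * ?f * ?g) + ?f * (?g ^ n - ?f ^ n)"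
    unfolding cauchy_ker_diff[OF assms] .
  then have "?g ^ Suc n - ?f ^ Suc n - \<i> * h * of_nat (Suc n) * ?f ^ (Suc n + 1)
    = ?f * E + \<i> * h * ?f * (?g ^ (n + 1) - ?f ^ (n + 1))"
    unfolding E_def by (simp add: algebra_simps)
  also have "cmod \<dots> \<le> cmod (?f * E) + cmod (\<i> * h * ?f * (?g ^ (n + 1) - ?f ^ (n + 1)))"
    by (rule norm_triangle_ineq)
  also have "\<dots> = cmod ?f * cmod E + h * (cmod ?f * cmod (?g ^ (n + 1) - ?f ^ (n + 1)))"
    using assms by (simp add: norm_mult)
  also have "\<dots> \<le> 1 / y * (h\<^sup>2 * (real n)\<^sup>2 / y ^ (n + 2)) + h * (1 / y * (real (n + 1) * h / y ^ (n + 1 + 1)))"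
    using assms Suc unfolding E_def
    by (intro add_mono mult_mono norm_cauchy_ker_power_diff_le norm_cauchy_ker_le) auto
  also have "\<dots> = h\<^sup>2 * ((real n)\<^sup>2 + real n + 1) / y ^ (Suc n + 2)"
    using assms by (simp add: field_simps power2_eq_square)
  also have "\<dots> \<le> h\<^sup>2 * (real (Suc n))\<^sup>2 / y ^ (Suc n + 2)"
    using assms by (intro divide_right_mono mult_left_mono) (auto simp: power2_eq_square algebra_simps)
  finally show ?case .
qed simp

lemma (in real_distribution) integrable_cauchy_ker_power:
  assumes "y > 0" shows "integrable M (\<lambda>t. cauchy_ker y t ^ n)"
proof (rule integrable_const_bound[where B = "(1 / y) ^ n"])
  show "AE t in M. cmod (cauchy_ker y t ^ n) \<le> (1 / y) ^ n"
    using norm_cauchy_ker_le[OF assms] by (auto simp: norm_power intro!: power_mono)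
qed simp

text \<open>Interchange of limits: a sequence that is uniformly close to convergent ones, with close
  limits, converges. It is applied to powers of the kernel, to characteristic functions and to the
  passage from rational to real heights.\<close>

lemma tendsto_by_approx:
  fixes X :: "nat \<Rightarrow> 'a :: real_normed_vector"
  assumes "\<And>e. e > 0 \<Longrightarrow> \<exists>Y y. Y \<longlonglongrightarrow> y \<and> (\<forall>\<^sub>F n in sequentially. norm (X n - Y n) \<le> e) \<and> norm (x - y) \<le> e"
  shows "X \<longlonglongrightarrow> x"
proof (rule tendstoI)
  fix e :: real assume "e > 0"
  then obtain Y y where Y: "Y \<longlonglongrightarrow> y" "\<forall>\<^sub>F n in sequentially. norm (X n - Y n) \<le> e / 4" "norm (x - y) \<le> e / 4"
    using assms[of "e / 4"] by auto
  have "\<forall>\<^sub>F n in sequentially. dist (Y n) y < e / 4"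
    using Y(1) \<open>e > 0\<close> by (intro tendstoD) auto
  with Y(2) show "\<forall>\<^sub>F n in sequentially. dist (X n) x < e"
  proof eventually_elim
    case (elim n)
    have "norm (X n - x) = norm ((X n - Y n) + (Y n - y) - (x - y))" by simp
    also have "\<dots> \<le> norm (X n - Y n) + norm (Y n - y) + norm (x - y)"
      by (meson norm_triangle_ineq norm_triangle_ineq4 order_trans add_right_mono)
    also have "\<dots> < e" using elim Y(3) \<open>e > 0\<close> by (simp add: dist_norm)
    finally show ?case by (simp add: dist_norm)
  qed
qed

lemma (in real_distribution) cauchy_ker_power_integral_approx:
  assumes "y > 0" "h > 0" "n > 0"
  shows "cmod ((\<integral>t. cauchy_ker y t ^ (n + 1) \<partial>M) -
     ((\<integral>t. cauchy_ker (y + h) t ^ n \<partial>M) - (\<integral>t. cauchy_ker y t ^ n \<partial>M)) / (\<i> * h * of_nat n))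
     \<le> h * real n / y ^ (n + 2)"
proof -
  have yh: "y + h > 0" using assms by simp
  have nz: "\<i> * complex_of_real h * of_nat n \<noteq> 0" using assms by simp
  let ?D = "\<lambda>t. cauchy_ker (y + h) t ^ n - cauchy_ker y t ^ n - \<i> * h * of_nat n * cauchy_ker y t ^ (n + 1)"
  note i1 = integrable_cauchy_ker_power[OF yh, of n]
  note i2 = integrable_cauchy_ker_power[OF \<open>y > 0\<close>, of n]
  note i3 = integrable_mult_right[OF integrable_cauchy_ker_power[OF \<open>y > 0\<close>, of "n + 1"], of "\<i> * h * of_nat n"]
  note i12 = Bochner_Integration.integrable_diff[OF i1 i2]
  note int = Bochner_Integration.integrable_diff[OF i12 i3]
  have "(\<integral>t. ?D t \<partial>M) = (\<integral>t. cauchy_ker (y + h) t ^ n \<partial>M) - (\<integral>t. cauchy_ker y t ^ n \<partial>M)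
      - \<i> * h * of_nat n * (\<integral>t. cauchy_ker y t ^ (n + 1) \<partial>M)"
    unfolding Bochner_Integration.integral_diff[OF i12 i3] Bochner_Integration.integral_diff[OF i1 i2]
      integral_mult_right_zero ..
  moreover have "a - (b - c) / w = - (b - c - w * a) / w" if "w \<noteq> 0" for a b c w :: complex
    using that by (simp add: field_simps)
  ultimately have "(\<integral>t. cauchy_ker y t ^ (n + 1) \<partial>M) -
     ((\<integral>t. cauchy_ker (y + h) t ^ n \<partial>M) - (\<integral>t. cauchy_ker y t ^ n \<partial>M)) / (\<i> * h * of_nat n)
     = - (\<integral>t. ?D t \<partial>M) / (\<i> * h * of_nat n)"
    using nz by presburger
  also have "cmod \<dots> = cmod (\<integral>t. ?D t \<partial>M) / (h * real n)"
    using assms by (simp add: norm_divide norm_mult)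
  also have "cmod (\<integral>t. ?D t \<partial>M) \<le> (\<integral>t. h\<^sup>2 * (real n)\<^sup>2 / y ^ (n + 2) \<partial>M)"
    by (intro Bochner_Integration.integral_norm_bound_integral int norm_cauchy_ker_power_diffquot_le assms) auto
  also have "\<dots> = h\<^sup>2 * (real n)\<^sup>2 / y ^ (n + 2)" using prob_space by simp
  finally have "cmod ((\<integral>t. cauchy_ker y t ^ (n + 1) \<partial>M) -
     ((\<integral>t. cauchy_ker (y + h) t ^ n \<partial>M) - (\<integral>t. cauchy_ker y t ^ n \<partial>M)) / (\<i> * h * of_nat n))
    \<le> h\<^sup>2 * (real n)\<^sup>2 / y ^ (n + 2) / (h * real n)"
    using assms by (simp add: divide_right_mono)
  also have "\<dots> = h * real n / y ^ (n + 2)"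
    using assms by (simp add: power2_eq_square field_simps)
  finally show ?thesis .
qed

text \<open>The integral of a power is a difference quotient of integrals of the preceding power at
  heights y and y + h, up to an error that is the same for all measures; the induction therefore
  carries all heights above \<open>y0\<close>.\<close>

lemma cauchy_ker_power_conv:
  assumes \<mu>: "\<And>n. real_distribution (\<mu> n)" and M: "real_distribution M" and "y0 \<ge> 0"
    and conv: "\<And>y. y > y0 \<Longrightarrow> (\<lambda>n. \<integral>t. cauchy_ker y t \<partial>\<mu> n) \<longlonglongrightarrow> (\<integral>t. cauchy_ker y t \<partial>M)"
    and "y > y0" "k > 0"
  shows "(\<lambda>n. \<integral>t. cauchy_ker y t ^ k \<partial>\<mu> n) \<longlonglongrightarrow> (\<integral>t. cauchy_ker y t ^ k \<partial>M)"
  using \<open>k > 0\<close> \<open>y > y0\<close>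
proof (induction k arbitrary: y rule: nat_induct_non_zero)
  case (Suc k)
  have y: "y > 0" using Suc \<open>y0 \<ge> 0\<close> by linarith
  show ?case
  proof (rule tendsto_by_approx)
    fix e :: real assume "e > 0"
    \<comment> \<open>Chosen so that the error of the difference quotient is exactly
      \<open>e\<close>.\<close>
    define h where "h = e * y ^ (k + 2) / real k"
    have h: "h > 0" using \<open>e > 0\<close> y Suc by (simp add: h_def)
    have he: "h * real k / y ^ (k + 2) = e" using y Suc by (simp add: h_def)
    let ?Q = "\<lambda>\<nu>. ((\<integral>t. cauchy_ker (y + h) t ^ k \<partial>\<nu>) - (\<integral>t. cauchy_ker y t ^ k \<partial>\<nu>)) / (\<i> * h * of_nat k)"
    have "(\<lambda>n. ?Q (\<mu> n)) \<longlonglongrightarrow> ?Q M"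
      using Suc h by (intro tendsto_intros Suc.IH) auto
    moreover have "cmod ((\<integral>t. cauchy_ker y t ^ Suc k \<partial>\<mu> n) - ?Q (\<mu> n)) \<le> e" for n
      using real_distribution.cauchy_ker_power_integral_approx[OF \<mu> y h, of k n] Suc he by simp
    moreover have "cmod ((\<integral>t. cauchy_ker y t ^ Suc k \<partial>M) - ?Q M) \<le> e"
      using real_distribution.cauchy_ker_power_integral_approx[OF M y h, of k] Suc he by simp
    ultimately show "\<exists>Y x. Y \<longlonglongrightarrow> x \<and> (\<forall>\<^sub>F n in sequentially.
        cmod ((\<integral>t. cauchy_ker y t ^ Suc k \<partial>\<mu> n) - Y n) \<le> e) \<and> cmod ((\<integral>t. cauchy_ker y t ^ Suc k \<partial>M) - x) \<le> e"
      by (intro exI[of _ "\<lambda>n. ?Q (\<mu> n)"] exI[of _ "?Q M"]) auto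
  qed
qed (use conv in simp)

text \<open>A smooth substitute for the indicator of |t| > y. Its integral is an affine function of
  the Cauchy transform at \<i> y, so tail masses can be read off from the transforms.\<close>

definition tail_ker :: "real \<Rightarrow> real \<Rightarrow> real" where
  "tail_ker y t = t\<^sup>2 / (t\<^sup>2 + y\<^sup>2)"

lemma tail_ker_eq: "y > 0 \<Longrightarrow> tail_ker y t = 1 - y * Im (cauchy_ker y t)"
proof -
  assume y: "y > 0"
  have "Im (cauchy_ker y t) = y / (t\<^sup>2 + y\<^sup>2)"
    by (simp add: cauchy_ker_def Im_divide)
  moreover have "t\<^sup>2 + y\<^sup>2 \<noteq> 0" using y by (simp add: sum_power2_eq_zero_iff)
  ultimately have "tail_ker y t + y * Im (cauchy_ker y t) = (t\<^sup>2 + y\<^sup>2) / (t\<^sup>2 + y\<^sup>2)"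
    unfolding tail_ker_def by (simp only: add_divide_distrib power2_eq_square times_divide_eq_right)
  also have "\<dots> = 1" using \<open>t\<^sup>2 + y\<^sup>2 \<noteq> 0\<close> by simp
  finally show ?thesis by linarith
qed

text \<open>Clearing the denominator, of modulus at least 1, leaves the second-order Taylor
  remainder of the exponential.\<close>

lemma norm_iexp_minus_resolvent_le:
  "cmod (iexp (- u) - 1 / (1 + \<i> * complex_of_real u)) \<le> u\<^sup>2 / 2"
proof -
  let ?w = "1 + \<i> * complex_of_real u"
  have w: "?w \<noteq> 0" by (auto simp: complex_eq_iff)
  have w1: "cmod ?w \<ge> 1" using abs_Re_le_cmod[of ?w] by simp
  have "iexp (- u) - 1 / ?w = (iexp (- u) * (?w - iexp u)) / ?w"
    using w by (simp add: field_simps exp_minus)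
  also have "cmod \<dots> = cmod (iexp u - ?w) / cmod ?w"
    by (simp add: norm_divide norm_mult norm_minus_commute)
  also have "\<dots> \<le> cmod (iexp u - ?w)"
    using w1 by (simp add: divide_le_eq mult_le_cancel_left1)
  also have "\<dots> \<le> u\<^sup>2 / 2"
    using iexp_approx1[of u 1] by (simp add: numeral_2_eq_2)
  finally show ?thesis .
qed

text \<open>Post's approximation of the exponential turns powers of the Cauchy kernel on the imaginary
  axis into characters.\<close>
lemma norm_iexp_minus_resolvent_power_le:
  fixes n :: nat and s t :: real
  assumes "n > 0" "s > 0"
  shows "cmod (iexp (- s * t) - (1 / (1 + \<i> * complex_of_real (s * t / n))) ^ n)
    \<le> 5 / 2 * tail_ker (sqrt n / s) t"
proof -
  define u where "u = s * t / n"
  let ?w = "1 / (1 + \<i> * complex_of_real u)"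
  have w1: "cmod (1 + \<i> * complex_of_real u) \<ge> 1" using abs_Re_le_cmod[of "1 + \<i> * complex_of_real u"] by simp
  have w: "cmod ?w \<le> 1" using w1 by (simp add: norm_divide divide_le_eq)
  have e: "iexp (- s * t) = iexp (- u) ^ n"
    using assms by (simp add: exp_of_nat_mult[symmetric] u_def)
  have "cmod (iexp (- u) ^ n - ?w ^ n) \<le> real n * cmod (iexp (- u) - ?w)"
    by (intro norm_power_diff w) simp
  also have "\<dots> \<le> real n * (u\<^sup>2 / 2)"
    by (intro mult_left_mono norm_iexp_minus_resolvent_le) simp
  finally have 1: "cmod (iexp (- u) ^ n - ?w ^ n) \<le> (s * t)\<^sup>2 / real n / 2"
    using assms by (simp add: u_def power2_eq_square field_simps)
  have "cmod (iexp (- u) ^ n - ?w ^ n) \<le> cmod (iexp (- u) ^ n) + cmod (?w ^ n)"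
    by (rule norm_triangle_ineq4)
  also have "\<dots> \<le> 1 + 1"
    using w by (intro add_mono) (simp_all add: norm_power power_le_one)
  finally have 2: "cmod (iexp (- u) ^ n - ?w ^ n) \<le> 2" by simp
  \<comment> \<open>The two bounds found are a/2 and 2. They cross at a = 4, and equality with a
    multiple of a / (1 + a) at that point forces the factor 5/2.\<close>
  define a where "a = (s * t)\<^sup>2 / real n"
  have a: "a \<ge> 0" by (simp add: a_def)
  have "cmod (iexp (- u) ^ n - ?w ^ n) \<le> 5 / 2 * (a / (1 + a))"
  proof (cases "a \<le> 4")
    case True
    have "a / 2 \<le> 5 / 2 * (a / (1 + a))"
    proof -
      have "a * (1 + a) \<le> a * 5" using a True by (intro mult_left_mono) auto
      then have "a \<le> a * 5 / (1 + a)" using a by (simp add: le_divide_eq)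
      then have "a / 2 \<le> (a * 5 / (1 + a)) / 2" by (rule divide_right_mono) simp
      also have "\<dots> = 5 / 2 * (a / (1 + a))" by (simp only: divide_divide_eq_left times_divide_times_eq mult.commute)
      finally show ?thesis .
    qed
    then show ?thesis using 1 by (simp add: a_def)
  next
    case False
    then have "2 \<le> 5 / 2 * (a / (1 + a))" by (simp add: field_simps)
    then show ?thesis using 2 by simp
  qed
  also have "a / (1 + a) = tail_ker (sqrt n / s) t"
  proof -
    have "a / (1 + a) = (real n / s\<^sup>2 * a) / (real n / s\<^sup>2 * (1 + a))" using assms by simp
    also have "real n / s\<^sup>2 * a = t\<^sup>2" using assms by (simp add: a_def power_mult_distrib)
    also have "real n / s\<^sup>2 * (1 + a) = t\<^sup>2 + (sqrt n / s)\<^sup>2"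
      using \<open>real n / s\<^sup>2 * a = t\<^sup>2\<close> by (simp add: distrib_left power_divide)
    finally show ?thesis by (simp add: tail_ker_def)
  qed
  finally show ?thesis unfolding e u_def[symmetric] .
qed

lemma tail_ker_nonneg: "tail_ker y t \<ge> 0" by (simp add: tail_ker_def)

lemma tail_ker_le_1: "tail_ker y t \<le> 1"
proof -
  have "t\<^sup>2 + y\<^sup>2 = 0 \<or> 0 < t\<^sup>2 + y\<^sup>2" by (auto simp: sum_power2_gt_zero_iff)
  then show ?thesis by (auto simp: tail_ker_def divide_le_eq_1)
qed

lemma borel_measurable_tail_ker [measurable]: "tail_ker y \<in> borel_measurable borel"
  unfolding tail_ker_def by measurable

lemma (in real_distribution) integrable_tail_ker: "integrable M (tail_ker y)"
  by (rule integrable_const_bound[where B = 1]) (auto simp: tail_ker_nonneg tail_ker_le_1)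

lemma (in real_distribution) integral_tail_ker:
  assumes "y > 0"
  shows "(\<integral>t. tail_ker y t \<partial>M) = 1 - y * Im (\<integral>t. cauchy_ker y t \<partial>M)"
  using integrable_cauchy_ker_power[OF assms, of 1] assms prob_space
  by (simp add: tail_ker_eq)

lemma (in real_distribution) integral_tail_ker_tendsto_0:
  assumes "s > 0"
  shows "(\<lambda>n. \<integral>t. tail_ker (sqrt (real n) / s) t \<partial>M) \<longlonglongrightarrow> 0"
proof -
  have "(\<lambda>n. \<integral>t. tail_ker (sqrt (real n) / s) t \<partial>M) \<longlonglongrightarrow> (\<integral>t. 0 \<partial>M)"
  proof (rule integral_dominated_convergence[where w = "\<lambda>_. 1"])
    show "AE t in M. (\<lambda>n. tail_ker (sqrt (real n) / s) t) \<longlonglongrightarrow> 0"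
    proof (intro AE_I2)
      fix t :: real
      have "filterlim (\<lambda>n. t\<^sup>2 + real n / s\<^sup>2) at_top sequentially"
        using assms by real_asymp
      then have "(\<lambda>n. t\<^sup>2 / (t\<^sup>2 + real n / s\<^sup>2)) \<longlonglongrightarrow> 0"
        by (intro tendsto_divide_0[OF tendsto_const] filterlim_at_top_imp_at_infinity)
      then show "(\<lambda>n. tail_ker (sqrt (real n) / s) t) \<longlonglongrightarrow> 0"
        by (simp add: tail_ker_def power_divide)
    qed
  qed (auto simp: tail_ker_nonneg tail_ker_le_1)
  then show ?thesis by simp
qed

section \<open>From Cauchy transforms to characteristic functions\<close>

lemma cauchy_ker_scaled:
  assumes "n > 0" "s > 0"
  shows "1 / (1 + \<i> * complex_of_real (s * t / real n)) = (of_nat n / (\<i> * s)) * cauchy_ker (real n / s) t"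
proof -
  have "1 + \<i> * complex_of_real (s * t / real n) = (\<i> * s / of_nat n) * (t - \<i> * complex_of_real (real n / s))"
    using assms by (simp add: field_simps)
  then show ?thesis by (simp add: cauchy_ker_def)
qed

text \<open>Integrates the pointwise approximation of the character. The error is again expressed by
  a Cauchy transform, now at height sqrt n / s, and so its limit along a sequence of measures is
  known.\<close>

lemma (in real_distribution) char_approx_cauchy_ker:
  assumes "n > 0" "s > 0"
  shows "cmod (char M (- s) - (of_nat n / (\<i> * s)) ^ n * (\<integral>t. cauchy_ker (real n / s) t ^ n \<partial>M))
    \<le> 5 / 2 * (\<integral>t. tail_ker (sqrt n / s) t \<partial>M)"
proof -
  have y: "real n / s > 0" using assms by simp
  have i1: "integrable M (\<lambda>t. iexp (- s * t))"
    by (rule integrable_const_bound[where B = 1]) auto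
  note i2 = integrable_cauchy_ker_power[OF y, of n]
  let ?c = "(of_nat n / (\<i> * complex_of_real s)) ^ n"
  note i3 = integrable_mult_right[OF i2, of ?c]
  have eq: "(1 / (1 + \<i> * complex_of_real (s * t / n))) ^ n = ?c * cauchy_ker (real n / s) t ^ n" for t
    unfolding cauchy_ker_scaled[OF assms] power_mult_distrib ..
  have "char M (- s) - ?c * (\<integral>t. cauchy_ker (real n / s) t ^ n \<partial>M)
     = (\<integral>t. iexp (- s * t) - ?c * cauchy_ker (real n / s) t ^ n \<partial>M)"
    unfolding char_def Bochner_Integration.integral_diff[OF i1 i3] integral_mult_right_zero ..
  also have "cmod \<dots> \<le> (\<integral>t. 5 / 2 * tail_ker (sqrt n / s) t \<partial>M)"
  proof (rule Bochner_Integration.integral_norm_bound_integral)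
    show "cmod (iexp (- s * t) - ?c * cauchy_ker (real n / s) t ^ n) \<le> 5 / 2 * tail_ker (sqrt n / s) t" for t
      using norm_iexp_minus_resolvent_power_le[OF assms, of t] unfolding eq .
  qed (intro Bochner_Integration.integrable_diff i1 i3 integrable_mult_right integrable_tail_ker)+
  finally show ?thesis by simp
qed

lemma char_uminus: "char M (- t) = cnj (char M t)"
proof -
  have "iexp (- t * x) = cnj (iexp (t * x))" for x by (simp add: exp_cnj)
  then have "char M (- t) = (\<integral>x. cnj (iexp (t * x)) \<partial>M)" unfolding char_def by presburger
  also have "\<dots> = cnj (char M t)" unfolding char_def by (rule Bochner_Integration.integral_cnj)
  finally show ?thesis .
qed

text \<open>For fixed s, a large k makes the tail error small under the limit measure; by
  convergence of the transforms it is then small under \<open>\<mu> n\<close> for large n, which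
  plays the part of tightness. The approximation is made at negative arguments, and conjugation
  gives the positive ones.\<close>

theorem weak_conv_of_cauchy_transforms:
  assumes \<mu>: "\<And>n. real_distribution (\<mu> n)" and M: "real_distribution M" and "y0 \<ge> 0"
    and conv: "\<And>y. y > y0 \<Longrightarrow> (\<lambda>n. \<integral>t. cauchy_ker y t \<partial>\<mu> n) \<longlonglongrightarrow> (\<integral>t. cauchy_ker y t \<partial>M)"
  shows "weak_conv_m \<mu> M"
proof (rule levy_continuity[OF \<mu> M])
  have neg: "(\<lambda>n. char (\<mu> n) (- s)) \<longlonglongrightarrow> char M (- s)" if s: "s > 0" for s
  proof (rule tendsto_by_approx)
    fix e :: real assume "e > 0"
    have "filterlim (\<lambda>k. sqrt (real k) / s) at_top sequentially"
         "filterlim (\<lambda>k. real k / s) at_top sequentially"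
      using s by real_asymp+
    then have "\<forall>\<^sub>F k in sequentially. sqrt (real k) / s > y0" "\<forall>\<^sub>F k in sequentially. real k / s > y0"
      by (auto simp: filterlim_at_top_dense)
    \<comment> \<open>The factor 5/2 in the character bound turns e/5 into e/2.\<close>
    moreover have "\<forall>\<^sub>F k in sequentially. (\<integral>t. tail_ker (sqrt (real k) / s) t \<partial>M) < e / 5"
      using \<open>e > 0\<close> by (intro order_tendstoD[OF real_distribution.integral_tail_ker_tendsto_0[OF M s]]) auto
    ultimately have "\<forall>\<^sub>F k in sequentially. sqrt (real k) / s > y0 \<and> real k / s > y0 \<and> k > 0 \<and>
        (\<integral>t. tail_ker (sqrt (real k) / s) t \<partial>M) < e / 5"
      using eventually_gt_at_top[of 0] by eventually_elim auto
    from eventually_happens'[OF sequentially_bot this]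
    obtain k where k: "sqrt (real k) / s > y0" "real k / s > y0" "k > 0"
        "(\<integral>t. tail_ker (sqrt (real k) / s) t \<partial>M) < e / 5"
      by blast
    have pos: "sqrt (real k) / s > 0" using k s by simp
    let ?Q = "\<lambda>\<nu>. (of_nat k / (\<i> * s)) ^ k * (\<integral>t. cauchy_ker (real k / s) t ^ k \<partial>\<nu>)"
    have "(\<lambda>n. ?Q (\<mu> n)) \<longlonglongrightarrow> ?Q M"
      by (intro tendsto_intros cauchy_ker_power_conv[OF \<mu> M \<open>y0 \<ge> 0\<close> conv] k)
    moreover have "(\<lambda>n. 1 - sqrt k / s * Im (\<integral>t. cauchy_ker (sqrt k / s) t \<partial>\<mu> n))
         \<longlonglongrightarrow> 1 - sqrt k / s * Im (\<integral>t. cauchy_ker (sqrt k / s) t \<partial>M)"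
      by (intro tendsto_intros conv k)
    then have "(\<lambda>n. \<integral>t. tail_ker (sqrt k / s) t \<partial>\<mu> n) \<longlonglongrightarrow> (\<integral>t. tail_ker (sqrt k / s) t \<partial>M)"
      by (simp add: real_distribution.integral_tail_ker[OF \<mu> pos] real_distribution.integral_tail_ker[OF M pos])
    then have "\<forall>\<^sub>F n in sequentially. (\<integral>t. tail_ker (sqrt k / s) t \<partial>\<mu> n) < e / 5"
      using k(4) by (rule order_tendstoD)
    then have "\<forall>\<^sub>F n in sequentially. cmod (char (\<mu> n) (- s) - ?Q (\<mu> n)) \<le> e"
    proof eventually_elim
      case (elim n)
      show ?case
        using real_distribution.char_approx_cauchy_ker[OF \<mu>[of n] \<open>k > 0\<close> s] elim \<open>e > 0\<close> by linarith
    qed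
    moreover have "cmod (char M (- s) - ?Q M) \<le> e"
      using real_distribution.char_approx_cauchy_ker[OF M \<open>k > 0\<close> s] k(4) \<open>e > 0\<close> by linarith
    ultimately show "\<exists>Y x. Y \<longlonglongrightarrow> x \<and> (\<forall>\<^sub>F n in sequentially.
        cmod (char (\<mu> n) (- s) - Y n) \<le> e) \<and> cmod (char M (- s) - x) \<le> e"
      by (intro exI[of _ "\<lambda>n. ?Q (\<mu> n)"] exI[of _ "?Q M"]) auto
  qed
  show "(\<lambda>n. char (\<mu> n) t) \<longlonglongrightarrow> char M t" for t
  proof (cases t "0 :: real" rule: linorder_cases)
    case less
    then show ?thesis using neg[of "- t"] by simp
  next
    case equal
    then show ?thesis using \<mu> M by (simp add: real_distribution.char_zero)
  next
    case greater
    from tendsto_cnj[OF neg[OF greater]] show ?thesis by (simp add: char_uminus)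
  qed
qed

section \<open>The semicircle distribution\<close>

lemma integral_semicircle_eq:
  fixes f :: "real \<Rightarrow> complex"
  assumes [measurable]: "f \<in> borel_measurable borel" and cont: "continuous_on {- beta_d d..beta_d d} f"
  shows "(\<integral>x. f x \<partial>semicircle_d d) = integral {- beta_d d..beta_d d}
     (\<lambda>x. (2 / (pi * (beta_d d)\<^sup>2) * sqrt ((beta_d d)\<^sup>2 - x\<^sup>2)) *\<^sub>R f x)"
proof -
  let ?b = "beta_d d"
  let ?c = "2 / (pi * ?b\<^sup>2)"
  have b: "?b \<ge> 0" by (cases d) (simp_all add: beta_d_def)
  have "(\<integral>x. f x \<partial>semicircle_d d) = (\<integral>x. (?c * sqrt (max 0 (?b\<^sup>2 - x\<^sup>2))) *\<^sub>R f x \<partial>lborel)"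
    unfolding semicircle_d_def by (rule integral_density) auto
  also have "\<dots> = (LINT x:{-?b..?b}|lborel. (?c * sqrt (?b\<^sup>2 - x\<^sup>2)) *\<^sub>R f x)"
    unfolding set_lebesgue_integral_def
  proof (intro Bochner_Integration.integral_cong refl)
    fix x
    show "(?c * sqrt (max 0 (?b\<^sup>2 - x\<^sup>2))) *\<^sub>R f x = indicat_real {-?b..?b} x *\<^sub>R (?c * sqrt (?b\<^sup>2 - x\<^sup>2)) *\<^sub>R f x"
    proof (cases "x \<in> {-?b..?b}")
      case True
      then have "\<bar>x\<bar> \<le> \<bar>?b\<bar>" using b by auto
      then have "x\<^sup>2 \<le> ?b\<^sup>2" by (simp only: abs_le_square_iff)
      then show ?thesis using True by simp
    next
      case False
      then have "\<not> \<bar>x\<bar> \<le> \<bar>?b\<bar>" using b by auto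
      then have "\<not> x\<^sup>2 \<le> ?b\<^sup>2" by (simp only: abs_le_square_iff not_False_eq_True)
      then show ?thesis using False by simp
    qed
  qed
  also have "\<dots> = integral {-?b..?b} (\<lambda>x. (?c * sqrt (?b\<^sup>2 - x\<^sup>2)) *\<^sub>R f x)"
    by (intro set_borel_integral_eq_integral borel_integrable_atLeastAtMost' continuous_intros cont)
  finally show ?thesis .
qed

context
  fixes b :: real
  assumes b: "b > 0"
begin

lemma arcsin_scaled_deriv:
  assumes "t \<in> {-b<..<b}"
  shows "((\<lambda>t. arcsin (t / b)) has_real_derivative 1 / sqrt (b\<^sup>2 - t\<^sup>2)) (at t)"
proof -
  have t: "- 1 < t / b" "t / b < 1" using assms b by (auto simp: field_simps)
  have "1 - (t / b)\<^sup>2 = (b\<^sup>2 - t\<^sup>2) / b\<^sup>2" using b by (simp add: field_simps)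
  then have s: "sqrt (1 - (t / b)\<^sup>2) = sqrt (b\<^sup>2 - t\<^sup>2) / b" using b by (simp add: real_sqrt_divide)
  have "((\<lambda>t. arcsin (t / b)) has_real_derivative inverse (sqrt (1 - (t / b)\<^sup>2)) * (1 / b)) (at t)"
    by (rule DERIV_chain2[where f = arcsin and g = "\<lambda>t. t / b", OF DERIV_arcsin[OF t] DERIV_cdivide[OF DERIV_ident]])
  then show ?thesis using b by (simp add: s)
qed

lemma disc_pos:
  assumes "t \<in> {-b<..<b}"
  shows "b\<^sup>2 - t\<^sup>2 > 0"
proof -
  have "(b - t) * (b + t) > 0" using assms by simp
  then show ?thesis by (simp add: power2_eq_square algebra_simps)
qed

lemma sqrt_disc_deriv:
  assumes "t \<in> {-b<..<b}"
  shows "((\<lambda>t. sqrt (b\<^sup>2 - t\<^sup>2)) has_real_derivative - t / sqrt (b\<^sup>2 - t\<^sup>2)) (at t)"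
  using disc_pos[OF assms] by (auto intro!: derivative_eq_intros simp: field_simps)

lemma semicircle_area: "((\<lambda>t. sqrt (b\<^sup>2 - t\<^sup>2)) has_integral (pi * b\<^sup>2 / 2)) {-b..b}"
proof -
  let ?F = "\<lambda>t. (t * sqrt (b\<^sup>2 - t\<^sup>2) + b\<^sup>2 * arcsin (t / b)) / 2"
  have "((\<lambda>t. sqrt (b\<^sup>2 - t\<^sup>2)) has_integral (?F b - ?F (-b))) {-b..b}"
  \<comment> \<open>The arcsine has no derivative at the endpoints, so differentiability is shown in
    the interior and continuity on the closed interval.\<close>
  proof (rule fundamental_theorem_of_calculus_interior)
    show "continuous_on {-b..b} ?F"
      using b by (intro continuous_intros) (auto simp: field_simps)
  next
    fix t assume t: "t \<in> {-b<..<b}"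
    let ?w = "sqrt (b\<^sup>2 - t\<^sup>2)"
    have w: "?w > 0" "?w * ?w = b\<^sup>2 - t\<^sup>2" using disc_pos[OF t] by auto
    have "(?F has_real_derivative (1 * ?w + (- t / ?w) * t + b\<^sup>2 * (1 / ?w)) / 2) (at t)"
      by (intro DERIV_cdivide DERIV_add DERIV_cmult DERIV_mult DERIV_ident arcsin_scaled_deriv sqrt_disc_deriv t)
    also have "(1 * ?w + (- t / ?w) * t + b\<^sup>2 * (1 / ?w)) / 2 = ?w"
      using w by (simp add: field_simps power2_eq_square)
    finally show "(?F has_vector_derivative ?w) (at t)"
      by (simp add: has_real_derivative_iff_has_vector_derivative)
  qed (use b in auto)
  then show ?thesis using b by (simp add: field_simps)
qed

text \<open>With w = sqrt(b^2 - t^2) and r^2 = x^2 - b^2, the integrand is - t/w - x/w + r^2/(w (x -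
  t)). The first two terms integrate to w and - x arcsin(t/b). For the third, the Moebius map
  \<open>?q\<close> takes [-b, b] onto [-1, 1] and satisfies 1 - q^2 = (r w / (b (x - t)))^2, so r
  arcsin(q) is a primitive.\<close>

lemma semicircle_stieltjes_real:
  assumes x: "x > b"
  shows "((\<lambda>t. sqrt (b\<^sup>2 - t\<^sup>2) / (t - x)) has_integral (pi * (sqrt (x\<^sup>2 - b\<^sup>2) - x))) {-b..b}"
proof -
  define r where "r = sqrt (x\<^sup>2 - b\<^sup>2)"
  have "x\<^sup>2 - b\<^sup>2 > 0"
  proof -
    have "(x - b) * (x + b) > 0" using x b by simp
    then show ?thesis by (simp add: power2_eq_square algebra_simps)
  qed
  then have r: "r > 0" "r * r = x\<^sup>2 - b\<^sup>2" by (auto simp: r_def)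
  let ?q = "\<lambda>t. (x * t - b\<^sup>2) / (b * (x - t))"
  have q1: "1 - (?q t)\<^sup>2 = (r * sqrt (b\<^sup>2 - t\<^sup>2) / (b * (x - t)))\<^sup>2" if "t \<in> {-b..b}" for t
  proof -
    have w: "sqrt (b\<^sup>2 - t\<^sup>2) * sqrt (b\<^sup>2 - t\<^sup>2) = b\<^sup>2 - t\<^sup>2"
    proof -
      have "(b - t) * (b + t) \<ge> 0" using that by simp
      then show ?thesis by (simp add: power2_eq_square algebra_simps)
    qed
    have xt: "b * (x - t) \<noteq> 0" using x that b by auto
    have "(r * sqrt (b\<^sup>2 - t\<^sup>2) / (b * (x - t)))\<^sup>2 = (r * r) * (sqrt (b\<^sup>2 - t\<^sup>2) * sqrt (b\<^sup>2 - t\<^sup>2)) / (b * (x - t))\<^sup>2"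
      by (simp only: power2_eq_square times_divide_times_eq mult_ac)
    also have "\<dots> = ((b * (x - t))\<^sup>2 - (x * t - b\<^sup>2)\<^sup>2) / (b * (x - t))\<^sup>2"
      unfolding r w by (simp add: power2_eq_square algebra_simps)
    also have "\<dots> = 1 - (?q t)\<^sup>2"
    proof -
      have "(u\<^sup>2 - v\<^sup>2) / u\<^sup>2 = 1 - (v / u)\<^sup>2" if "u \<noteq> 0" for u v :: real
        using that by (simp add: diff_divide_distrib power_divide)
      then show ?thesis using xt .
    qed
    finally show ?thesis by simp
  qed
  have q2: "-1 \<le> ?q t \<and> ?q t \<le> 1" if "t \<in> {-b..b}" for t
  proof -
    have "(?q t)\<^sup>2 \<le> 1" using q1[OF that] zero_le_power2[of "r * sqrt (b\<^sup>2 - t\<^sup>2) / (b * (x - t))"] by linarith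
    then have "\<bar>?q t\<bar> \<le> \<bar>1\<bar>" unfolding abs_le_square_iff by simp
    then show ?thesis unfolding abs_one by (simp only: abs_le_iff minus_le_iff)
  qed
  let ?F = "\<lambda>t. sqrt (b\<^sup>2 - t\<^sup>2) - x * arcsin (t / b) + r * arcsin (?q t)"
  have "((\<lambda>t. sqrt (b\<^sup>2 - t\<^sup>2) / (t - x)) has_integral (?F b - ?F (-b))) {-b..b}"
  proof (rule fundamental_theorem_of_calculus_interior)
    show "continuous_on {-b..b} ?F"
      using b x q2 by (intro continuous_intros ballI) (auto simp: field_simps)
  next
    fix t assume t: "t \<in> {-b<..<b}"
    let ?w = "sqrt (b\<^sup>2 - t\<^sup>2)"
    have w: "?w > 0" "?w * ?w = b\<^sup>2 - t\<^sup>2" using disc_pos[OF t] by auto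
    have xt: "x - t > 0" using x t by auto
    have "0 < 1 - (?q t)\<^sup>2" using q1[of t] t r w b xt by (simp add: zero_less_power2)
    then have q: "-1 < ?q t" "?q t < 1"
      using abs_square_less_1[of "?q t"] abs_less_iff[of "?q t" 1] by (simp_all only: less_diff_eq add_0_left minus_less_iff)
    have s: "sqrt (1 - (?q t)\<^sup>2) = r * ?w / (b * (x - t))"
      using q1[of t] t r w b xt by (simp add: real_sqrt_abs)
    have "(?q has_real_derivative (x * (b * (x - t)) - (x * t - b\<^sup>2) * (- b)) / (b * (x - t))\<^sup>2) (at t)"
      using b xt by (auto intro!: derivative_eq_intros simp: power2_eq_square)
    also have "(x * (b * (x - t)) - (x * t - b\<^sup>2) * (- b)) = b * (r * r)"
      unfolding r by (simp add: power2_eq_square algebra_simps)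
    finally have dq: "(?q has_real_derivative b * (r * r) / (b * (x - t))\<^sup>2) (at t)" .
    have "((\<lambda>t. arcsin (?q t)) has_real_derivative inverse (sqrt (1 - (?q t)\<^sup>2)) * (b * (r * r) / (b * (x - t))\<^sup>2)) (at t)"
      by (rule DERIV_chain2[OF DERIV_arcsin[OF q] dq])
    also have "inverse (sqrt (1 - (?q t)\<^sup>2)) * (b * (r * r) / (b * (x - t))\<^sup>2) = r / (?w * (x - t))"
    proof -
      have "inverse (r * w / (b * X)) * (b * (r * r) / (b * X)\<^sup>2) = r / (w * X)"
        if "r \<noteq> 0" "w \<noteq> 0" "b \<noteq> 0" "X \<noteq> 0" for r w b X :: real
        using that by (simp add: field_simps power2_eq_square)
      from this[of r ?w b "x - t"] show ?thesis unfolding s using r(1) w(1) b xt by simp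
    qed
    finally have da: "((\<lambda>t. arcsin (?q t)) has_real_derivative r / (?w * (x - t))) (at t)" .
    have "(?F has_real_derivative (- t / ?w - x * (1 / ?w) + r * (r / (?w * (x - t))))) (at t)"
      by (intro DERIV_add DERIV_diff DERIV_cmult arcsin_scaled_deriv sqrt_disc_deriv da t)
    also have "(- t / ?w - x * (1 / ?w) + r * (r / (?w * (x - t)))) = (- (t + x) * (x - t) + r * r) / (?w * (x - t))"
    proof -
      have "- t / w - x * (1 / w) + r * (r / (w * X)) = (- (t + x) * X + r * r) / (w * X)"
        if "w \<noteq> 0" "X \<noteq> 0" for w X :: real using that by (simp add: field_simps)
      then show ?thesis using w(1) xt by simp
    qed
    also have "\<dots> = - (?w * ?w) / (?w * (x - t))"
      unfolding w r by (simp add: power2_eq_square algebra_simps)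
    also have "\<dots> = ?w / (t - x)"
    proof -
      have "- (w * w) / (w * X) = w / (- X)" if "w \<noteq> 0" for w X :: real using that by simp
      from this[of ?w "x - t"] show ?thesis using w(1) by (simp only: minus_diff_eq)
    qed
    finally show "(?F has_vector_derivative ?w / (t - x)) (at t)"
      by (simp add: has_real_derivative_iff_has_vector_derivative)
  qed (use b in auto)
  moreover have "?q b = 1"
  proof -
    have "b * (x - b) \<noteq> 0" using b x by auto
    then show ?thesis by (simp add: divide_eq_eq power2_eq_square algebra_simps)
  qed
  then have "?F b = r * (pi / 2) - x * (pi / 2)"
    using b by (simp only: arcsin_1) simp
  moreover have "?q (- b) = - 1"
  proof -
    have "b * (x - (- b)) \<noteq> 0" using b x by auto
    then show ?thesis unfolding divide_eq_eq by (simp add: power2_eq_square algebra_simps)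
  qed
  then have "?F (- b) = x * (pi / 2) - r * (pi / 2)"
    using b by (simp only: arcsin_minus_1) simp
  ultimately have "((\<lambda>t. sqrt (b\<^sup>2 - t\<^sup>2) / (t - x)) has_integral
      ((r * (pi / 2) - x * (pi / 2)) - (x * (pi / 2) - r * (pi / 2)))) {-b..b}"
    by simp
  also have "(r * (pi / 2) - x * (pi / 2)) - (x * (pi / 2) - r * (pi / 2)) = pi * (r - x)"
    by (simp add: algebra_simps)
  finally show ?thesis by (simp only: r_def)
qed

end

section \<open>Normalisation and Stieltjes transform of the semicircle\<close>

lemma beta_d_pos: "d \<ge> 2 \<Longrightarrow> beta_d d > 0"
  by (simp add: beta_d_def)

lemma prob_space_semicircle:
  assumes "d \<ge> 2"
  shows "prob_space (semicircle_d d)"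
proof
  let ?b = "beta_d d"
  let ?c = "2 / (pi * ?b\<^sup>2)"
  have b: "?b > 0" by (rule beta_d_pos[OF assms])
  have "((\<lambda>t. ?c * sqrt (?b\<^sup>2 - t\<^sup>2)) has_integral (?c * (pi * ?b\<^sup>2 / 2))) {-?b..?b}"
    by (intro has_integral_mult_right semicircle_area b)
  then have "((\<lambda>t. if t \<in> {-?b..?b} then ?c * sqrt (?b\<^sup>2 - t\<^sup>2) else 0) has_integral 1) UNIV"
    unfolding has_integral_restrict_UNIV using b by simp
  also have "(\<lambda>t. if t \<in> {-?b..?b} then ?c * sqrt (?b\<^sup>2 - t\<^sup>2) else 0) = (\<lambda>t. ?c * sqrt (max 0 (?b\<^sup>2 - t\<^sup>2)))"
  proof
    fix x
    have "x \<in> {-?b..?b} \<longleftrightarrow> \<bar>x\<bar> \<le> \<bar>?b\<bar>" using b by auto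
    also have "\<dots> \<longleftrightarrow> x\<^sup>2 \<le> ?b\<^sup>2" by (rule abs_le_square_iff)
    finally show "(if x \<in> {-?b..?b} then ?c * sqrt (?b\<^sup>2 - x\<^sup>2) else 0) = ?c * sqrt (max 0 (?b\<^sup>2 - x\<^sup>2))"
      by auto
  qed
  finally have "(\<integral>\<^sup>+t. ennreal (?c * sqrt (max 0 (?b\<^sup>2 - t\<^sup>2))) \<partial>lborel) = ennreal 1"
    by (intro nn_integral_has_integral_lborel) auto
  then show "emeasure (semicircle_d d) (space (semicircle_d d)) = 1"
    by (simp add: semicircle_d_def emeasure_density)
qed

lemma real_distribution_semicircle: "d \<ge> 2 \<Longrightarrow> real_distribution (semicircle_d d)"
  unfolding real_distribution_def real_distribution_axioms_def
  using prob_space_semicircle by (simp add: semicircle_d_def)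

text \<open>Only the square of the root enters, so this identity holds for either branch;
  \<open>norm_m_d_le\<close> is what distinguishes them.\<close>

lemma m_d_quadratic:
  assumes "z \<noteq> 0" "d \<ge> 2"
  shows "z * m_d d z = - 1 - complex_of_real ((beta_d d)\<^sup>2 / 4) * (m_d d z)\<^sup>2"
proof -
  let ?b = "complex_of_real (beta_d d)"
  define q where "q = csqrt (1 - ?b\<^sup>2 / z\<^sup>2)"
  have b: "?b \<noteq> 0" using beta_d_pos[OF assms(2)] by simp
  have "q\<^sup>2 = 1 - ?b\<^sup>2 / z\<^sup>2" by (simp add: q_def)
  then have q: "?b\<^sup>2 = z\<^sup>2 * (1 - q\<^sup>2)" using assms by (simp add: field_simps)
  have m: "m_d d z = 2 / ?b\<^sup>2 * (- z + z * q)" by (simp add: m_d_def q_def)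
  have "(z * m_d d z + 1 + ?b\<^sup>2 / 4 * (m_d d z)\<^sup>2) * ?b\<^sup>2
      = 2 * z * (- z + z * q) + ?b\<^sup>2 + (- z + z * q)\<^sup>2"
    unfolding m using b by (simp add: power_mult_distrib power_divide field_simps power2_eq_square)
  also have "\<dots> = 0" unfolding q by (simp add: power2_eq_square algebra_simps)
  finally have "z * m_d d z + 1 + ?b\<^sup>2 / 4 * (m_d d z)\<^sup>2 = 0" using b by simp
  then have "z * m_d d z + (1 + ?b\<^sup>2 / 4 * (m_d d z)\<^sup>2) = 0" by (simp only: add.assoc)
  then have "z * m_d d z = - (1 + ?b\<^sup>2 / 4 * (m_d d z)\<^sup>2)" by (rule eq_neg_iff_add_eq_0[THEN iffD2])
  then show ?thesis by simp
qed

text \<open>Both sides are holomorphic off the support and agree on the real half-line to its right,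
  so the identity theorem extends the real computation; this also confirms the branch chosen in
  \<open>m_d\<close>.\<close>

lemma stieltjes_semicircle:
  assumes d: "d \<ge> 2" and z: "z \<notin> complex_of_real ` {- beta_d d .. beta_d d}"
  shows "(\<integral>t. 1 / (complex_of_real t - z) \<partial>semicircle_d d) = m_d d z"
proof -
  define b where "b = beta_d d"
  have b: "b > 0" using beta_d_pos[OF d] by (simp add: b_def)
  define c where "c = 2 / (pi * b\<^sup>2)"
  define S where "S = - (complex_of_real ` {-b..b})"
  define L where "L z = integral (cbox (-b) b) (\<lambda>t. (c * sqrt (b\<^sup>2 - t\<^sup>2)) *\<^sub>R (1 / (complex_of_real t - z)))" for z
  have nz: "complex_of_real t - z \<noteq> 0" if "z \<in> S" "t \<in> {-b..b}" for z t
    using that by (auto simp: S_def)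
  have int_L: "(\<integral>t. 1 / (complex_of_real t - z) \<partial>semicircle_d d) = L z" if "z \<in> S" for z
    unfolding L_def c_def b_def cbox_interval
    by (rule integral_semicircle_eq) (use nz[OF that] in \<open>auto intro!: continuous_intros simp: b_def\<close>)
  have comp: "compact (complex_of_real ` {-b..b})"
    by (intro compact_continuous_image continuous_intros) auto
  have S_open: "open S" unfolding S_def using comp by (simp add: compact_imp_closed open_Compl)
  \<comment> \<open>The complement of a bounded convex set in the plane is connected, which the
    identity theorem requires.\<close>
  have S_conn: "connected S" unfolding S_def
    by (rule connected_complement_bounded_convex)
       (use comp in \<open>auto simp: compact_imp_bounded intro!: convex_linear_image bounded_linear.linear bounded_linear_of_real\<close>)
  have L_hol: "L holomorphic_on S"
    unfolding holomorphic_on_open[OF S_open]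
  proof
    fix z assume "z \<in> S"
    then obtain e where e: "e > 0" "ball z e \<subseteq> S" using S_open open_contains_ball by blast
    have nz': "complex_of_real t - x \<noteq> 0" if "x \<in> ball z e" "t \<in> {-b..b}" for x t
      using that nz[of x t] e by blast
    \<comment> \<open>Differentiation under the integral asks for a convex domain; \<open>S\<close>
      is not convex, hence the ball.\<close>
    have "(L has_field_derivative integral (cbox (-b) b) (\<lambda>t. (c * sqrt (b\<^sup>2 - t\<^sup>2)) *\<^sub>R (1 / (complex_of_real t - z)\<^sup>2)))
       (at z within ball z e)"
      unfolding L_def
    proof (rule leibniz_rule_field_derivative)
      fix x t assume "x \<in> ball z e" "t \<in> cbox (-b) b"
      then have "complex_of_real t - x \<noteq> 0" using nz'[of x t] by simp
      then show "((\<lambda>x. (c * sqrt (b\<^sup>2 - t\<^sup>2)) *\<^sub>R (1 / (complex_of_real t - x))) has_field_derivative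
            (c * sqrt (b\<^sup>2 - t\<^sup>2)) *\<^sub>R (1 / (complex_of_real t - x)\<^sup>2)) (at x within ball z e)"
        unfolding scaleR_conv_of_real
        by (auto intro!: derivative_eq_intros simp: power2_eq_square)
    next
      fix x assume "x \<in> ball z e"
      then show "(\<lambda>t. (c * sqrt (b\<^sup>2 - t\<^sup>2)) *\<^sub>R (1 / (complex_of_real t - x))) integrable_on cbox (-b) b"
        using nz'[of x] by (intro integrable_continuous continuous_intros) auto
    next
      show "continuous_on (ball z e \<times> cbox (-b) b) (\<lambda>(x, t). (c * sqrt (b\<^sup>2 - t\<^sup>2)) *\<^sub>R (1 / (complex_of_real t - x)\<^sup>2))"
        unfolding case_prod_unfold using nz' by (intro continuous_intros) auto
    qed (use e in auto)
    then show "\<exists>f'. (L has_field_derivative f') (at z)"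
      using e at_within_open[of z "ball z e"] by auto
  qed
  have S0: "z \<noteq> 0" if "z \<in> S" for z using that b by (auto simp: S_def image_iff)
  \<comment> \<open>The principal root is singular only where its argument is a nonpositive real r;
    then z^2 = b^2/(1 - r), so z is real with |z| <= b and lies on the removed segment.\<close>
  have cut: "1 - (complex_of_real b)\<^sup>2 / z\<^sup>2 \<notin> \<real>\<^sub>\<le>\<^sub>0" if "z \<in> S" for z
  proof
    assume "1 - (complex_of_real b)\<^sup>2 / z\<^sup>2 \<in> \<real>\<^sub>\<le>\<^sub>0"
    then obtain r where r: "r \<le> 0" "1 - (complex_of_real b)\<^sup>2 / z\<^sup>2 = complex_of_real r"
      by (auto elim!: nonpos_Reals_cases)
    have "z\<^sup>2 * complex_of_real (1 - r) = (complex_of_real b)\<^sup>2"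
    proof -
      have "complex_of_real (1 - r) = (complex_of_real b)\<^sup>2 / z\<^sup>2"
        unfolding of_real_diff r(2)[symmetric] by simp
      then show ?thesis using S0[OF that] by simp
    qed
    moreover have "complex_of_real (1 - r) \<noteq> 0" using r(1) by (simp del: of_real_diff)
    ultimately have "z\<^sup>2 = (complex_of_real b)\<^sup>2 / complex_of_real (1 - r)" by (metis nonzero_eq_divide_eq)
    then have "z\<^sup>2 = complex_of_real (b\<^sup>2 / (1 - r))" by (simp only: of_real_divide of_real_power)
    also have "b\<^sup>2 / (1 - r) = (b / sqrt (1 - r))\<^sup>2" using r(1) by (simp add: power_divide)
    also have "complex_of_real \<dots> = (complex_of_real (b / sqrt (1 - r)))\<^sup>2" by (rule of_real_power)
    finally have "z = complex_of_real (b / sqrt (1 - r)) \<or> z = - complex_of_real (b / sqrt (1 - r))"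
      by (simp add: power2_eq_iff)
    then have "z = complex_of_real (b / sqrt (1 - r)) \<or> z = complex_of_real (- (b / sqrt (1 - r)))"
      by simp
    moreover have "b / sqrt (1 - r) \<le> b" "b / sqrt (1 - r) \<ge> 0"
      using b r(1) by (simp_all add: divide_le_eq mult_le_cancel_left1)
    then have "b / sqrt (1 - r) \<in> {-b..b}" "- (b / sqrt (1 - r)) \<in> {-b..b}" using b by auto
    ultimately show False using that unfolding S_def by blast
  qed
  have m_hol: "m_d d holomorphic_on S"
  proof -
    have "(\<lambda>z. csqrt (1 - (complex_of_real b)\<^sup>2 / z\<^sup>2)) holomorphic_on S"
      using cut S0 by (intro holomorphic_on_compose_gen[of _ S csqrt "- \<real>\<^sub>\<le>\<^sub>0", unfolded o_def]
         holomorphic_intros holomorphic_on_csqrt) auto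
    then have "(\<lambda>z. 2 / (complex_of_real b)\<^sup>2 * (- z + z * csqrt (1 - (complex_of_real b)\<^sup>2 / z\<^sup>2))) holomorphic_on S"
      by (intro holomorphic_on_mult holomorphic_on_add holomorphic_on_minus holomorphic_on_const holomorphic_on_ident)
    then show ?thesis unfolding m_d_def b_def[symmetric] .
  qed
  have eq: "L (complex_of_real x) = m_d d (complex_of_real x)" if x: "x > b" for x
  proof -
    have "((\<lambda>t. c * (sqrt (b\<^sup>2 - t\<^sup>2) / (t - x))) has_integral (c * (pi * (sqrt (x\<^sup>2 - b\<^sup>2) - x)))) {-b..b}"
      by (intro has_integral_mult_right semicircle_stieltjes_real b x)
    then have "((\<lambda>t. complex_of_real (c * (sqrt (b\<^sup>2 - t\<^sup>2) / (t - x)))) has_integral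
        complex_of_real (c * (pi * (sqrt (x\<^sup>2 - b\<^sup>2) - x)))) {-b..b}"
      by (rule has_integral_of_real)
    then have "L (complex_of_real x) = complex_of_real (c * (pi * (sqrt (x\<^sup>2 - b\<^sup>2) - x)))"
      unfolding L_def cbox_interval by (intro integral_unique) (simp add: scaleR_conv_of_real)
    also have "c * (pi * (sqrt (x\<^sup>2 - b\<^sup>2) - x)) = 2 / b\<^sup>2 * (- x + sqrt (x\<^sup>2 - b\<^sup>2))"
      by (simp add: c_def)
    also have "sqrt (x\<^sup>2 - b\<^sup>2) = x * sqrt (1 - b\<^sup>2 / x\<^sup>2)"
    proof -
      have "x\<^sup>2 - b\<^sup>2 = x\<^sup>2 * (1 - b\<^sup>2 / x\<^sup>2)" using x b by (simp add: field_simps)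
      then show ?thesis using x b by (simp add: real_sqrt_mult)
    qed
    also have "complex_of_real (2 / b\<^sup>2 * (- x + x * sqrt (1 - b\<^sup>2 / x\<^sup>2))) = m_d d (complex_of_real x)"
    proof -
      have "b\<^sup>2 \<le> x\<^sup>2" using x b by (intro power_mono) auto
      then have "1 - b\<^sup>2 / x\<^sup>2 \<ge> 0" using x b by simp
      then have "csqrt (complex_of_real (1 - b\<^sup>2 / x\<^sup>2)) = complex_of_real (sqrt (1 - b\<^sup>2 / x\<^sup>2))"
        using csqrt_of_real_nonneg[of "complex_of_real y" for y, OF Im_complex_of_real] unfolding Re_complex_of_real by blast
      then show ?thesis unfolding m_d_def b_def[symmetric] by simp
    qed
    finally show ?thesis .
  qed
  let ?U = "complex_of_real ` {b<..}"
  have US: "?U \<subseteq> S" by (auto simp: S_def)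
  have "L z - m_d d z = 0"
  proof (rule analytic_continuation[of "\<lambda>z. L z - m_d d z" S ?U "complex_of_real (b + 1)"])
    show "(\<lambda>z. L z - m_d d z) holomorphic_on S" by (intro holomorphic_intros L_hol m_hol)
    show "complex_of_real (b + 1) islimpt ?U"
      unfolding islimpt_approachable
    proof (intro allI impI)
      fix e :: real assume "e > 0"
      then show "\<exists>x'\<in>?U. x' \<noteq> complex_of_real (b + 1) \<and> dist x' (complex_of_real (b + 1)) < e"
        by (intro bexI[of _ "complex_of_real (b + 1 + e / 2)"]) (auto simp: dist_of_real dist_real_def image_iff simp del: of_real_add)
    qed
    show "z \<in> S" using z by (simp add: S_def b_def)
    show "complex_of_real (b + 1) \<in> S" by (rule subsetD[OF US], rule imageI) simp
  qed (use S_open S_conn US eq in auto)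
  moreover have "z \<in> S" using z by (simp add: S_def b_def)
  ultimately show ?thesis using int_L by simp
qed

section \<open>Almost sure convergence\<close>

text \<open>By monotone convergence the series of the \<open>X n\<close> has finite integral, so it
  converges almost everywhere and its terms tend to 0.\<close>

lemma AE_tendsto_0_of_summable_integral:
  fixes X :: "nat \<Rightarrow> 'a \<Rightarrow> real"
  assumes int: "\<And>n. integrable M (X n)" and nonneg: "\<And>n x. X n x \<ge> 0"
    and summ: "summable (\<lambda>n. \<integral>x. X n x \<partial>M)"
  shows "AE x in M. (\<lambda>n. X n x) \<longlonglongrightarrow> 0"
proof -
  have [measurable]: "X n \<in> borel_measurable M" for n using int by auto
  have "(\<integral>\<^sup>+x. (\<Sum>n. ennreal (X n x)) \<partial>M) = (\<Sum>n. \<integral>\<^sup>+x. ennreal (X n x) \<partial>M)"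
    by (rule nn_integral_suminf) simp
  also have "\<dots> = (\<Sum>n. ennreal (\<integral>x. X n x \<partial>M))"
    using int nonneg by (simp add: nn_integral_eq_integral)
  also have "\<dots> = ennreal (\<Sum>n. \<integral>x. X n x \<partial>M)"
    using nonneg summ by (intro suminf_ennreal2) auto
  finally have "(\<integral>\<^sup>+x. (\<Sum>n. ennreal (X n x)) \<partial>M) \<noteq> \<infinity>" by simp
  then have "AE x in M. (\<Sum>n. ennreal (X n x)) \<noteq> \<infinity>"
    by (intro nn_integral_noteq_infinite) simp_all
  then show ?thesis
  proof eventually_elim
    case (elim x)
    then have "summable (\<lambda>n. X n x)"
      using nonneg by (intro summable_suminf_not_top) (auto simp: infinity_ennreal_def)
    then show ?case by (rule summable_LIMSEQ_zero)
  qed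
qed

text \<open>A probability mass function carries the discrete sigma-algebra, whereas
  \<open>real_distribution\<close> demands the Borel one; the identity map changes it.\<close>

lemma real_distribution_pmf: "real_distribution (distr (measure_pmf p) borel (\<lambda>x. x))"
proof -
  have "prob_space (distr (measure_pmf p) borel (\<lambda>x. x))"
    by (intro prob_space.prob_space_distr measure_pmf.prob_space_axioms) simp
  then show ?thesis unfolding real_distribution_def real_distribution_axioms_def by simp
qed

text \<open>Weak convergence is defined through distribution functions, which the change of
  sigma-algebra preserves.\<close>

lemma weak_conv_m_pmf_iff:
  "weak_conv_m (\<lambda>n. distr (measure_pmf (p n)) borel (\<lambda>x. x)) M \<longleftrightarrow> weak_conv_m (\<lambda>n. measure_pmf (p n)) M"
proof -
  have "cdf (distr (measure_pmf q) borel (\<lambda>x. x)) = cdf (measure_pmf q)" for q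
    by (simp add: fun_eq_iff cdf_def measure_distr)
  then show ?thesis by (simp add: weak_conv_m_def)
qed

text \<open>Above height 1 the kernel is 1-Lipschitz in y, uniformly in t and hence over all
  probability measures, so a nearby rational height is as good as y.\<close>

lemma cauchy_ker_tendsto_of_rational:
  assumes \<mu>: "\<And>n. real_distribution (\<mu> n)" and M: "real_distribution M"
    and conv: "\<And>q :: rat. real_of_rat q \<ge> 2 \<Longrightarrow>
      (\<lambda>n. \<integral>t. cauchy_ker (real_of_rat q) t \<partial>\<mu> n) \<longlonglongrightarrow> (\<integral>t. cauchy_ker (real_of_rat q) t \<partial>M)"
    and y: "y > 2"
  shows "(\<lambda>n. \<integral>t. cauchy_ker y t \<partial>\<mu> n) \<longlonglongrightarrow> (\<integral>t. cauchy_ker y t \<partial>M)"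
proof (rule tendsto_by_approx)
  fix e :: real assume "e > 0"
  then obtain q :: rat where q: "y < real_of_rat q" "real_of_rat q < y + e"
    using of_rat_dense[of y "y + e"] by auto
  define h where "h = real_of_rat q - y"
  have h: "h > 0" "h \<le> e" "real_of_rat q = y + h" using q by (auto simp: h_def)
  have close: "cmod ((\<integral>t. cauchy_ker y t \<partial>\<nu>) - (\<integral>t. cauchy_ker (y + h) t \<partial>\<nu>)) \<le> e" if "real_distribution \<nu>" for \<nu>
  proof -
    interpret \<nu>: real_distribution \<nu> by fact
    have i: "integrable \<nu> (cauchy_ker y)" "integrable \<nu> (cauchy_ker (y + h))"
      using \<nu>.integrable_cauchy_ker_power[of y 1] \<nu>.integrable_cauchy_ker_power[of "y + h" 1] y h by auto
    have "(\<integral>t. cauchy_ker y t \<partial>\<nu>) - (\<integral>t. cauchy_ker (y + h) t \<partial>\<nu>) = (\<integral>t. cauchy_ker y t - cauchy_ker (y + h) t \<partial>\<nu>)"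
      using i by simp
    also have "cmod \<dots> \<le> (\<integral>t. e \<partial>\<nu>)"
    proof (rule Bochner_Integration.integral_norm_bound_integral)
      fix t
      have k: "cmod (cauchy_ker y t) \<le> 1" "cmod (cauchy_ker (y + h) t) \<le> 1"
        using norm_cauchy_ker_le[of y t] norm_cauchy_ker_le[of "y + h" t] y h
        by (auto elim!: order_trans simp: divide_le_eq)
      have "cmod (cauchy_ker y t - cauchy_ker (y + h) t) = h * (cmod (cauchy_ker y t) * cmod (cauchy_ker (y + h) t))"
        using y h cauchy_ker_diff[of y h t] by (subst norm_minus_commute) (simp add: norm_mult)
      also have "\<dots> \<le> h * (1 * 1)"
        using h k by (intro mult_left_mono mult_mono) auto
      finally show "cmod (cauchy_ker y t - cauchy_ker (y + h) t) \<le> e" using h by simp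
    qed (use i in auto)
    also have "\<dots> = e" using \<nu>.prob_space by simp
    finally show ?thesis .
  qed
  have "(\<lambda>n. \<integral>t. cauchy_ker (y + h) t \<partial>\<mu> n) \<longlonglongrightarrow> (\<integral>t. cauchy_ker (y + h) t \<partial>M)"
    using conv[of q] y h by simp
  then show "\<exists>Y x. Y \<longlonglongrightarrow> x \<and> (\<forall>\<^sub>F n in sequentially. cmod ((\<integral>t. cauchy_ker y t \<partial>\<mu> n) - Y n) \<le> e)
      \<and> cmod ((\<integral>t. cauchy_ker y t \<partial>M) - x) \<le> e"
    using close[OF \<mu>] close[OF M] by (intro exI conjI always_eventually allI)
qed

section \<open>The semicircle transform on the imaginary axis\<close>

lemma integral_cauchy_ker_semicircle:
  assumes "d \<ge> 2" "y > 0"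
  shows "(\<integral>t. cauchy_ker y t \<partial>semicircle_d d) = m_d d (\<i> * y)"
proof -
  have "\<i> * complex_of_real y \<noteq> complex_of_real x" for x
    using assms(2) by (auto simp: complex_eq_iff)
  then have "\<i> * complex_of_real y \<notin> complex_of_real ` {- beta_d d..beta_d d}" by auto
  from stieltjes_semicircle[OF assms(1) this] show ?thesis by (simp add: cauchy_ker_def)
qed

text \<open>The kernel has modulus at most 1/y, and a probability average preserves the bound. This
  avoids estimating the complex square root and is what selects the root in
  \<open>gaussian_matrix_model\<close>.\<close>

lemma norm_m_d_le:
  assumes "d \<ge> 2" "y > 0"
  shows "cmod (m_d d (\<i> * y)) \<le> 1 / y"
proof -
  interpret real_distribution "semicircle_d d" by (rule real_distribution_semicircle[OF assms(1)])
  have "cmod (\<integral>t. cauchy_ker y t \<partial>semicircle_d d) \<le> (\<integral>t. 1 / y \<partial>semicircle_d d)"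
    using integrable_cauchy_ker_power[OF assms(2), of 1] norm_cauchy_ker_le[OF assms(2)]
    by (intro Bochner_Integration.integral_norm_bound_integral) auto
  also have "\<dots> = 1 / y" using prob_space by simp
  finally show ?thesis unfolding integral_cauchy_ker_semicircle[OF assms] .
qed

lemma m_d_equation:
  fixes y :: real
  assumes "y > 0"
  shows "\<i> * y * m_d (n + 2) (\<i> * y) = - 1 - (m_d (n + 2) (\<i> * y))\<^sup>2 / ((of_nat n + 2) * (of_nat n + 1))"
proof -
  have "(beta_d (n + 2))\<^sup>2 / 4 = 1 / ((real n + 2) * (real n + 1))"
  proof -
    have "(beta_d (n + 2))\<^sup>2 = 4 / (real (n + 2) * (real (n + 2) - 1))"
      unfolding beta_d_def power_divide by (subst real_sqrt_pow2) auto
    also have "real (n + 2) * (real (n + 2) - 1) = (real n + 2) * (real n + 1)" by (simp add: add.commute)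
    finally show ?thesis by simp
  qed
  then have b: "complex_of_real ((beta_d (n + 2))\<^sup>2 / 4) = 1 / ((of_nat n + 2) * (of_nat n + 1))"
    by simp
  have "\<i> * y * m_d (n + 2) (\<i> * y) = - 1 - complex_of_real ((beta_d (n + 2))\<^sup>2 / 4) * (m_d (n + 2) (\<i> * y))\<^sup>2"
    using assms by (intro m_d_quadratic) auto
  then show ?thesis unfolding b by simp
qed

text \<open>Moves the problem to a concrete product of Gaussian measures, where Fubini and
  integration by parts are available.\<close>

lemma GOTE_distr:
  assumes "prob_space M" and GOTE: "GOTE M d N W" and N: "N > 0"
  defines "S \<equiv> {xs \<in> tensor_idx d N. sorted xs}"
  shows "distr M (PiM S (\<lambda>_. borel)) (\<lambda>\<omega>. \<lambda>I\<in>S. W \<omega> I) = gaussian_PiM (\<lambda>I. sqrt (1 / real (num_perms I))) S"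
    and "(\<lambda>\<omega>. \<lambda>I\<in>S. W \<omega> I) \<in> M \<rightarrow>\<^sub>M PiM S (\<lambda>_. borel)"
proof -
  interpret prob_space M by fact
  let ?f = "\<lambda>I x. ennreal (normal_density 0 (sqrt (1 / real (num_perms I))) x)"
  \<comment> \<open>The product form of independence asks for a nonempty index set; here N > 0
    enters.\<close>
  have "replicate d 0 \<in> S" using N by (auto simp: S_def tensor_idx_def)
  then have S: "S \<noteq> {}" by auto
  have fin: "finite S" by (simp add: S_def)
  have indep: "indep_vars (\<lambda>_. borel) (\<lambda>xs \<omega>. W \<omega> xs) S"
    using GOTE by (simp add: GOTE_def S_def)
  have dist: "distributed M lborel (\<lambda>\<omega>. W \<omega> I) (?f I)" if "I \<in> S" for I
    using GOTE that by (simp add: GOTE_def S_def)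
  have rv: "random_variable borel (\<lambda>\<omega>. W \<omega> I)" if "I \<in> S" for I
    using distributed_measurable[OF dist[OF that]] by simp
  have "distr M (PiM S (\<lambda>_. borel)) (\<lambda>\<omega>. \<lambda>I\<in>S. W \<omega> I) = PiM S (\<lambda>I. distr M borel (\<lambda>\<omega>. W \<omega> I))"
    by (rule iffD1[OF indep_vars_iff_distr_eq_PiM'[where X = "\<lambda>I \<omega>. W \<omega> I" and M' = "\<lambda>_. borel", OF S rv] indep])
  also have "\<dots> = PiM S (\<lambda>I. density lborel (?f I))"
  proof (intro PiM_cong refl)
    fix I assume "I \<in> S"
    have "distr M borel (\<lambda>\<omega>. W \<omega> I) = distr M lborel (\<lambda>\<omega>. W \<omega> I)"
      by (intro distr_cong) auto
    also have "\<dots> = density lborel (?f I)" by (rule distributed_distr_eq_density[OF dist[OF \<open>I \<in> S\<close>]])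
    finally show "distr M borel (\<lambda>\<omega>. W \<omega> I) = density lborel (?f I)" .
  qed
  also have "\<dots> = gaussian_PiM (\<lambda>I. sqrt (1 / real (num_perms I))) S"
    by (subst gaussian_PiM_def) (use num_perms_pos fin in auto)
  finally show "distr M (PiM S (\<lambda>_. borel)) (\<lambda>\<omega>. \<lambda>I\<in>S. W \<omega> I) = gaussian_PiM (\<lambda>I. sqrt (1 / real (num_perms I))) S" .
  show "(\<lambda>\<omega>. \<lambda>I\<in>S. W \<omega> I) \<in> M \<rightarrow>\<^sub>M PiM S (\<lambda>_. borel)"
    by (intro measurable_restrict rv)
qed

text \<open>Instantiates the model with the standard deviations of the independent tensor entries.
  The rescaling by 1 / sqrt N is put into the coefficients \<open>C\<close>, which gives the 1/N in
  the covariance; the moment bound then returns to \<open>M\<close> through the joint law.\<close>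

lemma stieltjes_contract_mat_second_moment:
  fixes y :: real and n N :: nat
  assumes M: "prob_space M" and GOTE: "GOTE M (n + 2) N W" and N: "N > 0" and y: "y \<ge> 2"
    and v: "(\<Sum>i<N. (v i)\<^sup>2) = 1"
  defines "X \<equiv> \<lambda>\<omega>. (cmod ((\<integral>t. cauchy_ker y t \<partial>empirical_spectral_measure
      (contract_mat (n + 2) N (\<lambda>xs. W \<omega> xs / sqrt (real N)) v)) - m_d (n + 2) (\<i> * y)))\<^sup>2"
  shows "integrable M X" and
    "(\<integral>\<omega>. X \<omega> \<partial>M) \<le> ((1 + 4 * real n + (real n)\<^sup>2)\<^sup>2 / 2 + (2 + 4 * real n + (real n)\<^sup>2)) / (real N)\<^sup>2"
proof -
  define \<sigma> where "\<sigma> = (\<lambda>I. sqrt (1 / real (num_perms I)))"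
  define S where "S = {xs \<in> tensor_idx (n + 2) N. sorted xs}"
  define C where "C = (\<lambda>I i j. contr_coeff n N v I i j / sqrt (real N))"
  define m where "m = m_d (n + 2) (\<i> * complex_of_real y)"
  have S_fin: "finite S" by (simp add: S_def)
  interpret G: gaussian_matrix_model \<sigma> S C N n v y m
  proof
    show "\<sigma> I > 0" for I using num_perms_pos[of I] by (simp add: \<sigma>_def)
    show "C I i j = C I j i" for I i j unfolding C_def by (subst contr_coeff_sym) (rule refl)
    show "(\<Sum>I\<in>S. (\<sigma> I)\<^sup>2 * (C I i j * C I k l)) = contr_cov v n i j k l / real N"
      if "i < N" "j < N" "k < N" "l < N" for i j k l
    proof -
      have "(\<sigma> I)\<^sup>2 * (C I i j * C I k l) = contr_coeff n N v I i j * contr_coeff n N v I k l / real (num_perms I) / real N" for I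
        using N num_perms_pos[of I] by (simp add: \<sigma>_def C_def power_divide real_sqrt_divide)
      then show ?thesis
        unfolding S_def using sum_contr_coeff_cov[OF v that, of n] by (simp only: sum_divide_distrib[symmetric])
    qed
    show "\<i> * y * m = - 1 - m\<^sup>2 / ((of_nat n + 2) * (of_nat n + 1))"
      unfolding m_def by (rule m_d_equation) (use y in simp)
    show "cmod m \<le> 1 / y" unfolding m_def by (rule norm_m_d_le) (use y in simp_all)
  qed (use v N y S_fin in auto)
  let ?r = "\<lambda>\<omega>. \<lambda>I\<in>S. W \<omega> I"
  note distr = GOTE_distr(1)[OF M GOTE N, folded S_def \<sigma>_def]
  note meas = GOTE_distr(2)[OF M GOTE N, folded S_def]
  have X: "X \<omega> = (cmod (G.D (?r \<omega>)))\<^sup>2" for \<omega>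
  proof -
    define A where "A = contract_mat (n + 2) N (\<lambda>xs. W \<omega> xs / sqrt (real N)) v"
    have carrier: "A \<in> carrier_mat N N" by (simp add: A_def contract_mat_def)
    have entry: "A $$ (i, j) = G.H (?r \<omega>) i j" if "i < N" "j < N" for i j
    proof -
      \<comment> \<open>Permutation symmetry of the tensor replaces each entry by its sorted
        representative.\<close>
      have "W \<omega> (xs @ [i, j]) = W \<omega> (sort (xs @ [i, j]))" if "xs \<in> tensor_idx n N" for xs
      proof -
        have "sort (xs @ [i, j]) \<in> tensor_idx (n + 2) N"
          using that \<open>i < N\<close> \<open>j < N\<close> by (auto simp: tensor_idx_def)
        moreover have "mset (xs @ [i, j]) = mset (sort (xs @ [i, j]))" by simp
        ultimately show ?thesis using GOTE unfolding GOTE_def by blast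
      qed
      then have "A $$ (i, j) = (\<Sum>xs\<in>tensor_idx n N. W \<omega> (sort (xs @ [i, j])) * mset_monom v (mset xs)) / sqrt (real N)"
        using that by (simp add: A_def contract_mat_def prod_nth_eq_mset_monom sum_divide_distrib)
      also have "\<dots> = (\<Sum>I\<in>S. W \<omega> I * contr_coeff n N v I i j) / sqrt (real N)"
        unfolding S_def by (subst sum_contr_coeff[OF that]) (rule refl)
      also have "\<dots> = G.H (?r \<omega>) i j"
        unfolding G.H_def by (simp add: C_def sum_divide_distrib)
      finally show ?thesis .
    qed
    have sym: "A $$ (i, j) = A $$ (j, i)" if "i < N" "j < N" for i j
      unfolding entry[OF that] entry[OF that(2,1)] by (rule G.H_sym)
    \<comment> \<open>\<open>resolvent\<close> depends on its matrix only through
      \<open>shift_mat\<close>, so agreement of entries below N is enough.\<close>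
    have shift: "shift_mat N z (\<lambda>i j. A $$ (i, j)) = shift_mat N z (G.H (?r \<omega>))" for z
      unfolding shift_mat_def by (intro eq_matI) (auto simp: entry)
    have "(\<integral>t. cauchy_ker y t \<partial>empirical_spectral_measure A)
      = (\<Sum>i<N. resolvent N (\<i> * y) (\<lambda>i j. A $$ (i, j)) i i) / of_nat N"
      unfolding cauchy_ker_def
      by (rule stieltjes_empirical_spectral_measure[OF carrier sym _ N]) (use y in auto)
    also have "\<dots> = G.s (?r \<omega>)"
      unfolding G.s_def G.R_def resolvent_def shift ..
    finally show ?thesis
      unfolding X_def A_def[symmetric] m_def[symmetric] by (simp only: G.D_def)
  qed
  have eqd: "distr M (PiM S (\<lambda>_. borel)) ?r = G.P" by (rule distr)
  have measD: "(\<lambda>g. (cmod (G.D g))\<^sup>2) \<in> borel_measurable (PiM S (\<lambda>_. borel))"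
    using borel_measurable_integrable[OF G.integrable_norm_D_sq]
    unfolding measurable_cong_sets[OF sets_gaussian_PiM[OF G.\<sigma>_pos S_fin] refl] .
  have "integrable M (\<lambda>\<omega>. (cmod (G.D (?r \<omega>)))\<^sup>2)"
    using G.integrable_norm_D_sq unfolding eqd[symmetric] integrable_distr_eq[OF meas measD] .
  then show "integrable M X" by (simp only: X[abs_def])
  have "(\<integral>\<omega>. X \<omega> \<partial>M) = (\<integral>\<omega>. (cmod (G.D (?r \<omega>)))\<^sup>2 \<partial>M)" by (simp only: X)
  also have "\<dots> = (\<integral>g. (cmod (G.D g))\<^sup>2 \<partial>G.P)"
    unfolding eqd[symmetric] by (rule integral_distr[OF meas measD, symmetric])
  also have "\<dots> \<le> (G.K1\<^sup>2 / 2 + G.K2) / (real N)\<^sup>2" by (rule G.second_moment_bound)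
  finally show "(\<integral>\<omega>. X \<omega> \<partial>M) \<le> ((1 + 4 * real n + (real n)\<^sup>2)\<^sup>2 / 2 + (2 + 4 * real n + (real n)\<^sup>2)) / (real N)\<^sup>2"
    unfolding G.K1_def G.K2_def .
qed

lemma AE_stieltjes_contract_mat_tendsto:
  fixes W :: "nat \<Rightarrow> 'w \<Rightarrow> nat list \<Rightarrow> real"
  assumes M: "prob_space M" and d: "d \<ge> 2" and GOTE: "\<And>N. GOTE M d N (W N)"
    and v: "\<And>N. N \<ge> 1 \<Longrightarrow> (\<Sum>i<N. (v N i)\<^sup>2) = 1" and y: "y \<ge> 2"
  shows "AE \<omega> in M. (\<lambda>N. \<integral>t. cauchy_ker y t \<partial>empirical_spectral_measure
      (contract_mat d N (\<lambda>xs. W N \<omega> xs / sqrt (real N)) (v N))) \<longlonglongrightarrow> (\<integral>t. cauchy_ker y t \<partial>semicircle_d d)"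
proof -
  obtain n where n: "d = n + 2" using d by (metis le_add_diff_inverse2)
  let ?I = "\<lambda>N \<omega>. \<integral>t. cauchy_ker y t \<partial>empirical_spectral_measure
      (contract_mat (n + 2) N (\<lambda>xs. W N \<omega> xs / sqrt (real N)) (v N))"
  let ?K = "(1 + 4 * real n + (real n)\<^sup>2)\<^sup>2 / 2 + (2 + 4 * real n + (real n)\<^sup>2)"
  define X where "X N \<omega> = (cmod (?I N \<omega> - m_d (n + 2) (\<i> * y)))\<^sup>2" for N \<omega>
  \<comment> \<open>The index is shifted past N = 0, where the moment bound and the normalisation of
    \<open>v\<close> say nothing; limits are unaffected.\<close>
  have X: "integrable M (X (Suc N))" "(\<integral>\<omega>. X (Suc N) \<omega> \<partial>M) \<le> ?K / (real (Suc N))\<^sup>2" for N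
    unfolding X_def[abs_def]
    by (rule stieltjes_contract_mat_second_moment[OF M GOTE[unfolded n] _ y v]; simp)+
  have "summable (\<lambda>N. 1 / (real N)\<^sup>2)"
    using inverse_power_summable[of 2, where 'a = real] by (simp add: inverse_eq_divide)
  then have "summable (\<lambda>N. ?K * (1 / (real (Suc N))\<^sup>2))"
    by (intro summable_mult summable_Suc_iff[THEN iffD2])
  then have "summable (\<lambda>N. \<integral>\<omega>. X (Suc N) \<omega> \<partial>M)"
    by (rule summable_comparison_test'[where N = 0]) (use X(2) in \<open>simp add: X_def\<close>)
  then have "AE \<omega> in M. (\<lambda>N. X (Suc N) \<omega>) \<longlonglongrightarrow> 0"
    by (intro AE_tendsto_0_of_summable_integral X) (simp add: X_def)
  then show ?thesis
  proof eventually_elim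
    case (elim \<omega>)
    from LIMSEQ_imp_Suc[OF this] have "(\<lambda>N. sqrt (X N \<omega>)) \<longlonglongrightarrow> sqrt 0"
      by (rule tendsto_real_sqrt)
    then have "(\<lambda>N. ?I N \<omega> - m_d (n + 2) (\<i> * y)) \<longlonglongrightarrow> 0"
      unfolding X_def real_sqrt_abs abs_norm_cancel real_sqrt_zero by (rule tendsto_norm_zero_cancel)
    then have "(\<lambda>N. ?I N \<omega>) \<longlonglongrightarrow> m_d (n + 2) (\<i> * y)" by (rule LIM_zero_cancel)
    moreover have "(\<integral>t. cauchy_ker y t \<partial>semicircle_d d) = m_d d (\<i> * y)"
      by (rule integral_cauchy_ker_semicircle[OF d]) (use y in simp)
    ultimately show ?case unfolding n by (simp only:)
  qed
qed

theorem theorem1: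
  fixes M :: "'w measure" and d :: nat
    and W :: "nat \<Rightarrow> 'w \<Rightarrow> nat list \<Rightarrow> real"
    and v :: "nat \<Rightarrow> nat \<Rightarrow> real"
  assumes "prob_space M"
    and "d \<ge> 3"
    and "\<And>N. GOTE M d N (W N)"
    and "\<And>N. N \<ge> 1 \<Longrightarrow> (\<Sum>i<N. (v N i)\<^sup>2) = 1"
  shows "(AE \<omega> in M. weak_conv_m
            (\<lambda>N. empirical_spectral_measure
                   (contract_mat d N (\<lambda>xs. W N \<omega> xs / sqrt (real N)) (v N)))
            (semicircle_d d))
       \<and> prob_space (semicircle_d d)
       \<and> (\<forall>z. z \<notin> complex_of_real ` {- beta_d d .. beta_d d} \<longrightarrow>
            (\<integral>t. 1 / (complex_of_real t - z) \<partial>semicircle_d d) = m_d d z)"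
proof (intro conjI allI impI)
  have d: "d \<ge> 2" using \<open>d \<ge> 3\<close> by simp
  show "prob_space (semicircle_d d)" by (rule prob_space_semicircle[OF d])
  show "(\<integral>t. 1 / (complex_of_real t - z) \<partial>semicircle_d d) = m_d d z"
    if "z \<notin> complex_of_real ` {- beta_d d .. beta_d d}" for z
    by (rule stieltjes_semicircle[OF d that])
  let ?A = "\<lambda>N \<omega>. contract_mat d N (\<lambda>xs. W N \<omega> xs / sqrt (real N)) (v N)"
  \<comment> \<open>The exceptional null set depends on the height, so countably many heights are
    collected before an outcome is fixed.\<close>
  have "AE \<omega> in M. \<forall>q :: rat. real_of_rat q \<ge> 2 \<longrightarrow>
     (\<lambda>N. \<integral>t. cauchy_ker (real_of_rat q) t \<partial>empirical_spectral_measure (?A N \<omega>))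
        \<longlonglongrightarrow> (\<integral>t. cauchy_ker (real_of_rat q) t \<partial>semicircle_d d)"
    unfolding AE_all_countable
  proof
    fix q :: rat
    show "AE \<omega> in M. real_of_rat q \<ge> 2 \<longrightarrow>
     (\<lambda>N. \<integral>t. cauchy_ker (real_of_rat q) t \<partial>empirical_spectral_measure (?A N \<omega>))
        \<longlonglongrightarrow> (\<integral>t. cauchy_ker (real_of_rat q) t \<partial>semicircle_d d)"
      using AE_stieltjes_contract_mat_tendsto[OF assms(1) d assms(3,4)] by (cases "real_of_rat q \<ge> 2") auto
  qed
  then show "AE \<omega> in M. weak_conv_m (\<lambda>N. empirical_spectral_measure (?A N \<omega>)) (semicircle_d d)"
  proof eventually_elim
    case (elim \<omega>)
    let ?\<mu> = "\<lambda>N. distr (empirical_spectral_measure (?A N \<omega>)) borel (\<lambda>x. x)"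
    have \<mu>: "real_distribution (?\<mu> N)" for N
      unfolding empirical_spectral_measure_def by (rule real_distribution_pmf)
    have sc: "real_distribution (semicircle_d d)" by (rule real_distribution_semicircle[OF d])
    have int: "(\<integral>t. cauchy_ker y t \<partial>?\<mu> N) = (\<integral>t. cauchy_ker y t \<partial>empirical_spectral_measure (?A N \<omega>))" for y N
      unfolding empirical_spectral_measure_def by (subst integral_distr) auto
    have "weak_conv_m ?\<mu> (semicircle_d d)"
    proof (rule weak_conv_of_cauchy_transforms[OF \<mu> sc, of 2])
      fix y :: real assume "y > 2"
      show "(\<lambda>N. \<integral>t. cauchy_ker y t \<partial>?\<mu> N) \<longlonglongrightarrow> (\<integral>t. cauchy_ker y t \<partial>semicircle_d d)"
        by (rule cauchy_ker_tendsto_of_rational[OF \<mu> sc _ \<open>y > 2\<close>]) (use elim in \<open>simp only: int\<close>)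
    qed simp
    then show ?case
      unfolding empirical_spectral_measure_def weak_conv_m_pmf_iff .
  qed
qed

end
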